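(* Let $\Omega\subset\mathbb{R}^N$ be a smooth bounded domain with $0\in\Omega$, let $p\in(1,N)$, $q\in(p-1,p)$, $\vartheta>0$, and let $A,B$ satisfy the structural assumptions listed in the context. Let $f\in W^{1,\infty}(\bar\Omega)$ be nonnegative and let $u\in C^1(\bar\Omega\setminus\{0\})$ be a weak solution of $$-\operatorname{div}(A(|\nabla u|)\nabla u)+B(|\nabla u|)=\vartheta\frac{u^q}{|x|^p}+f(x)\ \text{ in }\Omega,\quad u>0\ \text{ in }\Omega,\quad u=0\ \text{ on }\partial\Omega.$$ Then the critical set $Z_u=\{x\in\Omega\setminus\{0\}:\nabla u(x)=0\}$ has zero Lebesgue measure: $|Z_u|=0$.
   Context: Notation: $\mathbb{R}^+=(0,+\infty)$, $\overline{\mathbb{R}}^+=[0,+\infty)$. Weak solution means: $u\in W_0^{1,p}(\Omega)$, $u>0$, and $\int_\Omega A(|\nabla u|)(\nabla u,\nabla\varphi)\,dx+\int_\Omega B(|\nabla u|)\varphi\,dx=\vartheta\int_\Omega\frac{u^q}{|x|^p}\varphi\,dx+\int_\Omega f\varphi\,dx$ for all $\varphi\in W_0^{1,p}(\Omega)\cap L^\infty(\Omega)$. Assumptions on $A$: $A:\mathbb{R}^+\to\mathbb{R}^+$ is of class $C^1(\mathbb{R}^+)$ (with the convention that $A(|\eta|)\eta=0$ when $\eta=0$), and there are constants $K\ge 1$, $c_1,c_2>0$ such that: (i) $t\mapsto tA(t)$ is increasing; (ii) $|A(|\eta|)\eta|\le c_1|\eta|^{p-1}$ for all $\eta\in\mathbb{R}^N$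 with $|\eta|\ge K$; (iii) $[A(|\eta|)\eta-A(|\eta'|)\eta']\cdot[\eta-\eta']\ge c_2(|\eta|+|\eta'|)^{p-2}|\eta-\eta'|^2$ for all $\eta,\eta'\in\mathbb{R}^N$ (not both zero); (iv) $-1<m_A:=\inf_{t>0}\frac{tA'(t)}{A(t)}\le M_A:=\sup_{t>0}\frac{tA'(t)}{A(t)}<+\infty$. Assumptions on $B$: $B:\overline{\mathbb{R}}^+\to\overline{\mathbb{R}}^+$ is of class $C^1(\overline{\mathbb{R}}^+)$, $B(0)=0$, $B(t)\ge\sigma t^p$ for all $t\geq 0$ for some $\sigma>0$, and $B'(t)\le\hat C\,tA(t)$ for all $t>0$ for some $\hat C>0$. *)

theory Defs
  imports "HOL-Analysis.Analysis"
begin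

definition gradient :: "('a::euclidean_space \<Rightarrow> real) \<Rightarrow> 'a \<Rightarrow> 'a" where
  "gradient f x = (THE D. GDERIV f x :> D)"

primrec C_k :: "nat \<Rightarrow> ('a::euclidean_space \<Rightarrow> real) \<Rightarrow> bool" where
  "C_k 0 f \<longleftrightarrow> continuous_on UNIV f"
| "C_k (Suc k) f \<longleftrightarrow>
     (\<forall>x. f differentiable at x) \<and> (\<forall>b\<in>Basis. C_k k (\<lambda>x. frechet_derivative f (at x) b))"

definition smooth :: "('a::euclidean_space \<Rightarrow> real) \<Rightarrow> bool" where
  "smooth f \<longleftrightarrow> (\<forall>k. C_k k f)"

text \<open>
  Near each of its boundary points the domain is the region above a smooth graph, after a rotation
  of the axes: \<open>e\<close> is the unit vector of the vertical axis and \<open>x - (x \<bullet> e) *\<^sub>R e\<close> is the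
  horizontal component of \<open>x\<close>.  Only the values of \<open>\<gamma>\<close> on the hyperplane orthogonal to \<open>e\<close> matter,
  and every smooth function on that hyperplane extends to a smooth function on the whole space.
\<close>
definition smooth_bounded_domain :: "'a::euclidean_space set \<Rightarrow> bool" where
  "smooth_bounded_domain \<Omega> \<longleftrightarrow>
     open \<Omega> \<and> connected \<Omega> \<and> \<Omega> \<noteq> {} \<and> bounded \<Omega> \<and>
     (\<forall>x0\<in>frontier \<Omega>. \<exists>r>0. \<exists>e \<gamma>. norm e = 1 \<and> smooth \<gamma> \<and>
        \<Omega> \<inter> ball x0 r = {x \<in> ball x0 r. \<gamma> (x - (x \<bullet> e) *\<^sub>R e) < x \<bullet> e})"

text \<open>Continuous differentiability on \<open>closure \<Omega> - {0}\<close>: the function and its gradient in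
  \<open>\<Omega> - {0}\<close> extend continuously up to the boundary of \<open>\<Omega>\<close>.\<close>
definition C1_closure_minus_origin :: "'a::euclidean_space set \<Rightarrow> ('a \<Rightarrow> real) \<Rightarrow> bool" where
  "C1_closure_minus_origin \<Omega> u \<longleftrightarrow>
     continuous_on (closure \<Omega> - {0}) u \<and>
     (\<exists>G. continuous_on (closure \<Omega> - {0}) G \<and> (\<forall>x\<in>\<Omega> - {0}. GDERIV u x :> G x))"

definition critical_set :: "'a::euclidean_space set \<Rightarrow> ('a \<Rightarrow> real) \<Rightarrow> 'a set" where
  "critical_set \<Omega> u = {x \<in> \<Omega> - {0}. gradient u x = 0}"

definition test_functions :: "'a::euclidean_space set \<Rightarrow> ('a \<Rightarrow> real) set" where
  "test_functions \<Omega> =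
     {\<phi>. smooth \<phi> \<and> compact (closure {x. \<phi> x \<noteq> 0}) \<and> closure {x. \<phi> x \<noteq> 0} \<subseteq> \<Omega>}"

definition L_p :: "'a::euclidean_space set \<Rightarrow> real \<Rightarrow> ('a \<Rightarrow> 'b::euclidean_space) set" where
  "L_p \<Omega> p = {f. set_borel_measurable lebesgue \<Omega> f \<and>
                  set_integrable lebesgue \<Omega> (\<lambda>x. norm (f x) powr p)}"

definition L_infinity :: "'a::euclidean_space set \<Rightarrow> ('a \<Rightarrow> 'b::euclidean_space) set" where
  "L_infinity \<Omega> = {f. set_borel_measurable lebesgue \<Omega> f \<and>
                       (\<exists>M. AE x\<in>\<Omega> in lebesgue. norm (f x) \<le> M)}"

definition L1_loc :: "'a::euclidean_space set \<Rightarrow> ('a \<Rightarrow> 'b::euclidean_space) set" where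
  "L1_loc \<Omega> = {f. \<forall>K. compact K \<and> K \<subseteq> \<Omega> \<longrightarrow> set_integrable lebesgue K f}"

definition has_weak_gradient ::
    "'a::euclidean_space set \<Rightarrow> ('a \<Rightarrow> real) \<Rightarrow> ('a \<Rightarrow> 'a) \<Rightarrow> bool" where
  "has_weak_gradient \<Omega> u g \<longleftrightarrow>
     u \<in> L1_loc \<Omega> \<and> g \<in> L1_loc \<Omega> \<and>
     (\<forall>\<phi>\<in>test_functions \<Omega>.
        (LINT x:\<Omega>|lebesgue. u x *\<^sub>R gradient \<phi> x) = - (LINT x:\<Omega>|lebesgue. \<phi> x *\<^sub>R g x))"

text \<open>The closure of the test functions in the Sobolev space of exponent \<open>p\<close>; functions that agree
  almost everywhere are not identified.\<close>
definition W0_1p :: "'a::euclidean_space set \<Rightarrow> real \<Rightarrow> ('a \<Rightarrow> real) set" where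
  "W0_1p \<Omega> p =
     {u. u \<in> L_p \<Omega> p \<and>
         (\<exists>g. has_weak_gradient \<Omega> u g \<and> g \<in> L_p \<Omega> p \<and>
           (\<exists>\<phi>::nat \<Rightarrow> 'a \<Rightarrow> real. (\<forall>n. \<phi> n \<in> test_functions \<Omega>) \<and>
              (\<lambda>n. LINT x:\<Omega>|lebesgue. \<bar>\<phi> n x - u x\<bar> powr p) \<longlonglongrightarrow> 0 \<and>
              (\<lambda>n. LINT x:\<Omega>|lebesgue. norm (gradient (\<phi> n) x - g x) powr p) \<longlonglongrightarrow> 0))}"

definition W_1_infinity :: "'a::euclidean_space set \<Rightarrow> ('a \<Rightarrow> real) set" where
  "W_1_infinity \<Omega> = {f. f \<in> L_infinity \<Omega> \<and> (\<exists>g. has_weak_gradient \<Omega> f g \<and> g \<in> L_infinity \<Omega>)}"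

definition lower_index :: "(real \<Rightarrow> real) \<Rightarrow> ereal" where
  "lower_index A = (INF t\<in>{0<..}. ereal (t * deriv A t / A t))"

definition upper_index :: "(real \<Rightarrow> real) \<Rightarrow> ereal" where
  "upper_index A = (SUP t\<in>{0<..}. ereal (t * deriv A t / A t))"

text \<open>
  The weak gradient is unique up to null sets, so the choice of \<open>Du\<close> and \<open>D\<phi>\<close> is immaterial.
  Where \<open>Du x = 0\<close> the factor \<open>Du x \<bullet> D\<phi> x\<close> vanishes, so \<open>A 0\<close> plays no role.  Under the growth
  conditions on \<open>A\<close> and \<open>B\<close>, with \<open>q < p < N\<close>, all four integrands are integrable (the third one by
  the Hardy inequality), so the value \<open>0\<close> of a divergent Bochner integral never enters.
\<close>
definition weak_solution ::
    "'a::euclidean_space set \<Rightarrow> real \<Rightarrow> real \<Rightarrow> real \<Rightarrow> (real \<Rightarrow> real) \<Rightarrow> (real \<Rightarrow> real) \<Rightarrow>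
     ('a \<Rightarrow> real) \<Rightarrow> ('a \<Rightarrow> real) \<Rightarrow> bool" where
  "weak_solution \<Omega> p q \<theta> A B f u \<longleftrightarrow>
     u \<in> W0_1p \<Omega> p \<and> (AE x\<in>\<Omega> in lebesgue. 0 < u x) \<and>
     (\<exists>Du. has_weak_gradient \<Omega> u Du \<and>
       (\<forall>\<phi> D\<phi>. \<phi> \<in> W0_1p \<Omega> p \<inter> L_infinity \<Omega> \<and> has_weak_gradient \<Omega> \<phi> D\<phi> \<longrightarrow>
          (LINT x:\<Omega>|lebesgue. A (norm (Du x)) * (Du x \<bullet> D\<phi> x))
            + (LINT x:\<Omega>|lebesgue. B (norm (Du x)) * \<phi> x)
          = \<theta> * (LINT x:\<Omega>|lebesgue. u x powr q / norm x powr p * \<phi> x)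
            + (LINT x:\<Omega>|lebesgue. f x * \<phi> x)))"

end

theory Submission
  imports Defs
begin

text \<open>
  Write \<open>V = A(|\<nabla>u|)\<nabla>u\<close> and \<open>g = \<theta> u\<^sup>q/|x|\<^sup>p + f - B(|\<nabla>u|)\<close>, so that \<open>- div V = g\<close> away from the
  origin, where \<open>g\<close> is locally bounded and, since \<open>B 0 = 0\<close>, positive on the critical set.  It
  therefore suffices that \<open>div V = 0\<close> almost everywhere on the critical set, and this follows once
  \<open>V\<close> is a pointwise bounded limit of \<open>C\<^sup>1\<close> fields \<open>W\<close> that vanish near the critical set and have
  derivatives bounded in local \<open>L\<^sup>2\<close>.

  Such fields are obtained by inserting the vector \<open>D\<^sup>hu\<close> of difference quotients of \<open>u\<close> into a
  truncation of \<open>\<xi> \<mapsto> A(|\<xi>|)\<xi>\<close> that vanishes for \<open>|\<xi>| \<le> d\<close>.  The equation is tested with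
  \<open>\<Sum>\<^sub>e D\<^sup>-\<^sup>h\<^sub>e (\<eta> W\<^sub>e)\<close>.  The leading term is a small perturbation of \<open>tr (P H\<^sup>T Q H)\<close>, where \<open>P\<close> and \<open>Q\<close> are
  the derivatives of the flux and of its truncation at \<open>D\<^sup>hu\<close> and \<open>H\<close> is the derivative of \<open>D\<^sup>hu\<close>;
  because \<open>P\<close> and \<open>Q\<close> are simultaneously diagonal and \<open>Q \<le> C P\<close>, this trace dominates \<open>|Q H|\<^sup>2 = |DW|\<^sup>2\<close> with a
  constant independent of \<open>d\<close>.  The perturbation tends to zero with \<open>h\<close> for fixed \<open>d\<close>, since on the set
  where \<open>|\<nabla>u| \<ge> d/2\<close> the equation is uniformly elliptic and the usual difference quotient argument bounds
  the second derivatives of \<open>u\<close> in \<open>L\<^sup>2\<close>.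
\<close>

section \<open>Compactly supported C1 functions and difference quotients\<close>

text \<open>The obstacle is the loss of ellipticity at critical points: \<open>A\<close> may vanish
  or blow up at zero, so second derivatives of u have no uniform bound there. The derivative of the
  flux fares better: its eigenvalues \<open>A t\<close> (tangential) and
  \<open>A t + t * A' t\<close> (radial) are comparable through the indices of \<open>A\<close>, and
  only such ratios may enter a constant that has to survive the limit d -> 0. This shapes the
  treatment of the cutoff. Where the gradient of the cutoff is hit, the difference quotient of the
  flux is not dominated by the truncated energy; it is therefore shifted once more onto the other
  factor, and only the size of the flux remains, which is bounded. Difference quotients stand in for
  derivatives because u is merely C1 while the truncated field has to be differentiated classically.
  The conclusion about div V comes from a pairing: div W vanishes on the critical set, so a cutoff
  zeta multiplying it may be replaced by zeta minus the indicator of that set. The latter becomes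
  small in L2 while div W stays bounded in L2.\<close>

text \<open>The gradient is carried as an explicit field \<open>D\<close>, so that no choice is
  involved when it is named later. \<open>U\<close> need not be open: supports inside closed balls
  or compact sets are expressed by the same predicate.\<close>

definition C1c :: "'a::euclidean_space set \<Rightarrow> ('a \<Rightarrow> real) \<Rightarrow> ('a \<Rightarrow> 'a) \<Rightarrow> bool" where
  "C1c U \<phi> D \<longleftrightarrow> (\<forall>x. GDERIV \<phi> x :> D x) \<and> continuous_on UNIV D \<and>
     (\<exists>K. compact K \<and> K \<subseteq> U \<and> (\<forall>x. x \<notin> K \<longrightarrow> \<phi> x = 0 \<and> D x = 0))"

lemma integrable_continuous_compact_support:
  fixes f :: "'a::euclidean_space \<Rightarrow> 'b::euclidean_space"
  assumes "continuous_on UNIV f" "compact K" "\<And>x. x \<notin> K \<Longrightarrow> f x = 0"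
  shows "integrable lborel f"
proof -
  have "integrable lborel (\<lambda>x. indicator K x *\<^sub>R f x)"
    using assms by (intro borel_integrable_compact) (auto intro: continuous_on_subset)
  moreover have "(\<lambda>x. indicator K x *\<^sub>R f x) = f" using assms(3) by (auto simp: indicator_def)
  ultimately show ?thesis by simp
qed

lemma bounded_continuous_compact_support:
  fixes f :: "'a::euclidean_space \<Rightarrow> 'b::euclidean_space"
  assumes "continuous_on UNIV f" "compact K" "\<And>x. x \<notin> K \<Longrightarrow> f x = 0"
  shows "\<exists>B>0. \<forall>x. norm (f x) \<le> B"
proof -
  have "compact (f ` K)" using assms by (intro compact_continuous_image) (auto intro: continuous_on_subset)
  then obtain B where B: "\<forall>y\<in>f ` K. norm y \<le> B" using compact_imp_bounded bounded_iff by metis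
  have "norm (f x) \<le> max B 1" for x using B assms(3)[of x] by (cases "x \<in> K") fastforce+
  then show ?thesis by (intro exI[of _ "max B 1"]) auto
qed

lemma lborel_integral_translate:
  fixes f :: "'a::euclidean_space \<Rightarrow> 'b::{banach,second_countable_topology}"
  assumes "f \<in> borel_measurable borel"
  shows "(LBINT x. f (x + c)) = integral\<^sup>L lborel f"
proof -
  have "integral\<^sup>L lborel f = integral\<^sup>L (distr lborel borel ((+) c)) f" by (simp add: lborel_distr_plus)
  also have "\<dots> = (LBINT x. f (c + x))" using assms by (intro integral_distr) auto
  finally show ?thesis by (simp add: add.commute)
qed

lemma lborel_integrable_translate:
  fixes f :: "'a::euclidean_space \<Rightarrow> 'b::{banach,second_countable_topology}"
  assumes "integrable lborel f"
  shows "integrable lborel (\<lambda>x. f (x + c))"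
proof -
  have "integrable (distr lborel borel ((+) c)) f" using assms by (simp add: lborel_distr_plus)
  moreover have "f \<in> borel_measurable borel" using assms by auto
  ultimately have "integrable lborel (\<lambda>x. f (c + x))" by (subst (asm) integrable_distr_eq) auto
  then show ?thesis by (simp add: add.commute)
qed

section \<open>Gradients of compactly supported functions\<close>

lemma GDERIV_const_zero: "GDERIV (\<lambda>x. c) x :> 0"
  by (simp add: gderiv_def)

lemma GDERIV_imp_isCont: "GDERIV f x :> D \<Longrightarrow> isCont f x"
  unfolding gderiv_def by (rule has_derivative_continuous)

lemma GDERIV_continuous_on: "(\<And>x. x \<in> S \<Longrightarrow> GDERIV f x :> D x) \<Longrightarrow> continuous_on S f"
  by (meson GDERIV_imp_isCont continuous_at_imp_continuous_on)

lemma C1c_D: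
  assumes "C1c U \<phi> D"
  shows "GDERIV \<phi> x :> D x" "continuous_on UNIV D" "continuous_on UNIV \<phi>"
  using assms GDERIV_continuous_on[of UNIV \<phi> D] by (auto simp: C1c_def)

lemma C1c_support:
  assumes "C1c U \<phi> D"
  obtains K where "compact K" "K \<subseteq> U" "\<And>x. x \<notin> K \<Longrightarrow> \<phi> x = 0" "\<And>x. x \<notin> K \<Longrightarrow> D x = 0"
  using assms by (auto simp: C1c_def)

lemma C1c_mono: "C1c U \<phi> D \<Longrightarrow> U \<subseteq> U' \<Longrightarrow> C1c U' \<phi> D"
  unfolding C1c_def by blast

lemma GDERIV_unique':
  fixes f :: "'a::euclidean_space \<Rightarrow> real"
  assumes "GDERIV f x :> D" "GDERIV f x :> D'"
  shows "D = D'"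
proof -
  have "(\<lambda>h. inner h D) = (\<lambda>h. inner h D')"
    using assms unfolding gderiv_def by (rule has_derivative_unique)
  then show ?thesis by (metis inner_commute vector_eq_ldot)
qed

text \<open>On the open complement of \<open>K\<close> the function is identically zero, so
  uniqueness of the gradient forces \<open>D\<close> to vanish there too.\<close>

lemma C1cI:
  assumes "\<And>x. GDERIV \<phi> x :> D x" "continuous_on UNIV D" "compact K" "K \<subseteq> U" "\<And>x. x \<notin> K \<Longrightarrow> \<phi> x = 0"
  shows "C1c U \<phi> D"
proof -
  have "D x = 0" if "x \<notin> K" for x
  proof -
    have "open (- K)" using assms(3) compact_imp_closed by blast
    then have "(\<phi> has_derivative (\<lambda>h. 0)) (at x)"
      using has_derivative_transform_within_open[of "\<lambda>_. 0" "\<lambda>h. 0" x UNIV "- K" \<phi>] that assms(5) by auto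
    then have "GDERIV \<phi> x :> 0" by (simp add: gderiv_def)
    then show ?thesis using assms(1) GDERIV_unique' by blast
  qed
  then show ?thesis using assms by (auto simp: C1c_def)
qed

text \<open>\<open>u\<close> may be arbitrary outside \<open>U\<close>. The product is identically
  zero on the open complement of the support of \<open>\<phi>\<close>, which together with
  \<open>U\<close> covers the space, so differentiability and continuity are checked on two open
  sets.\<close>

lemma C1c_mult:
  assumes "C1c U \<phi> D" "open U" "\<And>x. x \<in> U \<Longrightarrow> GDERIV u x :> G x" "continuous_on U G"
  shows "C1c U (\<lambda>x. \<phi> x * u x) (\<lambda>x. \<phi> x *\<^sub>R G x + u x *\<^sub>R D x)"
proof -
  obtain K where K: "compact K" "K \<subseteq> U" "\<And>x. x \<notin> K \<Longrightarrow> \<phi> x = 0" "\<And>x. x \<notin> K \<Longrightarrow> D x = 0"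
    using assms(1) by (rule C1c_support) blast
  have oK: "open (- K)" using K(1) compact_imp_closed by blast
  have cu: "continuous_on U u" using assms(3) by (rule GDERIV_continuous_on)
  show ?thesis
  proof (rule C1cI)
    fix x show "GDERIV (\<lambda>x. \<phi> x * u x) x :> \<phi> x *\<^sub>R G x + u x *\<^sub>R D x"
    proof (cases "x \<in> U")
      case True
      then show ?thesis using GDERIV_mult[OF C1c_D(1)[OF assms(1), of x] assms(3)[OF True]] by simp
    next
      case False
      then have x: "x \<notin> K" using K by auto
      have "((\<lambda>x. \<phi> x * u x) has_derivative (\<lambda>h. 0)) (at x)"
        using has_derivative_transform_within_open[of "\<lambda>_. 0" "\<lambda>h. 0" x UNIV "- K" "\<lambda>x. \<phi> x * u x"] x oK K(3) by auto
      then show ?thesis using x K by (simp add: gderiv_def)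
    qed
  next
    have 1: "continuous_on U (\<lambda>x. \<phi> x *\<^sub>R G x + u x *\<^sub>R D x)"
      by (intro continuous_intros cu assms(4) continuous_on_subset[OF C1c_D(2)[OF assms(1)]]
          continuous_on_subset[OF C1c_D(3)[OF assms(1)]]) auto
    have "continuous_on (- K) (\<lambda>x. 0::'a)" by simp
    then have 2: "continuous_on (- K) (\<lambda>x. \<phi> x *\<^sub>R G x + u x *\<^sub>R D x)"
      by (rule continuous_on_eq) (auto simp: K)
    have "U \<union> - K = UNIV" using K by auto
    then show "continuous_on UNIV (\<lambda>x. \<phi> x *\<^sub>R G x + u x *\<^sub>R D x)"
      using continuous_on_open_Un[OF assms(2) oK 1 2] by simp
  qed (use K in auto)
qed

lemma GDERIV_translate: "GDERIV f (x + c) :> D \<Longrightarrow> GDERIV (\<lambda>x. f (x + c)) x :> D"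
proof -
  assume "GDERIV f (x + c) :> D"
  then have "((\<lambda>x. f (x + c)) has_derivative (\<lambda>h. inner h D)) (at x)"
    unfolding gderiv_def
    using has_derivative_compose[of "\<lambda>x. x + c" "\<lambda>h. h" x UNIV f "\<lambda>h. inner h D"] by (simp add: has_derivative_add_const)
  then show ?thesis by (simp add: gderiv_def)
qed

lemma GDERIV_cmult: "GDERIV f x :> D \<Longrightarrow> GDERIV (\<lambda>x. c * f x) x :> c *\<^sub>R D"
  using GDERIV_mult[OF GDERIV_const_zero, of f x D c] by simp

lemma GDERIV_divide_const: "GDERIV f x :> D \<Longrightarrow> GDERIV (\<lambda>x. f x / c) x :> D /\<^sub>R c"
  using GDERIV_cmult[of f x D "inverse c"] by (simp add: field_simps)

lemma GDERIV_diffquot: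
  assumes "\<And>x. GDERIV f x :> D x"
  shows "GDERIV (\<lambda>x. (f (x + c) - f (x + d)) / h) x :> (D (x + c) - D (x + d)) /\<^sub>R h"
  by (intro GDERIV_divide_const GDERIV_diff GDERIV_translate assms)

lemma C1c_diffquot:
  assumes "C1c (cball x0 r) \<phi> D" "r + norm c < s"
  shows "C1c (ball x0 s) (\<lambda>x. (\<phi> x - \<phi> (x - c)) / h) (\<lambda>x. (D x - D (x - c)) /\<^sub>R h)"
proof -
  obtain K where K: "compact K" "K \<subseteq> cball x0 r" "\<And>x. x \<notin> K \<Longrightarrow> \<phi> x = 0"
    using assms(1) by (rule C1c_support) blast
  have n: "\<phi> x = 0" if "x \<notin> cball x0 r" for x using K(2) K(3)[of x] that by blast
  show ?thesis
  proof (rule C1cI[of _ _ "cball x0 (r + norm c)"])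
    show "GDERIV (\<lambda>x. (\<phi> x - \<phi> (x - c)) / h) x :> (D x - D (x - c)) /\<^sub>R h" for x
      using GDERIV_diffquot[of \<phi> D 0 "- c" h x] C1c_D(1)[OF assms(1)] by simp
    show "continuous_on UNIV (\<lambda>x. (D x - D (x - c)) /\<^sub>R h)"
      by (intro continuous_intros C1c_D(2)[OF assms(1)] continuous_on_compose2[OF C1c_D(2)[OF assms(1)]]) auto
    show "(\<phi> x - \<phi> (x - c)) / h = 0" if "x \<notin> cball x0 (r + norm c)" for x
    proof -
      have "dist x0 x \<le> dist x0 (x - c) + norm c" 
        using norm_triangle_ineq4[of "x0 - (x - c)" c] by (simp add: dist_norm)
      then have "x \<notin> cball x0 r" "x - c \<notin> cball x0 r" using that norm_ge_zero[of c] by (auto simp: not_le simp del: norm_ge_zero)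
      then show ?thesis by (simp add: n)
    qed
  qed (use assms(2) in auto)
qed

lemma GDERIV_mvt:
  fixes f :: "'a::euclidean_space \<Rightarrow> real"
  assumes "\<And>x. GDERIV f x :> D x"
  shows "\<exists>t\<in>{0<..<1}. f (x + v) - f x = v \<bullet> D (x + t *\<^sub>R v)"
proof -
  have d: "((\<lambda>t. f (x + t *\<^sub>R v)) has_derivative (\<lambda>s. s * (v \<bullet> D (x + t *\<^sub>R v)))) (at t)" for t
  proof -
    have "(f has_derivative (\<lambda>h. inner h (D (x + t *\<^sub>R v)))) (at (x + t *\<^sub>R v))"
      using assms by (simp add: gderiv_def)
    then have "((\<lambda>t. f (x + t *\<^sub>R v)) has_derivative (\<lambda>s. inner (s *\<^sub>R v) (D (x + t *\<^sub>R v)))) (at t)"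
      by (intro has_derivative_compose[of "\<lambda>t. x + t *\<^sub>R v" "\<lambda>s. s *\<^sub>R v" t UNIV f]) (auto intro!: derivative_eq_intros)
    then show ?thesis by simp
  qed
  have "continuous_on {0..1} (\<lambda>t. f (x + t *\<^sub>R v))"
    using d by (meson continuous_at_imp_continuous_on has_derivative_continuous)
  then obtain t where "0 < t" "t < 1" "f (x + 1 *\<^sub>R v) - f (x + 0 *\<^sub>R v) = (1 - 0) * (v \<bullet> D (x + t *\<^sub>R v))"
    using mvt[of 0 1 "\<lambda>t. f (x + t *\<^sub>R v)" "\<lambda>t s. s * (v \<bullet> D (x + t *\<^sub>R v))"] d by auto
  then show ?thesis by auto
qed

section \<open>Difference quotients under the integral sign\<close>

lemma GDERIV_diffquot_tendsto:
  fixes f :: "'a::euclidean_space \<Rightarrow> real"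
  assumes "\<And>x. GDERIV f x :> D x" "continuous_on UNIV D" "t \<longlonglongrightarrow> 0" "\<And>n. t n \<noteq> 0"
  shows "(\<lambda>n. (f (x + t n *\<^sub>R e) - f x) / t n) \<longlonglongrightarrow> D x \<bullet> e"
proof -
  have "\<forall>n. \<exists>s\<in>{0<..<1}. f (x + t n *\<^sub>R e) - f x = (t n *\<^sub>R e) \<bullet> D (x + s *\<^sub>R (t n *\<^sub>R e))"
    using GDERIV_mvt[OF assms(1)] by blast
  then obtain s where s: "\<And>n. s n \<in> {0<..<1}" "\<And>n. f (x + t n *\<^sub>R e) - f x = (t n *\<^sub>R e) \<bullet> D (x + s n *\<^sub>R (t n *\<^sub>R e))"
    by metis
  have eq: "(f (x + t n *\<^sub>R e) - f x) / t n = D (x + (s n * t n) *\<^sub>R e) \<bullet> e" for n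
    using s(2)[of n] assms(4)[of n] by (simp add: inner_commute)
  have "(\<lambda>n. s n * t n) \<longlonglongrightarrow> 0"
  proof (rule tendsto_0_le[OF assms(3), of _ 1])
    show "\<forall>\<^sub>F n in sequentially. norm (s n * t n) \<le> norm (t n) * 1"
    proof (intro always_eventually allI)
      fix n show "norm (s n * t n) \<le> norm (t n) * 1"
        using s(1)[of n] by (auto simp: abs_mult intro!: mult_left_le_one_le)
    qed
  qed
  then have "(\<lambda>n. x + (s n * t n) *\<^sub>R e) \<longlonglongrightarrow> x + 0 *\<^sub>R e" by (intro tendsto_intros)
  moreover have "isCont D x" using assms(2) by (simp add: continuous_on_eq_continuous_at)
  ultimately have "(\<lambda>n. D (x + (s n * t n) *\<^sub>R e)) \<longlonglongrightarrow> D x" using isCont_tendsto_compose by fastforce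
  then show ?thesis unfolding eq by (intro tendsto_intros)
qed

text \<open>By the mean value theorem all quotients are bounded by the maximum of the gradient, and
  they live in one ball that contains every translate of the support by a step of size at most
  \<open>T\<close>. The dominating function is that maximum times the indicator of the ball, so its
  square is integrable as well.\<close>

lemma C1c_diffquot_dominated:
  assumes "C1c U \<phi> D" "t \<longlonglongrightarrow> 0" "\<And>n. t n \<noteq> 0" "\<And>n. \<bar>t n\<bar> \<le> T" "norm e = 1"
  obtains w where "integrable lborel w" "\<And>n x. \<bar>(\<phi> (x + t n *\<^sub>R e) - \<phi> x) / t n\<bar> \<le> w x"
     "integrable lborel (\<lambda>x. (w x)\<^sup>2)"
proof -
  obtain K where K: "compact K" "\<And>x. x \<notin> K \<Longrightarrow> \<phi> x = 0" "\<And>x. x \<notin> K \<Longrightarrow> D x = 0"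
    using assms(1) by (rule C1c_support) blast
  obtain B where B: "B > 0" "\<And>x. norm (D x) \<le> B"
    using bounded_continuous_compact_support[OF C1c_D(2)[OF assms(1)] K(1,3)] by auto
  obtain r where r: "K \<subseteq> cball 0 r"
    using compact_imp_bounded[OF K(1)] by (auto simp: bounded_iff subset_iff)
  define w where "w x = B * indicator (cball 0 (r + T)) x" for x :: 'a
  have ic: "integrable lborel (\<lambda>x::'a. indicator (cball 0 (r + T)) x :: real)"
    using emeasure_lborel_cball_finite by (intro integrable_real_indicator) auto
  have 1: "integrable lborel w" unfolding w_def using ic by auto
  have "(w x)\<^sup>2 = B\<^sup>2 * indicator (cball 0 (r + T)) x" for x by (auto simp: w_def indicator_def power2_eq_square)
  then have 2: "integrable lborel (\<lambda>x. (w x)\<^sup>2)" using ic by auto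
  have "\<bar>(\<phi> (x + t n *\<^sub>R e) - \<phi> x) / t n\<bar> \<le> w x" for n x
  proof (cases "x \<in> cball 0 (r + T)")
    case True
    obtain s where "\<phi> (x + t n *\<^sub>R e) - \<phi> x = (t n *\<^sub>R e) \<bullet> D (x + s *\<^sub>R (t n *\<^sub>R e))"
      using GDERIV_mvt[OF C1c_D(1)[OF assms(1)]] by blast
    then have "\<bar>(\<phi> (x + t n *\<^sub>R e) - \<phi> x) / t n\<bar> = \<bar>e \<bullet> D (x + s *\<^sub>R (t n *\<^sub>R e))\<bar>"
      using assms(3)[of n] by simp
    also have "\<dots> \<le> B" using Cauchy_Schwarz_ineq2[of e "D (x + s *\<^sub>R (t n *\<^sub>R e))"] B(2)[of "x + s *\<^sub>R (t n *\<^sub>R e)"] assms(5)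
      by simp
    finally show ?thesis using True by (simp add: w_def)
  next
    case False
    have "norm x \<le> norm (x + t n *\<^sub>R e) + norm (t n *\<^sub>R e)" by (metis add_diff_cancel_right' norm_triangle_ineq4)
    then have "norm x \<le> norm (x + t n *\<^sub>R e) + T" using assms(4)[of n] assms(5) by simp
    then have "x \<notin> K" "x + t n *\<^sub>R e \<notin> K" using False r assms(4)[of n] by (auto dest!: subsetD)
    then show ?thesis using K False by (simp add: w_def)
  qed
  with 1 2 show thesis using that by blast
qed

text \<open>Translation invariance makes the integral of every difference quotient vanish; dominated
  convergence carries this to the derivative, without iterated integrals.\<close>

lemma C1c_integral_derivative_zero:
  assumes "C1c U \<phi> D" "norm e = 1"
  shows "(LBINT x. D x \<bullet> e) = 0"
proof -
  define t where "t n = 1 / real (Suc n)" for n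
  have t: "t \<longlonglongrightarrow> 0" "\<And>n. t n \<noteq> 0" "\<And>n. \<bar>t n\<bar> \<le> 1"
    unfolding t_def using LIMSEQ_Suc[OF lim_const_over_n[of 1]] by (auto simp: divide_simps)
  obtain w where w: "integrable lborel w" "\<And>n x. \<bar>(\<phi> (x + t n *\<^sub>R e) - \<phi> x) / t n\<bar> \<le> w x"
      "integrable lborel (\<lambda>x. (w x)\<^sup>2)"
    by (rule C1c_diffquot_dominated[OF assms(1) t assms(2)]) (assumption | rule that)+
  obtain K where K: "compact K" "\<And>x. x \<notin> K \<Longrightarrow> \<phi> x = 0" using assms(1) by (rule C1c_support) blast
  note c\<phi> = C1c_D(3)[OF assms(1)]
  have [measurable]: "\<phi> \<in> borel_measurable borel" using c\<phi> by (rule borel_measurable_continuous_onI)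
  have [measurable]: "D \<in> borel_measurable borel" using C1c_D(2)[OF assms(1)] by (rule borel_measurable_continuous_onI)
  have i\<phi>: "integrable lborel \<phi>" using c\<phi> K by (rule integrable_continuous_compact_support)
  have "(\<lambda>n. (LBINT x. (\<phi> (x + t n *\<^sub>R e) - \<phi> x) / t n)) \<longlonglongrightarrow> (LBINT x. D x \<bullet> e)"
  proof (rule integral_dominated_convergence[where w=w])
    show "AE x in lborel. (\<lambda>n. (\<phi> (x + t n *\<^sub>R e) - \<phi> x) / t n) \<longlonglongrightarrow> D x \<bullet> e"
      using GDERIV_diffquot_tendsto[OF C1c_D(1,2)[OF assms(1)] t(1,2)] by auto
  qed (use w in auto)
  moreover have "(LBINT x. (\<phi> (x + t n *\<^sub>R e) - \<phi> x) / t n) = 0" for n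
    using Bochner_Integration.integral_diff[OF lborel_integrable_translate[OF i\<phi>] i\<phi>] lborel_integral_translate[of \<phi>]
    by simp
  ultimately have "(\<lambda>n. 0) \<longlonglongrightarrow> (LBINT x. D x \<bullet> e)" by (simp only:)
  then show ?thesis using LIMSEQ_unique[OF tendsto_const] by metis
qed

text \<open>The derivative of the product \<open>\<phi> * u\<close> integrates to zero. Regularity
  of \<open>u\<close> is asked on \<open>U\<close> only, because that product extends by
  zero.\<close>

lemma C1c_integration_by_parts:
  assumes "C1c U \<phi> D" "open U" "\<And>x. x \<in> U \<Longrightarrow> GDERIV u x :> G x" "continuous_on U G" "norm e = 1"
  shows "(LBINT x. u x * (D x \<bullet> e)) = - (LBINT x. \<phi> x * (G x \<bullet> e))"
    "integrable lborel (\<lambda>x. u x * (D x \<bullet> e))" "integrable lborel (\<lambda>x. \<phi> x * (G x \<bullet> e))"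
proof -
  obtain K where K: "compact K" "K \<subseteq> U" "\<And>x. x \<notin> K \<Longrightarrow> \<phi> x = 0" "\<And>x. x \<notin> K \<Longrightarrow> D x = 0"
    using assms(1) by (rule C1c_support) blast
  have cu: "continuous_on U u" using assms(3) by (rule GDERIV_continuous_on)
  have "integrable lborel (\<lambda>x. indicator K x *\<^sub>R (u x * (D x \<bullet> e)))"
    by (intro borel_integrable_compact K continuous_intros continuous_on_subset[OF cu]
        continuous_on_subset[OF C1c_D(2)[OF assms(1)]]) auto
  moreover have "(\<lambda>x. indicator K x *\<^sub>R (u x * (D x \<bullet> e))) = (\<lambda>x. u x * (D x \<bullet> e))"
    using K(4) by (fastforce simp: indicator_def)
  ultimately show 1: "integrable lborel (\<lambda>x. u x * (D x \<bullet> e))" by simp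
  have "integrable lborel (\<lambda>x. indicator K x *\<^sub>R (\<phi> x * (G x \<bullet> e)))"
    using K assms(4) by (intro borel_integrable_compact K continuous_intros 
        continuous_on_subset[OF C1c_D(3)[OF assms(1)]]) (auto intro: continuous_on_subset)
  moreover have "(\<lambda>x. indicator K x *\<^sub>R (\<phi> x * (G x \<bullet> e))) = (\<lambda>x. \<phi> x * (G x \<bullet> e))"
    using K(3) by (fastforce simp: indicator_def)
  ultimately show 2: "integrable lborel (\<lambda>x. \<phi> x * (G x \<bullet> e))" by simp
  have "(LBINT x. (\<phi> x *\<^sub>R G x + u x *\<^sub>R D x) \<bullet> e) = 0"
    by (rule C1c_integral_derivative_zero[OF C1c_mult[OF assms(1-4)] assms(5)])
  then show "(LBINT x. u x * (D x \<bullet> e)) = - (LBINT x. \<phi> x * (G x \<bullet> e))"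
    using 1 2 by (simp add: inner_add_left)
qed

lemma sum_square_le_card:
  fixes a :: "nat \<Rightarrow> real"
  shows "(\<Sum>i<n. a i)\<^sup>2 \<le> real n * (\<Sum>i<n. (a i)\<^sup>2)"
  using sum_squared_le_sum_of_squares[of a "{..<n}"] by (simp add: mult.commute)

text \<open>Splitting the step \<open>h\<close> into \<open>n\<close> equal parts bounds the left side by the same integral with
  step \<open>h / n\<close>; then \<open>n\<close> tends to infinity.\<close>
lemma C1c_diffquot_L2:
  assumes "C1c U \<phi> D" "norm e = 1" "h > 0"
  shows "(LBINT x. ((\<phi> x - \<phi> (x - h *\<^sub>R e)) / h)\<^sup>2) \<le> (LBINT x. (D x \<bullet> e)\<^sup>2)"
proof -
  define t where "t n = h / real (Suc n)" for n
  have t: "t \<longlonglongrightarrow> 0" "\<And>n. t n \<noteq> 0" "\<And>n. \<bar>t n\<bar> \<le> h"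
    unfolding t_def using assms(3) LIMSEQ_Suc[OF lim_const_over_n[of h]] by (auto simp: divide_simps)
  obtain w where w: "integrable lborel w" "\<And>n x. \<bar>(\<phi> (x + t n *\<^sub>R e) - \<phi> x) / t n\<bar> \<le> w x"
      "integrable lborel (\<lambda>x. (w x)\<^sup>2)"
    by (rule C1c_diffquot_dominated[OF assms(1) t assms(2)]) (assumption | rule that)+
  have [measurable]: "\<phi> \<in> borel_measurable borel" using C1c_D(3)[OF assms(1)] by (rule borel_measurable_continuous_onI)
  have [measurable]: "D \<in> borel_measurable borel" using C1c_D(2)[OF assms(1)] by (rule borel_measurable_continuous_onI)
  have dom: "((\<phi> (x + t n *\<^sub>R e) - \<phi> x) / t n)\<^sup>2 \<le> (w x)\<^sup>2" for x n
    using w(2)[of x n] abs_le_square_iff by (meson abs_ge_self order_trans)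
  have i: "integrable lborel (\<lambda>x. ((\<phi> (x + t n *\<^sub>R e) - \<phi> x) / t n)\<^sup>2)" for n
    by (rule Bochner_Integration.integrable_bound[OF w(3)]) (use dom in auto)
  have lim: "(\<lambda>n. (LBINT x. ((\<phi> (x + t n *\<^sub>R e) - \<phi> x) / t n)\<^sup>2)) \<longlonglongrightarrow> (LBINT x. (D x \<bullet> e)\<^sup>2)"
  proof (rule integral_dominated_convergence[where w="\<lambda>x. (w x)\<^sup>2"])
    show "AE x in lborel. (\<lambda>n. ((\<phi> (x + t n *\<^sub>R e) - \<phi> x) / t n)\<^sup>2) \<longlonglongrightarrow> (D x \<bullet> e)\<^sup>2"
      using GDERIV_diffquot_tendsto[OF C1c_D(1,2)[OF assms(1)] t(1,2)] by (intro always_eventually allI tendsto_power)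
  qed (use w dom in auto)
  have "(LBINT x. ((\<phi> x - \<phi> (x - h *\<^sub>R e)) / h)\<^sup>2) \<le> (LBINT x. ((\<phi> (x + t n *\<^sub>R e) - \<phi> x) / t n)\<^sup>2)" for n
  proof -
    define q where "q x = (\<phi> (x + t n *\<^sub>R e) - \<phi> x) / t n" for x
    have [measurable]: "q \<in> borel_measurable borel" unfolding q_def by measurable
    have iq: "integrable lborel (\<lambda>x. (q x)\<^sup>2)" unfolding q_def by (rule i)
    have "h = real (Suc n) * t n" by (simp add: t_def)
    have tele: "\<phi> (x + h *\<^sub>R e) - \<phi> x = (\<Sum>j<Suc n. t n * q (x + (real j * t n) *\<^sub>R e))" for x
    proof -
      have "t n * q (x + (real j * t n) *\<^sub>R e) = \<phi> (x + (real (Suc j) * t n) *\<^sub>R e) - \<phi> (x + (real j * t n) *\<^sub>R e)" for j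
        unfolding q_def using t(2)[of n] by (simp add: scaleR_add_left add.commute add.left_commute distrib_right)
      then have "(\<Sum>j<Suc n. t n * q (x + (real j * t n) *\<^sub>R e)) = 
        \<phi> (x + (real (Suc n) * t n) *\<^sub>R e) - \<phi> (x + (real 0 * t n) *\<^sub>R e)"
        using sum_lessThan_telescope[of "\<lambda>j. \<phi> (x + (real j * t n) *\<^sub>R e)" "Suc n"] by simp
      then show ?thesis using \<open>h = real (Suc n) * t n\<close> by simp
    qed
    have pt: "((\<phi> (x + h *\<^sub>R e) - \<phi> x) / h)\<^sup>2 \<le> (\<Sum>j<Suc n. (q (x + (real j * t n) *\<^sub>R e))\<^sup>2) / real (Suc n)" for x
    proof -
      have "(\<phi> (x + h *\<^sub>R e) - \<phi> x) / h = (\<Sum>j<Suc n. q (x + (real j * t n) *\<^sub>R e)) / real (Suc n)"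
        unfolding tele sum_distrib_left[symmetric] using t(2)[of n] by (subst \<open>h = real (Suc n) * t n\<close>) (simp del: sum.lessThan_Suc of_nat_Suc)
      moreover have "((\<Sum>j<Suc n. q (x + (real j * t n) *\<^sub>R e)) / real (Suc n))\<^sup>2 \<le> 
          (real (Suc n) * (\<Sum>j<Suc n. (q (x + (real j * t n) *\<^sub>R e))\<^sup>2)) / (real (Suc n))\<^sup>2"
        unfolding power_divide by (intro divide_right_mono sum_square_le_card) auto
      moreover have "\<dots> = (\<Sum>j<Suc n. (q (x + (real j * t n) *\<^sub>R e))\<^sup>2) / real (Suc n)"
        by (simp add: power2_eq_square del: sum.lessThan_Suc)
      ultimately show ?thesis by simp
    qed
    have iqs: "integrable lborel (\<lambda>x. (q (x + c))\<^sup>2)" for c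
      by (rule lborel_integrable_translate[OF iq])
    have qs: "(LBINT x. (q (x + c))\<^sup>2) = (LBINT x. (q x)\<^sup>2)" for c
      by (rule lborel_integral_translate) auto
    have "(LBINT x. ((\<phi> x - \<phi> (x - h *\<^sub>R e)) / h)\<^sup>2) = (LBINT x. ((\<phi> (x + h *\<^sub>R e) - \<phi> x) / h)\<^sup>2)"
      using lborel_integral_translate[of "\<lambda>x. ((\<phi> x - \<phi> (x - h *\<^sub>R e)) / h)\<^sup>2" "h *\<^sub>R e"] by simp
    also have "\<dots> \<le> (LBINT x. (\<Sum>j<Suc n. (q (x + (real j * t n) *\<^sub>R e))\<^sup>2) / real (Suc n))"
    proof (rule integral_mono)
      have iS: "integrable lborel (\<lambda>x. (\<Sum>j<Suc n. (q (x + (real j * t n) *\<^sub>R e))\<^sup>2) / real (Suc n))"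
        by (intro integrable_divide_zero Bochner_Integration.integrable_sum iqs)
      then show "integrable lborel (\<lambda>x. (\<Sum>j<Suc n. (q (x + (real j * t n) *\<^sub>R e))\<^sup>2) / real (Suc n))" .
      show "integrable lborel (\<lambda>x. ((\<phi> (x + h *\<^sub>R e) - \<phi> x) / h)\<^sup>2)"
      proof (rule Bochner_Integration.integrable_bound[OF iS])
        show "AE x in lborel. norm (((\<phi> (x + h *\<^sub>R e) - \<phi> x) / h)\<^sup>2)
            \<le> norm ((\<Sum>j<Suc n. (q (x + (real j * t n) *\<^sub>R e))\<^sup>2) / real (Suc n))"
        proof (intro always_eventually allI)
          fix x show "norm (((\<phi> (x + h *\<^sub>R e) - \<phi> x) / h)\<^sup>2)
            \<le> norm ((\<Sum>j<Suc n. (q (x + (real j * t n) *\<^sub>R e))\<^sup>2) / real (Suc n))"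
            unfolding real_norm_def abs_of_nonneg[OF zero_le_power2]
            by (rule order_trans[OF pt abs_ge_self])
        qed
      qed measurable
    qed (use pt in auto)
    also have "\<dots> = (LBINT x. (q x)\<^sup>2)"
      by (simp add: iqs qs del: sum.lessThan_Suc)
    finally show ?thesis by (simp add: q_def)
  qed
  then show ?thesis using LIMSEQ_le_const[OF lim] by blast
qed

section \<open>The flux and its truncations\<close>

text \<open>An exponent of at least two removes the kink of the positive part: at zero the quotient
  is itself a positive power of \<open>max 0 h\<close>. All cutoffs and truncations below are built
  from such powers, which is enough for C1.\<close>

lemma DERIV_max_power:
  fixes x :: real
  shows "((\<lambda>x. max 0 x ^ Suc (Suc n)) has_real_derivative real (Suc (Suc n)) * max 0 x ^ Suc n) (at x)"
proof -
  consider "x > 0" | "x < 0" | "x = 0" by linarith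
  then show ?thesis
  proof cases
    case 1
    have "((\<lambda>x. x ^ Suc (Suc n)) has_real_derivative real (Suc (Suc n)) * x ^ Suc n) (at x)"
      using DERIV_pow[of "Suc (Suc n)" x] by simp
    then have "((\<lambda>x. max 0 x ^ Suc (Suc n)) has_real_derivative real (Suc (Suc n)) * x ^ Suc n) (at x)"
      by (rule has_field_derivative_transform_within_open[where S="{0<..}"]) (use 1 in \<open>auto simp: max_def\<close>)
    then show ?thesis using 1 by (simp add: max_def)
  next
    case 2
    have "((\<lambda>x. 0) has_real_derivative 0) (at x)" by simp
    then have "((\<lambda>x. max 0 x ^ Suc (Suc n)) has_real_derivative 0) (at x)"
      by (rule has_field_derivative_transform_within_open[where S="{..<0}"]) (use 2 in \<open>auto simp: max_def\<close>)
    then show ?thesis using 2 by (simp add: max_def)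
  next
    case 3
    have "isCont (\<lambda>h::real. max 0 h ^ Suc n) 0" by (intro continuous_intros)
    then have "((\<lambda>h::real. max 0 h ^ Suc n) \<longlongrightarrow> 0) (at 0)" by (simp add: isCont_def)
    then have "((\<lambda>h::real. (max 0 (0 + h) ^ Suc (Suc n) - max 0 0 ^ Suc (Suc n)) / h) \<longlongrightarrow> 0) (at 0)"
      by (rule Lim_transform_eventually) (auto simp: eventually_at_filter max_def)
    then show ?thesis unfolding 3 DERIV_def by simp
  qed
qed

text \<open>This is the trace inequality for one point: \<open>P\<close> acts on the vectors
  \<open>y e\<close>, while the weights act on the index \<open>e\<close>, with eigenvalue
  \<open>r\<close> along \<open>\<nu>\<close> and \<open>k\<close> orthogonally to it. Splitting the
  family \<open>y\<close> along \<open>\<nu>\<close> makes every mixed term cancel in the sum over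
  \<open>e\<close>, on both sides, so that coercivity of \<open>P\<close> can be applied to each
  part separately.\<close>

lemma rank_one_coercivity:
  fixes P :: "'a::euclidean_space \<Rightarrow> 'a" and y :: "'a \<Rightarrow> 'a" and \<nu> :: 'a
  assumes "linear P" "\<And>v. \<kappa> * (norm v)\<^sup>2 \<le> P v \<bullet> v" "norm \<nu> = 1" "0 \<le> \<kappa>" "0 < Q"
    "0 \<le> k" "k \<le> Q" "0 \<le> r" "r \<le> Q"
  defines "z \<equiv> \<Sum>e\<in>Basis. (\<nu> \<bullet> e) *\<^sub>R y e"
  defines "w \<equiv> (\<lambda>e. k *\<^sub>R y e + ((r - k) * (\<nu> \<bullet> e)) *\<^sub>R z)"
  shows "\<kappa> / Q * (\<Sum>e\<in>Basis. (norm (w e))\<^sup>2) \<le> (\<Sum>e\<in>Basis. P (y e) \<bullet> w e)"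
proof -
  interpret linear P by fact
  \<comment> \<open>The part of the family orthogonal to \<open>\<nu>\<close> in the index:
    weighting \<open>y' e\<close> by \<open>\<nu> \<bullet> e\<close> and summing gives zero,
    because \<open>\<nu>\<close> is a unit vector.\<close>
  define y' where "y' e = y e - (\<nu> \<bullet> e) *\<^sub>R z" for e
  have nn: "(\<Sum>e\<in>Basis. (\<nu> \<bullet> e)\<^sup>2) = 1"
    using assms(3) euclidean_inner[of \<nu> \<nu>] by (simp add: power2_eq_square norm_eq_1)
  have y: "y e = y' e + (\<nu> \<bullet> e) *\<^sub>R z" for e by (simp add: y'_def)
  have w: "w e = k *\<^sub>R y' e + (r * (\<nu> \<bullet> e)) *\<^sub>R z" for e
    unfolding w_def y by (simp add: algebra_simps)
  have "(\<Sum>e\<in>Basis. (\<nu> \<bullet> e) *\<^sub>R y' e) = z - (\<Sum>e\<in>Basis. (\<nu> \<bullet> e)\<^sup>2) *\<^sub>R z"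
    unfolding y'_def by (simp add: algebra_simps sum_subtractf z_def[symmetric] scaleR_sum_left power2_eq_square)
  then have ort: "(\<Sum>e\<in>Basis. (\<nu> \<bullet> e) *\<^sub>R y' e) = 0" by (simp add: nn)
  have o1: "(\<Sum>e\<in>Basis. (\<nu> \<bullet> e) * (y' e \<bullet> v)) = 0" for v
    using arg_cong[OF ort, of "\<lambda>x. x \<bullet> v"] by (simp add: inner_sum_left)
  have o2: "(\<Sum>e\<in>Basis. (\<nu> \<bullet> e) * (P (y' e) \<bullet> v)) = 0" for v
    using arg_cong[OF ort, of "\<lambda>x. P x \<bullet> v"] by (simp add: sum scale inner_sum_left)
  have "(norm (w e))\<^sup>2 = k\<^sup>2 * (norm (y' e))\<^sup>2 + 2 * k * r * ((\<nu> \<bullet> e) * (y' e \<bullet> z)) + r\<^sup>2 * (norm z)\<^sup>2 * (\<nu> \<bullet> e)\<^sup>2" for e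
    unfolding w power2_norm_eq_inner by (simp add: inner_add_left inner_add_right power2_eq_square algebra_simps inner_commute)
  then have sw: "(\<Sum>e\<in>Basis. (norm (w e))\<^sup>2) = k\<^sup>2 * (\<Sum>e\<in>Basis. (norm (y' e))\<^sup>2) + r\<^sup>2 * (norm z)\<^sup>2"
    by (simp add: sum.distrib sum_distrib_left[symmetric] o1 nn)
  have "P (y e) \<bullet> w e = k * (P (y' e) \<bullet> y' e) + r * ((\<nu> \<bullet> e) * (P (y' e) \<bullet> z)) 
      + k * ((\<nu> \<bullet> e) * (y' e \<bullet> P z)) + r * (P z \<bullet> z) * (\<nu> \<bullet> e)\<^sup>2" for e
    unfolding w y by (simp add: add scale inner_add_left inner_add_right power2_eq_square algebra_simps inner_commute)
  then have sP: "(\<Sum>e\<in>Basis. P (y e) \<bullet> w e) = k * (\<Sum>e\<in>Basis. P (y' e) \<bullet> y' e) + r * (P z \<bullet> z)"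
    by (simp add: sum.distrib sum_distrib_left[symmetric] o1 o2 nn)
  \<comment> \<open>The weights enter \<open>w\<close> quadratically in the norm but linearly in the
    pairing with \<open>P\<close>; one factor is traded for the common bound
    \<open>Q\<close>.\<close>
  have k2: "k\<^sup>2 \<le> Q * k" "r\<^sup>2 \<le> Q * r" using assms(6-9) by (auto simp: power2_eq_square mult_right_mono)
  have "\<kappa> / Q * (k\<^sup>2 * (\<Sum>e\<in>Basis. (norm (y' e))\<^sup>2) + r\<^sup>2 * (norm z)\<^sup>2)
      \<le> \<kappa> / Q * ((Q * k) * (\<Sum>e\<in>Basis. (norm (y' e))\<^sup>2) + (Q * r) * (norm z)\<^sup>2)"
    using assms(4,5) k2 by (intro mult_left_mono add_mono mult_right_mono) (auto intro: sum_nonneg)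
  also have "\<dots> = k * (\<Sum>e\<in>Basis. \<kappa> * (norm (y' e))\<^sup>2) + r * (\<kappa> * (norm z)\<^sup>2)"
    using assms(5) by (simp add: sum_distrib_left[symmetric] field_simps)
  also have "\<dots> \<le> k * (\<Sum>e\<in>Basis. P (y' e) \<bullet> y' e) + r * (P z \<bullet> z)"
    using assms(2,6,8) by (intro add_mono mult_left_mono sum_mono) auto
  finally show ?thesis unfolding sw sP .
qed

text \<open>The numbers \<open>c0 - 1\<close> and \<open>M\<close> bound
  \<open>t * A' t / A t\<close> from below and above. The shift by one is chosen because
  \<open>1 + t * A' t / A t\<close> is the ratio of the radial to the tangential eigenvalue of the
  derivative of the flux; with \<open>c0 \<le> 1\<close> the quantity \<open>c0 * A t\<close> is a
  lower bound for both eigenvalues.\<close>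

locale elliptic_profile =
  fixes A A' :: "real \<Rightarrow> real" and c0 M :: real
  assumes A_pos: "\<And>t. 0 < t \<Longrightarrow> 0 < A t"
    and A_deriv: "\<And>t. 0 < t \<Longrightarrow> (A has_real_derivative A' t) (at t)"
    and A'_cont: "continuous_on {0<..} A'"
    and A_mono: "mono_on {0<..} (\<lambda>t. t * A t)"
    and c0: "0 < c0" "c0 \<le> 1" and M: "0 \<le> M"
    and A_lower: "\<And>t. 0 < t \<Longrightarrow> (c0 - 1) * A t \<le> t * A' t"
    and A_upper: "\<And>t. 0 < t \<Longrightarrow> t * A' t \<le> M * A t"
begin

definition flux :: "'a::euclidean_space \<Rightarrow> 'a" where "flux \<xi> = A (norm \<xi>) *\<^sub>R \<xi>"

text \<open>Away from zero this is the derivative of \<open>flux\<close>, with eigenvalue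
  \<open>A t\<close> on the orthogonal complement of \<open>\<xi>\<close> and
  \<open>A t + t * A' t\<close> along \<open>\<xi>\<close>, where t is the norm of
  \<open>\<xi>\<close>.\<close>

definition dflux :: "'a::euclidean_space \<Rightarrow> 'a \<Rightarrow> 'a" where
  "dflux \<xi> y = A (norm \<xi>) *\<^sub>R y + (A' (norm \<xi>) / norm \<xi> * (\<xi> \<bullet> y)) *\<^sub>R \<xi>"

section \<open>Ellipticity and linearisation of the flux\<close>

lemma A_cont: "continuous_on {0<..} A"
  by (meson A_deriv DERIV_isCont continuous_at_imp_continuous_on greaterThan_iff)

lemma A_bounds:
  assumes "0 < a" "a \<le> b"
  obtains lo hi where "0 < lo" "\<And>t. a \<le> t \<Longrightarrow> t \<le> b \<Longrightarrow> lo \<le> A t \<and> A t \<le> hi"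
proof -
  have c: "continuous_on {a..b} A" using A_cont assms by (auto intro: continuous_on_subset)
  obtain t0 where t0: "t0 \<in> {a..b}" "\<forall>t\<in>{a..b}. A t0 \<le> A t"
    using continuous_attains_inf[OF _ _ c] assms by auto
  obtain t1 where t1: "t1 \<in> {a..b}" "\<forall>t\<in>{a..b}. A t \<le> A t1"
    using continuous_attains_sup[OF _ _ c] assms by auto
  show thesis by (rule that[of "A t0" "A t1"]) (use t0 t1 assms A_pos in auto)
qed

lemma flux_zero [simp]: "flux 0 = 0"
  by (simp add: flux_def)

lemma norm_flux: "\<xi> \<noteq> 0 \<Longrightarrow> norm (flux \<xi>) = norm \<xi> * A (norm \<xi>)"
  using A_pos[of "norm \<xi>"] by (simp add: flux_def)

lemma norm_flux_le: "norm \<xi> \<le> L \<Longrightarrow> 0 < L \<Longrightarrow> norm (flux \<xi>) \<le> L * A L"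
proof (cases "\<xi> = 0")
  case False
  assume "norm \<xi> \<le> L" "0 < L"
  then show ?thesis using mono_onD[OF A_mono, of "norm \<xi>" L] False by (simp add: norm_flux)
qed (use A_pos[of L] in auto)

lemma linear_dflux: "linear (dflux \<xi>)"
  unfolding dflux_def by (intro linearI) (simp_all add: algebra_simps inner_add_right)

lemma flux_has_derivative:
  fixes \<xi> :: "'a::euclidean_space"
  assumes "\<xi> \<noteq> 0" shows "(flux has_derivative dflux \<xi>) (at \<xi>)"
proof -
  have "(norm has_derivative (\<lambda>y. y \<bullet> sgn \<xi>)) (at \<xi>)"
    using has_derivative_norm[OF assms] by (simp add: gderiv_def inner_commute)
  then have d: "((\<lambda>\<xi>. A (norm \<xi>)) has_derivative (\<lambda>y. A' (norm \<xi>) * (y \<bullet> sgn \<xi>))) (at \<xi>)"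
    using has_derivative_compose[of norm "\<lambda>y. y \<bullet> sgn \<xi>" \<xi> UNIV A "(*) (A' (norm \<xi>))"] A_deriv[of "norm \<xi>"] assms
    by (auto simp: has_field_derivative_def)
  show ?thesis unfolding flux_def dflux_def
    by (rule has_derivative_eq_rhs, rule has_derivative_scaleR[OF d has_derivative_ident])
      (simp add: sgn_div_norm field_simps inner_commute)
qed

lemma flux_borel [measurable]: "(flux :: 'a::euclidean_space \<Rightarrow> 'a) \<in> borel_measurable borel"
proof -
  have "(flux :: 'a \<Rightarrow> 'a) = (\<lambda>x. if x \<in> - {0} then flux x else 0)" by auto
  moreover have "continuous_on (- {0}) (flux :: 'a \<Rightarrow> 'a)"
    by (intro continuous_at_imp_continuous_on ballI has_derivative_continuous[OF flux_has_derivative]) auto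
  then have "(\<lambda>x::'a. if x \<in> - {0} then flux x else 0) \<in> borel_measurable borel"
    by (intro borel_measurable_continuous_on_if) auto
  ultimately show ?thesis by simp
qed

text \<open>The radial correction is bounded below by \<open>(c0 - 1) * A t\<close> times the
  squared radial component of \<open>y\<close>. Since \<open>c0 - 1\<close> is not positive,
  Cauchy-Schwarz may replace that component by the full norm.\<close>

lemma dflux_coercive: "c0 * A (norm \<xi>) * (norm y)\<^sup>2 \<le> dflux \<xi> y \<bullet> y" if "\<xi> \<noteq> 0"
proof -
  define t where "t = norm \<xi>"
  have t: "t > 0" using that by (simp add: t_def)
  have cs: "(\<xi> \<bullet> y)\<^sup>2 \<le> t\<^sup>2 * (norm y)\<^sup>2" using Cauchy_Schwarz_ineq[of \<xi> y] by (simp add: t_def power2_norm_eq_inner)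
  have "(c0 - 1) * A t * (norm y)\<^sup>2 \<le> (c0 - 1) * A t * ((\<xi> \<bullet> y)\<^sup>2 / t\<^sup>2)"
    using c0 A_pos[OF t] cs t by (intro mult_left_mono_neg) (auto simp: field_simps mult_nonpos_nonneg)
  also have "\<dots> \<le> t * A' t * ((\<xi> \<bullet> y)\<^sup>2 / t\<^sup>2)"
    using A_lower[OF t] by (intro mult_right_mono) auto
  also have "\<dots> = A' t / t * (\<xi> \<bullet> y)\<^sup>2" using t by (simp add: power2_eq_square)
  finally have "(c0 - 1) * A t * (norm y)\<^sup>2 \<le> A' t / t * (\<xi> \<bullet> y)\<^sup>2" .
  moreover have "dflux \<xi> y \<bullet> y = A t * (norm y)\<^sup>2 + A' t / t * (\<xi> \<bullet> y)\<^sup>2"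
    by (simp add: dflux_def t_def inner_add_left power2_norm_eq_inner) (simp add: power2_eq_square)
  ultimately show ?thesis by (simp add: t_def algebra_simps)
qed

lemma norm_dflux_le: "norm (dflux \<xi> y) \<le> (2 + M) * A (norm \<xi>) * norm y" if "\<xi> \<noteq> 0"
proof -
  define t where "t = norm \<xi>"
  have t: "t > 0" using that by (simp add: t_def)
  \<comment> \<open>One bound covers both signs: \<open>- (1 + M)\<close> lies below
    \<open>c0 - 1\<close>, and \<open>1 + M\<close> above \<open>M\<close>. Adding the tangential
    part \<open>A t\<close> gives the factor \<open>2 + M\<close>.\<close>
  have a: "\<bar>t * A' t\<bar> \<le> (1 + M) * A t"
  proof -
    have "- (1 + M) * A t \<le> (c0 - 1) * A t" using c0 M A_pos[OF t] by (intro mult_right_mono) auto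
    moreover have "M * A t \<le> (1 + M) * A t" using A_pos[OF t] by simp
    ultimately show ?thesis using A_lower[OF t] A_upper[OF t] by linarith
  qed
  have "norm ((A' t / t * (\<xi> \<bullet> y)) *\<^sub>R \<xi>) = \<bar>A' t\<bar> * \<bar>\<xi> \<bullet> y\<bar>" using t by (simp add: t_def abs_mult)
  also have "\<dots> \<le> \<bar>A' t\<bar> * (t * norm y)" unfolding t_def by (intro mult_left_mono Cauchy_Schwarz_ineq2) auto
  also have "\<dots> = \<bar>t * A' t\<bar> * norm y" using t by (simp add: abs_mult)
  also have "\<dots> \<le> (1 + M) * A t * norm y" using a by (intro mult_right_mono) auto
  finally have "norm (dflux \<xi> y) \<le> A t * norm y + (1 + M) * A t * norm y"
    using A_pos[OF t] norm_triangle_ineq[of "A t *\<^sub>R y" "(A' t / t * (\<xi> \<bullet> y)) *\<^sub>R \<xi>"]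
    by (simp add: dflux_def t_def)
  then show ?thesis by (simp add: t_def algebra_simps)
qed

text \<open>Joint continuity in the base point and the direction is uniform on the compact product
  of an annulus with the unit ball; linearity then scales the estimate to all directions
  \<open>y\<close>.\<close>

lemma dflux_uniformly_close:
  fixes \<delta> L \<omega> :: real
  assumes "0 < \<delta>" "0 < \<omega>"
  obtains \<rho> where "0 < \<rho>" "\<And>\<xi> \<xi>' y::'a::euclidean_space. \<delta> \<le> norm \<xi> \<Longrightarrow> norm \<xi> \<le> L \<Longrightarrow> \<delta> \<le> norm \<xi>' \<Longrightarrow> norm \<xi>' \<le> L \<Longrightarrow>
     norm (\<xi>' - \<xi>) < \<rho> \<Longrightarrow> norm (dflux \<xi>' y - dflux \<xi> y) \<le> \<omega> * norm y"
proof -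
  define S where "S = {\<xi>::'a. \<delta> \<le> norm \<xi> \<and> norm \<xi> \<le> L}"
  have "S = cball 0 L - ball 0 \<delta>" by (auto simp: S_def)
  then have cS: "compact S" by (simp add: compact_diff)
  have "continuous_on (S \<times> cball 0 1) (\<lambda>(\<xi>, y). dflux \<xi> y)"
    unfolding dflux_def case_prod_unfold using assms(1)
    by (intro continuous_intros continuous_on_compose2[OF A_cont] continuous_on_compose2[OF A'_cont]) (auto simp: S_def)
  then have "uniformly_continuous_on (S \<times> cball 0 1) (\<lambda>(\<xi>, y). dflux \<xi> y)"
    by (intro compact_uniformly_continuous compact_Times cS) auto
  then obtain \<rho> where \<rho>: "\<rho> > 0" "\<And>p p'. p \<in> S \<times> cball 0 1 \<Longrightarrow> p' \<in> S \<times> cball 0 1 \<Longrightarrow> dist p' p < \<rho> \<Longrightarrow>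
     dist ((\<lambda>(\<xi>, y). dflux \<xi> y) p') ((\<lambda>(\<xi>, y). dflux \<xi> y) p) < \<omega>"
    using assms(2) unfolding uniformly_continuous_on_def by meson
  show thesis
  proof (rule that[OF \<rho>(1)])
    fix \<xi> \<xi>' y :: 'a
    assume h: "\<delta> \<le> norm \<xi>" "norm \<xi> \<le> L" "\<delta> \<le> norm \<xi>'" "norm \<xi>' \<le> L" "norm (\<xi>' - \<xi>) < \<rho>"
    interpret l1: linear "dflux \<xi>" by (rule linear_dflux)
    interpret l2: linear "dflux \<xi>'" by (rule linear_dflux)
    have "dist (dflux \<xi>' (sgn y)) (dflux \<xi> (sgn y)) < \<omega>"
      using \<rho>(2)[of "(\<xi>, sgn y)" "(\<xi>', sgn y)"] h by (auto simp: S_def dist_Pair_Pair dist_norm norm_sgn)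
    then have "norm y * norm (dflux \<xi>' (sgn y) - dflux \<xi> (sgn y)) \<le> norm y * \<omega>"
      by (intro mult_left_mono) (auto simp: dist_norm)
    moreover have "dflux \<xi>' y - dflux \<xi> y = norm y *\<^sub>R (dflux \<xi>' (sgn y) - dflux \<xi> (sgn y))"
      by (cases "y = 0") (auto simp: l1.scale l2.scale l1.zero l2.zero sgn_div_norm scaleR_diff_right)
    ultimately show "norm (dflux \<xi>' y - dflux \<xi> y) \<le> \<omega> * norm y" by (simp add: mult.commute)
  qed
qed

text \<open>The mean value inequality is applied to \<open>flux\<close> minus its linearisation at
  \<open>\<xi>\<close>, on a ball around \<open>\<xi>\<close> of radius at most
  \<open>\<delta>/2\<close>. This ball stays in the annulus between \<open>\<delta>/2\<close> and
  \<open>L + \<delta>\<close>, hence off the singular point. The error is relative to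
  \<open>b - a\<close>, which is what allows it to be absorbed later.\<close>

lemma flux_difference:
  fixes \<delta> L \<omega> :: real
  assumes "0 < \<delta>" "0 < \<omega>"
  obtains \<rho> where "0 < \<rho>" "\<And>\<xi> a b::'a::euclidean_space. \<delta> \<le> norm \<xi> \<Longrightarrow> norm \<xi> \<le> L \<Longrightarrow> norm (a - \<xi>) < \<rho> \<Longrightarrow>
     norm (b - \<xi>) < \<rho> \<Longrightarrow> norm (flux b - flux a - dflux \<xi> (b - a)) \<le> \<omega> * norm (b - a)"
proof -
  obtain \<rho> where \<rho>: "0 < \<rho>" "\<And>\<xi> \<xi>' y::'a. \<delta>/2 \<le> norm \<xi> \<Longrightarrow> norm \<xi> \<le> L + \<delta> \<Longrightarrow> \<delta>/2 \<le> norm \<xi>' \<Longrightarrow> norm \<xi>' \<le> L + \<delta> \<Longrightarrow>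
     norm (\<xi>' - \<xi>) < \<rho> \<Longrightarrow> norm (dflux \<xi>' y - dflux \<xi> y) \<le> \<omega> * norm y"
    by (rule dflux_uniformly_close[of "\<delta>/2" \<omega> "L + \<delta>"]) (use assms in auto)
  show thesis
  proof (rule that[of "min \<rho> (\<delta>/2)"])
    show "0 < min \<rho> (\<delta>/2)" using \<rho> assms by auto
    fix \<xi> a b :: 'a
    assume h: "\<delta> \<le> norm \<xi>" "norm \<xi> \<le> L" "norm (a - \<xi>) < min \<rho> (\<delta>/2)" "norm (b - \<xi>) < min \<rho> (\<delta>/2)"
    define S where "S = ball \<xi> (min \<rho> (\<delta>/2))"
    have S: "\<delta>/2 \<le> norm x \<and> norm x \<le> L + \<delta> \<and> norm (x - \<xi>) < \<rho>" if "x \<in> S" for x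
    proof -
      have "norm (x - \<xi>) < min \<rho> (\<delta>/2)" using that by (simp add: S_def dist_norm norm_minus_commute)
      then show ?thesis using h norm_triangle_ineq2[of \<xi> x] norm_triangle_ineq2[of x \<xi>] norm_minus_commute[of x \<xi>] assms by auto
    qed
    interpret l: linear "dflux \<xi>" by (rule linear_dflux)
    have "norm ((flux b - dflux \<xi> b) - (flux a - dflux \<xi> a)) \<le> \<omega> * norm (b - a)"
    proof (rule differentiable_bound[of S "\<lambda>x. flux x - dflux \<xi> x" "\<lambda>x y. dflux x y - dflux \<xi> y"])
      fix x assume x: "x \<in> S"
      then have "x \<noteq> 0" using S[OF x] assms by auto
      moreover have "(dflux \<xi> has_derivative dflux \<xi>) (at x)"
        by (rule linear_imp_has_derivative[OF linear_dflux])
      ultimately have "((\<lambda>x. flux x - dflux \<xi> x) has_derivative (\<lambda>y. dflux x y - dflux \<xi> y)) (at x)"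
        using has_derivative_diff[OF flux_has_derivative] by blast
      then show "((\<lambda>x. flux x - dflux \<xi> x) has_derivative (\<lambda>y. dflux x y - dflux \<xi> y)) (at x within S)"
        by (rule has_derivative_at_withinI)
      show "onorm (\<lambda>y. dflux x y - dflux \<xi> y) \<le> \<omega>"
      proof (rule onorm_le)
        fix y show "norm (dflux x y - dflux \<xi> y) \<le> \<omega> * norm y"
          by (rule \<rho>(2)) (use S[OF x] h assms in auto)
      qed
    qed (use h in \<open>auto simp: S_def dist_norm norm_minus_commute\<close>)
    then show "norm (flux b - flux a - dflux \<xi> (b - a)) \<le> \<omega> * norm (b - a)"
      by (simp add: l.diff algebra_simps)
  qed
qed

text \<open>With this form of truncation the bounds on the weight and on the derivative of
  \<open>t * tweight d t\<close> by multiples of \<open>A t\<close> are uniform in \<open>d\<close>.\<close>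
definition tweight :: "real \<Rightarrow> real \<Rightarrow> real" where
  "tweight d t = A t * (max 0 (t - d))\<^sup>2 / t\<^sup>2"

text \<open>The derivative of \<open>tweight d\<close>. The factor \<open>t - max 0 (t - d)\<close>
  is \<open>d\<close> above the threshold, and below it the other factor vanishes, so one formula
  serves both sides.\<close>

definition tweight' :: "real \<Rightarrow> real \<Rightarrow> real" where
  "tweight' d t = A' t * (max 0 (t - d))\<^sup>2 / t\<^sup>2 + A t * (2 * max 0 (t - d) * (t - max 0 (t - d)) / t ^ 3)"

section \<open>Bounds for the truncated flux\<close>

lemma tweight_below: "t \<le> d \<Longrightarrow> tweight d t = 0" "t \<le> d \<Longrightarrow> tweight' d t = 0"
  by (auto simp: tweight_def tweight'_def max_def)

lemma tweight_deriv:
  assumes "0 < t" shows "(tweight d has_real_derivative tweight' d t) (at t)"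
proof -
  have "((\<lambda>t. t - d) has_real_derivative 1) (at t)" by (auto intro!: derivative_eq_intros)
  then have m: "((\<lambda>t. (max 0 (t - d))\<^sup>2) has_real_derivative 2 * max 0 (t - d)) (at t)"
    using DERIV_chain2[where f="\<lambda>x. max 0 x ^ Suc (Suc 0)" and g="\<lambda>t. t - d", OF DERIV_max_power[of 0 "t - d"], of 1 UNIV]
    by (simp add: numeral_2_eq_2)
  have "((\<lambda>t. A t * (max 0 (t - d))\<^sup>2 / t\<^sup>2) has_real_derivative tweight' d t) (at t)"
    by (rule DERIV_cong[OF DERIV_divide[OF DERIV_mult[OF A_deriv[OF assms] m] DERIV_pow[of 2]]])
      (use assms in \<open>simp_all add: tweight'_def field_simps power2_eq_square power3_eq_cube\<close>)
  then show ?thesis by (simp add: tweight_def[abs_def])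
qed

lemma tweight_cont: "continuous_on {0<..} (tweight d)" "continuous_on {0<..} (tweight' d)"
  using A_cont A'_cont unfolding tweight_def[abs_def] tweight'_def[abs_def] by (auto intro!: continuous_intros)

text \<open>The weight and \<open>tweight d t + t * tweight' d t\<close> are the tangential and
  radial eigenvalues of the derivative of the truncated flux. Both depend on \<open>d\<close> only
  through x = (1 - d/t)^+, a number in [0,1]: they equal \<open>A t * x\<^sup>2\<close> and
  \<open>(A t + t * A' t) * x\<^sup>2 + 2 * A t * x * (1 - x)\<close>. As 2x(1-x) is at most 1, the
  bounds are free of \<open>d\<close>.\<close>

lemma tweight_bounds:
  assumes "0 < t" "0 < d"
  shows "0 \<le> tweight d t" "tweight d t \<le> A t"
    "0 \<le> tweight d t + t * tweight' d t" "tweight d t + t * tweight' d t \<le> (2 + M) * A t"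
proof -
  define x where "x = max 0 (t - d) / t"
  have x: "0 \<le> x" "x \<le> 1" using assms by (auto simp: x_def max_def)
  have x2: "0 \<le> x\<^sup>2" "x\<^sup>2 \<le> 1" using x by (auto simp: power_le_one)
  have w: "tweight d t = A t * x\<^sup>2" by (simp add: tweight_def x_def power_divide)
  have "t * tweight' d t = t * A' t * x\<^sup>2 + A t * (2 * x * (1 - x))"
    using assms by (simp add: tweight'_def x_def field_simps power2_eq_square power3_eq_cube)
  then have r: "tweight d t + t * tweight' d t = (A t + t * A' t) * x\<^sup>2 + A t * (2 * x * (1 - x))"
    by (simp add: w algebra_simps)
  note A = A_pos[OF assms(1)]
  have "c0 * A t \<le> A t + t * A' t" using A_lower[OF assms(1)] by (simp add: algebra_simps)
  then have p: "0 \<le> A t + t * A' t" using c0 A by (meson less_imp_le mult_nonneg_nonneg order_trans)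
  show "0 \<le> tweight d t" "tweight d t \<le> A t" unfolding w using A x2 by (auto simp: mult_left_le)
  show "0 \<le> tweight d t + t * tweight' d t" unfolding r using p A x by auto
  have "(A t + t * A' t) * x\<^sup>2 \<le> (A t + t * A' t) * 1" using p x2 by (intro mult_left_mono) auto
  moreover have "A t * (2 * x * (1 - x)) \<le> A t * 1"
    using A sum_squares_ge_zero[of "1 - x" x] zero_le_power2[of "2*x-1"] by (intro mult_left_mono) (auto simp: power2_eq_square algebra_simps)
  ultimately show "tweight d t + t * tweight' d t \<le> (2 + M) * A t"
    unfolding r using A_upper[OF assms(1)] by (simp add: algebra_simps)
qed

end

section \<open>The localised equation\<close>

text \<open>Positive on the open ball, zero outside, with a kink on the sphere only. It is used
  through powers of at least two. The fourth power is the standard weight: its gradient is of order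
  \<open>cap ^ 3\<close>, whose square still contains a factor \<open>cap ^ 4\<close>.\<close>

definition cap :: "'a::euclidean_space \<Rightarrow> real \<Rightarrow> 'a \<Rightarrow> real" where
  "cap c r x = max 0 (r\<^sup>2 - (norm (x - c))\<^sup>2)"

lemma cap_nonneg: "0 \<le> cap c r x"
  by (simp add: cap_def)

lemma cap_le: "cap c r x \<le> r\<^sup>2"
  by (simp add: cap_def)

lemma cap_outside: "x \<notin> cball c r \<Longrightarrow> 0 < r \<Longrightarrow> cap c r x = 0"
  by (auto simp: cap_def dist_norm norm_minus_commute max_def dest: power_mono[of r _ 2])

lemma cap_continuous: "continuous_on S (cap c r)"
  unfolding cap_def[abs_def] by (intro continuous_intros)

lemma cap_lower:
  assumes "x \<in> cball c (r / 2)" "0 < r" shows "r\<^sup>2 / 2 \<le> cap c r x"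
proof -
  have "(norm (x - c))\<^sup>2 \<le> (r / 2)\<^sup>2"
    using assms by (intro power_mono) (auto simp: dist_norm norm_minus_commute)
  moreover have "(r / 2)\<^sup>2 = r\<^sup>2 / 4" by (simp add: power_divide)
  ultimately show ?thesis unfolding cap_def using zero_le_power2[of r] by linarith
qed

lemma GDERIV_cap_power:
  fixes c :: "'a::euclidean_space"
  shows "GDERIV (\<lambda>x. cap c r x ^ Suc (Suc n)) x :> (- 2 * real (Suc (Suc n)) * cap c r x ^ Suc n) *\<^sub>R (x - c)"
proof -
  have "((\<lambda>x. r\<^sup>2 - (norm (x - c))\<^sup>2) has_derivative (\<lambda>h. h \<bullet> (- 2 *\<^sub>R (x - c)))) (at x)"
    unfolding power2_norm_eq_inner
    by (rule derivative_eq_intros refl | simp add: inner_commute)+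
  then have "GDERIV (\<lambda>x. r\<^sup>2 - (norm (x - c))\<^sup>2) x :> - 2 *\<^sub>R (x - c)" by (simp add: gderiv_def)
  from GDERIV_DERIV_compose[OF this DERIV_max_power[of n]]
  have "GDERIV (\<lambda>x. cap c r x ^ Suc (Suc n)) x :>
      (real (Suc (Suc n)) * cap c r x ^ Suc n) *\<^sub>R (- 2 *\<^sub>R (x - c))" unfolding cap_def .
  moreover have "(real (Suc (Suc n)) * cap c r x ^ Suc n) *\<^sub>R (- 2 *\<^sub>R (x - c)) =
      (- 2 * real (Suc (Suc n)) * cap c r x ^ Suc n) *\<^sub>R (x - c)"
    unfolding scaleR_scaleR by (simp only: mult.commute[of _ "- 2"] mult.assoc)
  ultimately show ?thesis by (simp only:)
qed

lemma C1c_cap_mult: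
  fixes w :: "'a::euclidean_space \<Rightarrow> real"
  assumes "0 < r" "\<And>x. GDERIV w x :> W x" "continuous_on UNIV W"
  shows "C1c (cball c r) (\<lambda>x. cap c r x ^ Suc (Suc n) * w x)
     (\<lambda>x. cap c r x ^ Suc (Suc n) *\<^sub>R W x + (w x * (- 2 * real (Suc (Suc n)) * cap c r x ^ Suc n)) *\<^sub>R (x - c))"
proof (rule C1cI[of _ _ "cball c r"])
  show "GDERIV (\<lambda>x. cap c r x ^ Suc (Suc n) * w x) x :> cap c r x ^ Suc (Suc n) *\<^sub>R W x + (w x * (- 2 * real (Suc (Suc n)) * cap c r x ^ Suc n)) *\<^sub>R (x - c)" for x
    using GDERIV_mult[OF GDERIV_cap_power assms(2), of c r n x] by (simp del: power_Suc of_nat_Suc)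
  show "continuous_on UNIV (\<lambda>x. cap c r x ^ Suc (Suc n) *\<^sub>R W x + (w x * (- 2 * real (Suc (Suc n)) * cap c r x ^ Suc n)) *\<^sub>R (x - c))"
    by (intro continuous_intros cap_continuous assms GDERIV_continuous_on[OF assms(2)])
qed (use assms in \<open>auto simp: cap_outside\<close>)

lemma integrable_bounded_inner:
  fixes F E :: "'a::euclidean_space \<Rightarrow> 'b::euclidean_space"
  assumes "F \<in> borel_measurable borel" "\<And>x. norm (F x) \<le> B" "continuous_on UNIV E" "compact K" "\<And>x. x \<notin> K \<Longrightarrow> E x = 0"
  shows "integrable lborel (\<lambda>x. F x \<bullet> E x)"
proof (rule Bochner_Integration.integrable_bound)
  show "integrable lborel (\<lambda>x. B * norm (E x))"
    using integrable_continuous_compact_support[OF assms(3,4,5)] by (intro integrable_mult_right integrable_norm) auto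
  have [measurable]: "E \<in> borel_measurable borel" using assms(3) by (rule borel_measurable_continuous_onI)
  note [measurable] = assms(1)
  show "(\<lambda>x. F x \<bullet> E x) \<in> borel_measurable lborel" by measurable
  have B: "0 \<le> B" using assms(2) norm_ge_zero order_trans by blast
  show "AE x in lborel. norm (F x \<bullet> E x) \<le> norm (B * norm (E x))"
  proof (intro always_eventually allI)
    fix x
    have "norm (F x \<bullet> E x) \<le> norm (F x) * norm (E x)" by (simp add: Cauchy_Schwarz_ineq2)
    also have "\<dots> \<le> B * norm (E x)" using assms(2) by (intro mult_right_mono) auto
    finally show "norm (F x \<bullet> E x) \<le> norm (B * norm (E x))" using B by simp
  qed
qed

text \<open>Young's inequality separates the factors, and the difference quotient is bounded in L2
  by the gradient. Only the L2 norm of \<open>g\<close> enters, none of its derivatives, and the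
  free \<open>\<kappa>\<close> permits the gradient term to be absorbed.\<close>

lemma young_diffquot:
  fixes g \<psi> :: "'a::euclidean_space \<Rightarrow> real"
  assumes "C1c U \<psi> D" "norm e = 1" "h > 0" "\<kappa> > 0"
    and g: "g \<in> borel_measurable borel" "integrable lborel (\<lambda>x. (g x)\<^sup>2)"
  shows "\<bar>(LBINT x. g x * ((\<psi> x - \<psi> (x - h *\<^sub>R e)) / h))\<bar>
    \<le> (LBINT x. (g x)\<^sup>2) / (2 * \<kappa>) + \<kappa> / 2 * (LBINT x. (norm (D x))\<^sup>2)"
proof -
  obtain K where K: "compact K" "\<And>x. x \<notin> K \<Longrightarrow> \<psi> x = 0" "\<And>x. x \<notin> K \<Longrightarrow> D x = 0"
    using assms(1) by (rule C1c_support) blast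
  note [measurable] = g(1)
  have [measurable]: "\<psi> \<in> borel_measurable borel" using C1c_D(3)[OF assms(1)] by (rule borel_measurable_continuous_onI)
  define q where "q x = (\<psi> x - \<psi> (x - h *\<^sub>R e)) / h" for x
  have [measurable]: "q \<in> borel_measurable borel" unfolding q_def by measurable
  have cq: "continuous_on UNIV q" unfolding q_def using assms(3)
    by (intro continuous_intros C1c_D(3)[OF assms(1)] continuous_on_compose2[OF C1c_D(3)[OF assms(1)]]) auto
  have iq: "integrable lborel (\<lambda>x. (q x)\<^sup>2)"
  proof (rule integrable_continuous_compact_support[where K="K \<union> (+) (h *\<^sub>R e) ` K"])
    show "compact (K \<union> (+) (h *\<^sub>R e) ` K)" using K(1) by (intro compact_Un compact_translation) auto
    fix x assume "x \<notin> K \<union> (+) (h *\<^sub>R e) ` K"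
    then have "x \<notin> K" "x - h *\<^sub>R e \<notin> K" using image_eqI[of x "(+) (h *\<^sub>R e)" "x - h *\<^sub>R e" K] by auto
    then show "(q x)\<^sup>2 = 0" by (simp add: q_def K)
  qed (intro continuous_intros cq)
  have iD: "integrable lborel (\<lambda>x. (norm (D x))\<^sup>2)"
    by (rule integrable_continuous_compact_support[OF _ K(1)]) (auto intro!: continuous_intros C1c_D(2)[OF assms(1)] simp: K)
  have iDe: "integrable lborel (\<lambda>x. (D x \<bullet> e)\<^sup>2)"
    by (rule integrable_continuous_compact_support[OF _ K(1)]) (auto intro!: continuous_intros C1c_D(2)[OF assms(1)] simp: K)
  have pt: "\<bar>g x * q x\<bar> \<le> (g x)\<^sup>2 / (2 * \<kappa>) + \<kappa> / 2 * (q x)\<^sup>2" for x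
  proof -
    have "0 \<le> (\<bar>g x\<bar> - \<kappa> * \<bar>q x\<bar>)\<^sup>2 / (2 * \<kappa>)" using assms(4) by simp
    also have "\<dots> = (g x)\<^sup>2 / (2 * \<kappa>) + \<kappa> / 2 * (q x)\<^sup>2 - \<bar>g x * q x\<bar>"
    proof -
      have "(\<bar>g x\<bar> - \<kappa> * \<bar>q x\<bar>)\<^sup>2 = (g x)\<^sup>2 + \<kappa>\<^sup>2 * (q x)\<^sup>2 - 2 * \<kappa> * \<bar>g x * q x\<bar>"
        by (simp add: power2_diff power_mult_distrib abs_mult)
      then show ?thesis using assms(4) by (simp add: field_simps power2_eq_square)
    qed
    finally show ?thesis by simp
  qed
  have ib: "integrable lborel (\<lambda>x. (g x)\<^sup>2 / (2 * \<kappa>) + \<kappa> / 2 * (q x)\<^sup>2)" using g(2) iq by auto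
  have "\<bar>(LBINT x. g x * q x)\<bar> \<le> (LBINT x. \<bar>g x * q x\<bar>)" by (rule integral_abs_bound)
  also have "\<dots> \<le> (LBINT x. (g x)\<^sup>2 / (2 * \<kappa>) + \<kappa> / 2 * (q x)\<^sup>2)"
  proof (rule integral_mono)
    show "integrable lborel (\<lambda>x. \<bar>g x * q x\<bar>)"
    proof (rule Bochner_Integration.integrable_bound[OF ib])
      show "AE x in lborel. norm \<bar>g x * q x\<bar> \<le> norm ((g x)\<^sup>2 / (2 * \<kappa>) + \<kappa> / 2 * (q x)\<^sup>2)"
        using order_trans[OF pt abs_ge_self] by (intro always_eventually allI) auto
    qed measurable
  qed (use ib pt in auto)
  also have "\<dots> = (LBINT x. (g x)\<^sup>2) / (2 * \<kappa>) + \<kappa> / 2 * (LBINT x. (q x)\<^sup>2)"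
    using g(2) iq by simp
  also have "\<dots> \<le> (LBINT x. (g x)\<^sup>2) / (2 * \<kappa>) + \<kappa> / 2 * (LBINT x. (norm (D x))\<^sup>2)"
  proof (intro add_left_mono mult_left_mono)
    have "(LBINT x. (q x)\<^sup>2) \<le> (LBINT x. (D x \<bullet> e)\<^sup>2)"
      unfolding q_def by (rule C1c_diffquot_L2[OF assms(1-3)])
    also have "\<dots> \<le> (LBINT x. (norm (D x))\<^sup>2)"
    proof (rule integral_mono[OF iDe iD])
      fix x show "(D x \<bullet> e)\<^sup>2 \<le> (norm (D x))\<^sup>2"
        using Cauchy_Schwarz_ineq[of "D x" e] assms(2) by (simp add: power2_norm_eq_inner norm_eq_1)
    qed
    finally show "(LBINT x. (q x)\<^sup>2) \<le> (LBINT x. (norm (D x))\<^sup>2)" .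
  qed (use assms in auto)
  finally show ?thesis by (simp add: q_def)
qed

text \<open>The situation after localisation: \<open>u\<close> is a globally defined C1 function
  with uniformly continuous gradient, while the equation holds only for test functions supported in
  the ball of radius \<open>2 * R\<close>. Cutoffs live in the ball of radius \<open>R\<close>,
  which leaves room for translations. The source \<open>g\<close> is Borel and bounded everywhere,
  not just almost everywhere.\<close>

locale flux_equation = elliptic_profile A A' c0 M for A A' c0 M +
  fixes u :: "'a::euclidean_space \<Rightarrow> real" and G :: "'a \<Rightarrow> 'a" and L :: real
    and g :: "'a \<Rightarrow> real" and Bg :: real and x0 :: 'a and R :: real
  assumes u_deriv: "\<And>x. GDERIV u x :> G x"
    and G_ucont: "uniformly_continuous_on UNIV G"
    and L: "0 < L" "\<And>x. norm (G x) \<le> L"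
    and g_meas [measurable]: "g \<in> borel_measurable borel"
    and g_bound: "\<And>x. \<bar>g x\<bar> \<le> Bg"
    and g_supp: "\<And>x. x \<notin> ball x0 (2 * R) \<Longrightarrow> g x = 0"
    and R: "0 < R"
    and eqn: "\<And>\<phi> D. C1c (ball x0 (2 * R)) \<phi> D \<Longrightarrow>
       (LBINT x. flux (G x) \<bullet> D x) = (LBINT x. g x * \<phi> x)"
begin

definition dq :: "real \<Rightarrow> 'a \<Rightarrow> 'a" where
  "dq h x = (\<Sum>e\<in>Basis. ((u (x + h *\<^sub>R e) - u x) / h) *\<^sub>R e)"

text \<open>This vector has two roles: it is the difference quotient of \<open>G\<close> in
  direction \<open>e\<close>, which appears in the differenced equation, and the gradient of the
  component \<open>dq h x \<bullet> e\<close>, which appears in the gradient of test functions.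
  Their coincidence replaces the symmetry of the Hessian.\<close>

definition dG :: "real \<Rightarrow> 'a \<Rightarrow> 'a \<Rightarrow> 'a" where
  "dG h e x = (G (x + h *\<^sub>R e) - G x) /\<^sub>R h"

section \<open>Difference quotients of the solution and of the equation\<close>

lemma G_cont: "continuous_on S G"
  using uniformly_continuous_imp_continuous[OF G_ucont] continuous_on_subset by blast

lemma G_meas [measurable]: "G \<in> borel_measurable borel"
  using G_cont by (rule borel_measurable_continuous_onI)

lemma dq_inner: "e \<in> Basis \<Longrightarrow> dq h x \<bullet> e = (u (x + h *\<^sub>R e) - u x) / h"
  by (simp add: dq_def)

lemma dq_deriv: "e \<in> Basis \<Longrightarrow> GDERIV (\<lambda>x. dq h x \<bullet> e) x :> dG h e x"
  using GDERIV_diffquot[OF u_deriv, of "h *\<^sub>R e" 0 h x] by (simp add: dq_inner dG_def)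

lemma dG_cont: "continuous_on S (dG h e)"
  unfolding dG_def[abs_def] by (intro continuous_intros G_cont continuous_on_compose2[OF G_cont[of UNIV]]) auto

lemma dq_cont: "continuous_on S (dq h)"
proof -
  have "continuous_on UNIV u" using u_deriv by (rule GDERIV_continuous_on)
  then have "continuous_on T u" for T using continuous_on_subset by blast
  then show ?thesis unfolding dq_def[abs_def] divide_inverse
    by (intro continuous_on_sum continuous_on_scaleR continuous_on_mult continuous_on_diff continuous_on_const
        continuous_on_compose2[of UNIV u S "\<lambda>x. x + h *\<^sub>R _"] continuous_on_add continuous_on_id) auto
qed

text \<open>Each component of \<open>dq\<close> is the same component of \<open>G\<close> at an
  intermediate point, so uniform continuity of \<open>G\<close> makes the convergence uniform in x.
  The components are added up, whence the division by twice the dimension; the factor two keeps the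
  final inequality strict.\<close>

lemma dq_close:
  assumes "0 < \<epsilon>"
  obtains h0 where "0 < h0" "\<And>h x. 0 < h \<Longrightarrow> h < h0 \<Longrightarrow> norm (dq h x - G x) < \<epsilon>"
    "\<And>h x e. 0 < h \<Longrightarrow> h < h0 \<Longrightarrow> e \<in> Basis \<Longrightarrow> norm (G (x + h *\<^sub>R e) - G x) < \<epsilon>"
proof -
  define \<epsilon>' where "\<epsilon>' = \<epsilon> / (2 * real DIM('a))"
  have e': "0 < \<epsilon>'" "\<epsilon>' < \<epsilon>" "real DIM('a) * \<epsilon>' < \<epsilon>"
  proof -
    have d: "1 \<le> real DIM('a)" using DIM_positive[where 'a='a] by linarith
    show "0 < \<epsilon>'" "real DIM('a) * \<epsilon>' < \<epsilon>" using assms d by (auto simp: \<epsilon>'_def)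
    then show "\<epsilon>' < \<epsilon>" using mult_right_mono[OF d, of \<epsilon>'] by linarith
  qed
  obtain h0 where h0: "0 < h0" "\<And>x x'. dist x' x < h0 \<Longrightarrow> dist (G x') (G x) < \<epsilon>'"
    using G_ucont e'(1) unfolding uniformly_continuous_on_def by (metis UNIV_I)
  show thesis
  proof (rule that[OF h0(1)])
    fix h :: real and x e :: 'a assume h: "0 < h" "h < h0"
    show "e \<in> Basis \<Longrightarrow> norm (G (x + h *\<^sub>R e) - G x) < \<epsilon>"
      using h0(2)[of "x + h *\<^sub>R e" x] h e' by (auto simp: dist_norm)
    have comp: "\<bar>(dq h x - G x) \<bullet> e\<bar> \<le> \<epsilon>'" if e: "e \<in> Basis" for e
    proof -
      obtain t where t: "t \<in> {0<..<1}" "u (x + h *\<^sub>R e) - u x = (h *\<^sub>R e) \<bullet> G (x + t *\<^sub>R (h *\<^sub>R e))"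
        using GDERIV_mvt[OF u_deriv] by blast
      then have "dq h x \<bullet> e = G (x + t *\<^sub>R (h *\<^sub>R e)) \<bullet> e"
        using h unfolding dq_inner[OF e] by (simp add: inner_commute)
      then have "\<bar>(dq h x - G x) \<bullet> e\<bar> = \<bar>(G (x + t *\<^sub>R (h *\<^sub>R e)) - G x) \<bullet> e\<bar>" by (simp add: inner_diff_left)
      also have "\<dots> \<le> norm (G (x + t *\<^sub>R (h *\<^sub>R e)) - G x)" using e by (rule Basis_le_norm)
      also have "\<dots> \<le> \<epsilon>'"
      proof -
        have "t * h \<le> h" using t h by (intro mult_left_le_one_le) auto
        then have "t * h < h0" using h by linarith
        then have "dist (x + t *\<^sub>R (h *\<^sub>R e)) x < h0" using e t h by (simp add: dist_norm)
        then show ?thesis using h0(2) by (metis dist_norm less_imp_le)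
      qed
      finally show ?thesis .
    qed
    have "norm (dq h x - G x) \<le> (\<Sum>e\<in>Basis. \<bar>(dq h x - G x) \<bullet> e\<bar>)" by (rule norm_le_l1)
    also have "\<dots> \<le> real DIM('a) * \<epsilon>'" using sum_bounded_above[of Basis "\<lambda>e. \<bar>(dq h x - G x) \<bullet> e\<bar>" \<epsilon>'] comp by simp
    finally show "norm (dq h x - G x) < \<epsilon>" using e' by simp
  qed
qed

lemma flux_G_meas [measurable]: "(\<lambda>x. flux (G x)) \<in> borel_measurable borel"
  by measurable

lemma flux_G_bound: "norm (flux (G x)) \<le> L * A L"
  using norm_flux_le[OF L(2) L(1)] .

lemma g_square_integrable: "integrable lborel (\<lambda>x. (g x)\<^sup>2)"
proof (rule Bochner_Integration.integrable_bound)
  show "integrable lborel (\<lambda>x. Bg\<^sup>2 * indicator (ball x0 (2 * R)) x)"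
    using emeasure_lborel_ball_finite by (intro integrable_mult_right integrable_real_indicator) auto
  show "AE x in lborel. norm ((g x)\<^sup>2) \<le> norm (Bg\<^sup>2 * indicator (ball x0 (2 * R)) x)"
  proof (intro always_eventually allI)
    fix x
    have "(g x)\<^sup>2 \<le> Bg\<^sup>2" using power_mono[OF g_bound[of x], of 2] by simp
    then show "norm ((g x)\<^sup>2) \<le> norm (Bg\<^sup>2 * indicator (ball x0 (2 * R)) x)"
      using g_supp[of x] by (auto simp: indicator_def)
  qed
qed measurable

text \<open>Discrete integration by parts: a change of variables moves the forward quotient of the
  flux to a backward quotient of \<open>\<psi>\<close>, which is itself an admissible test function.
  Its support grows by \<open>h\<close>; the margin \<open>2 * h\<close> places it in an open
  ball.\<close>

lemma flux_diffquot_test: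
  assumes \<psi>: "C1c (cball x1 r) \<psi> D" and h: "0 < h" and sub: "cball x1 (r + 2 * h) \<subseteq> ball x0 (2 * R)" and e: "e \<in> Basis"
  shows "(LBINT x. ((flux (G (x + h *\<^sub>R e)) - flux (G x)) /\<^sub>R h) \<bullet> D x)
       = - (LBINT x. g x * ((\<psi> x - \<psi> (x - h *\<^sub>R e)) / h))"
    and "integrable lborel (\<lambda>x. ((flux (G (x + h *\<^sub>R e)) - flux (G x)) /\<^sub>R h) \<bullet> D x)"
proof -
  obtain K where K: "compact K" "\<And>x. x \<notin> K \<Longrightarrow> D x = 0"
    using \<psi> by (rule C1c_support) blast
  have i: "integrable lborel (\<lambda>x. flux (G (x + c)) \<bullet> D x)" for c
    by (rule integrable_bounded_inner[OF _ flux_G_bound C1c_D(2)[OF \<psi>] K]) measurable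
  have eq: "((flux (G (x + h *\<^sub>R e)) - flux (G x)) /\<^sub>R h) \<bullet> D x = (flux (G (x + h *\<^sub>R e)) \<bullet> D x - flux (G (x + 0)) \<bullet> D x) / h" for x
    by (simp add: inner_diff_left divide_inverse mult.commute)
  show "integrable lborel (\<lambda>x. ((flux (G (x + h *\<^sub>R e)) - flux (G x)) /\<^sub>R h) \<bullet> D x)"
    unfolding eq by (intro integrable_divide_zero Bochner_Integration.integrable_diff i)
  have [measurable]: "D \<in> borel_measurable borel" using C1c_D(2)[OF \<psi>] by (rule borel_measurable_continuous_onI)
  have tr: "(LBINT x. flux (G (x + h *\<^sub>R e)) \<bullet> D x) = (LBINT x. flux (G x) \<bullet> D (x - h *\<^sub>R e))"
    using lborel_integral_translate[of "\<lambda>x. flux (G x) \<bullet> D (x - h *\<^sub>R e)" "h *\<^sub>R e"] by simp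
  have itr: "integrable lborel (\<lambda>x. flux (G x) \<bullet> D (x - h *\<^sub>R e))"
    using lborel_integrable_translate[OF i[of "h *\<^sub>R e"], of "- (h *\<^sub>R e)"] by simp
  have "C1c (ball x1 (r + 2 * h)) (\<lambda>x. (\<psi> x - \<psi> (x - h *\<^sub>R e)) / h) (\<lambda>x. (D x - D (x - h *\<^sub>R e)) /\<^sub>R h)"
    by (rule C1c_diffquot[OF \<psi>]) (use h e in auto)
  then have "C1c (ball x0 (2 * R)) (\<lambda>x. (\<psi> x - \<psi> (x - h *\<^sub>R e)) / h) (\<lambda>x. (D x - D (x - h *\<^sub>R e)) /\<^sub>R h)"
    by (rule C1c_mono) (use sub ball_subset_cball in blast)
  from eqn[OF this]
  have "(LBINT x. g x * ((\<psi> x - \<psi> (x - h *\<^sub>R e)) / h)) = (LBINT x. flux (G x) \<bullet> ((D x - D (x - h *\<^sub>R e)) /\<^sub>R h))"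
    by simp
  also have "\<dots> = (LBINT x. (flux (G (x + 0)) \<bullet> D x - flux (G x) \<bullet> D (x - h *\<^sub>R e)) / h)"
    by (simp add: inner_diff_right divide_inverse mult.commute)
  also have "\<dots> = ((LBINT x. flux (G (x + 0)) \<bullet> D x) - (LBINT x. flux (G x) \<bullet> D (x - h *\<^sub>R e))) / h"
    using i[of 0] itr by simp
  also have "\<dots> = - (LBINT x. (flux (G (x + h *\<^sub>R e)) \<bullet> D x - flux (G (x + 0)) \<bullet> D x) / h)"
    using i[of 0] i[of "h *\<^sub>R e"] tr by (simp add: minus_divide_left)
  finally show "(LBINT x. ((flux (G (x + h *\<^sub>R e)) - flux (G x)) /\<^sub>R h) \<bullet> D x)
       = - (LBINT x. g x * ((\<psi> x - \<psi> (x - h *\<^sub>R e)) / h))"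
    unfolding eq by simp
qed

end

section \<open>Second differences away from the critical set\<close>

lemma square_add_le: "(a + b)\<^sup>2 \<le> 2 * a\<^sup>2 + 2 * (b::real)\<^sup>2"
  using zero_le_power2[of "a - b"] unfolding power2_eq_square by (simp add: algebra_simps)

context flux_equation
begin

definition dF :: "real \<Rightarrow> 'a \<Rightarrow> 'a \<Rightarrow> 'a" where
  "dF h e x = (flux (G (x + h *\<^sub>R e)) - flux (G x)) /\<^sub>R h"

text \<open>Both \<open>G x\<close> and \<open>G (x + h *\<^sub>R e)\<close> are close to
  \<open>dq h x\<close> for small h, so the flux may be linearised there. The base point is
  \<open>dq h x\<close> rather than \<open>G x\<close> because the truncation is evaluated at
  \<open>dq h x\<close> too, and the two derivatives must share their eigenvectors.\<close>

lemma dF_approx: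
  assumes "0 < \<delta>" "0 < \<omega>"
  obtains h0 where "0 < h0" "\<And>h x. 0 < h \<Longrightarrow> h < h0 \<Longrightarrow> norm (dq h x) \<le> L + 1"
    "\<And>h x. 0 < h \<Longrightarrow> h < h0 \<Longrightarrow> norm (dq h x - G x) < \<delta>"
    "\<And>h x e. 0 < h \<Longrightarrow> h < h0 \<Longrightarrow> e \<in> Basis \<Longrightarrow> \<delta> \<le> norm (dq h x) \<Longrightarrow>
       norm (dF h e x - dflux (dq h x) (dG h e x)) \<le> \<omega> * norm (dG h e x)"
proof -
  obtain \<rho> where \<rho>: "0 < \<rho>" "\<And>\<xi> a b::'a. \<delta> \<le> norm \<xi> \<Longrightarrow> norm \<xi> \<le> L + 1 \<Longrightarrow> norm (a - \<xi>) < \<rho> \<Longrightarrow>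
     norm (b - \<xi>) < \<rho> \<Longrightarrow> norm (flux b - flux a - dflux \<xi> (b - a)) \<le> \<omega> * norm (b - a)"
    by (rule flux_difference[of \<delta> \<omega> "L + 1", where 'a='a]) (use assms in auto)
  \<comment> \<open>The bound 1 gives \<open>norm (dq h x) \<le> L + 1\<close>, the bound
    \<open>\<delta>\<close> gives the second claim, and \<open>\<rho> / 2\<close> is used twice in
    the triangle inequality that brings \<open>G (x + h *\<^sub>R e)\<close> within
    \<open>\<rho>\<close> of \<open>dq h x\<close>.\<close>
  define \<epsilon> where "\<epsilon> = min (min 1 \<delta>) (\<rho> / 2)"
  have "0 < \<epsilon>" using assms \<rho> by (simp add: \<epsilon>_def)
  then obtain h0 where h0: "0 < h0" "\<And>h x. 0 < h \<Longrightarrow> h < h0 \<Longrightarrow> norm (dq h x - G x) < \<epsilon>"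
    "\<And>h x e. 0 < h \<Longrightarrow> h < h0 \<Longrightarrow> e \<in> Basis \<Longrightarrow> norm (G (x + h *\<^sub>R e) - G x) < \<epsilon>"
    by (rule dq_close) blast
  show thesis
  proof (rule that[OF h0(1)])
    fix h :: real and x e :: 'a assume h: "0 < h" "h < h0"
    note c = h0(2)[OF h, of x]
    show b: "norm (dq h x) \<le> L + 1" using c L(2)[of x] norm_triangle_ineq2[of "dq h x" "G x"] by (simp add: \<epsilon>_def)
    show "norm (dq h x - G x) < \<delta>" using c by (simp add: \<epsilon>_def)
    assume e: "e \<in> Basis" and \<delta>: "\<delta> \<le> norm (dq h x)"
    interpret l: linear "dflux (dq h x)" by (rule linear_dflux)
    have 1: "norm (G x - dq h x) < \<rho>" using c \<rho>(1) by (simp add: \<epsilon>_def norm_minus_commute)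
    have "norm (G (x + h *\<^sub>R e) - dq h x) \<le> norm (G (x + h *\<^sub>R e) - G x) + norm (dq h x - G x)"
      using norm_triangle_ineq4[of "G (x + h *\<^sub>R e) - G x" "dq h x - G x"] by simp
    then have 2: "norm (G (x + h *\<^sub>R e) - dq h x) < \<rho>" using c h0(3)[OF h e, of x] by (simp add: \<epsilon>_def)
    have "norm (dF h e x - dflux (dq h x) (dG h e x)) = 
      norm (flux (G (x + h *\<^sub>R e)) - flux (G x) - dflux (dq h x) (G (x + h *\<^sub>R e) - G x)) / h"
      using h by (simp add: dF_def dG_def l.scale scaleR_diff_right[symmetric] divide_inverse mult.commute)
    also have "\<dots> \<le> \<omega> * norm (G (x + h *\<^sub>R e) - G x) / h"
      using \<rho>(2)[OF \<delta> b 1 2] h by (intro divide_right_mono) auto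
    finally show "norm (dF h e x - dflux (dq h x) (dG h e x)) \<le> \<omega> * norm (dG h e x)"
      using h by (simp add: dG_def divide_inverse mult.commute mult.left_commute)
  qed
qed

text \<open>On this ball \<open>dq\<close> has norm at least \<open>\<delta>\<close>, so the
  equation is uniformly elliptic. The differenced equation is tested with \<open>cap ^ 4\<close>
  times a component of \<open>dq\<close>; the cutoff terms and the source are absorbed by Young's
  inequality, with constants that depend on \<open>\<delta>\<close> but not on h.\<close>

lemma difference_energy_local:
  assumes r: "0 < r" and sub: "cball x1 (2 * r) \<subseteq> ball x0 (2 * R)" and \<delta>: "0 < \<delta>"
    and G: "\<And>x. x \<in> cball x1 r \<Longrightarrow> 2 * \<delta> \<le> norm (G x)"
  obtains C h0 where "0 < h0" "\<And>h e. 0 < h \<Longrightarrow> h < h0 \<Longrightarrow> e \<in> Basis \<Longrightarrow>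
     (LBINT x. cap x1 r x ^ 4 * (norm (dG h e x))\<^sup>2) \<le> C"
proof -
  have \<delta>L: "\<delta> \<le> L + 1" using G[of x1] r L(2)[of x1] \<delta> by auto
  obtain lo hi where A: "0 < lo" "\<And>t. \<delta> \<le> t \<Longrightarrow> t \<le> L + 1 \<Longrightarrow> lo \<le> A t \<and> A t \<le> hi"
    by (rule A_bounds[OF \<delta> \<delta>L]) blast
  define c where "c = c0 * lo"
  have c: "0 < c" using A(1) c0 by (simp add: c_def)
  obtain h0 where h0: "0 < h0" "\<And>h x. 0 < h \<Longrightarrow> h < h0 \<Longrightarrow> norm (dq h x) \<le> L + 1"
    "\<And>h x. 0 < h \<Longrightarrow> h < h0 \<Longrightarrow> norm (dq h x - G x) < \<delta>"
    "\<And>h x e. 0 < h \<Longrightarrow> h < h0 \<Longrightarrow> e \<in> Basis \<Longrightarrow> \<delta> \<le> norm (dq h x) \<Longrightarrow>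
       norm (dF h e x - dflux (dq h x) (dG h e x)) \<le> c / 2 * norm (dG h e x)"
    by (rule dF_approx[OF \<delta>, of "c / 2"]) (use c in auto)
  \<comment> \<open>\<open>Cq\<close> bounds \<open>dF\<close> by a multiple of \<open>dG\<close>.
    The constants \<open>b1\<close> and \<open>b2\<close> come from the gradient of the cutoff,
    before and after Young's inequality, and \<open>b3\<close> is the corresponding square in the
    test function's gradient.\<close>
  define Cq where "Cq = (2 + M) * hi + c / 2"
  define b1 where "b1 = Cq * (L + 1) * 8 * r"
  define m where "m = measure lborel (cball x1 r)"
  define b2 where "b2 = b1\<^sup>2 * r ^ 4 / c"
  define b3 where "b3 = 128 * (L + 1)\<^sup>2 * r ^ 14"
  \<comment> \<open>With this value the gradient term of the test function contributes
    \<open>\<kappa> * r ^ 8 = c / 8\<close> times the energy, half of the coercive part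
    \<open>c / 4\<close> that survives the other absorptions.\<close>
  define \<kappa> where "\<kappa> = c / (8 * r ^ 8)"
  have \<kappa>: "0 < \<kappa>" using c r by (simp add: \<kappa>_def)
  define Ig where "Ig = (LBINT x. (g x)\<^sup>2)"
  have icb: "integrable lborel (indicat_real (cball x1 r))"
    using emeasure_lborel_cball_finite by (intro integrable_real_indicator) auto
  show thesis
  proof (rule that[of "min h0 (r / 2)" "8 / c * (b2 * m + Ig / (2 * \<kappa>) + \<kappa> / 2 * (b3 * m))"])
    show "0 < min h0 (r / 2)" using h0 r by simp
    fix h :: real and e :: 'a assume h: "0 < h" "h < min h0 (r / 2)" and e: "e \<in> Basis"
    have hh: "h < h0" using h by simp
    define s where "s x = cap x1 r x" for x
    have s: "0 \<le> s x" "s x \<le> r\<^sup>2" for x using cap_nonneg cap_le by (auto simp: s_def)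
    have s0: "s x = 0" if "x \<notin> cball x1 r" for x using cap_outside[OF that r] by (simp add: s_def)
    have cs: "continuous_on UNIV s" unfolding s_def[abs_def] by (rule cap_continuous)
    define y where "y x = dG h e x" for x
    define D where "D x = s x ^ 4 *\<^sub>R y x + ((dq h x \<bullet> e) * (- 8 * s x ^ 3)) *\<^sub>R (x - x1)" for x
    have C: "C1c (cball x1 r) (\<lambda>x. s x ^ 4 * (dq h x \<bullet> e)) D"
      using C1c_cap_mult[OF r dq_deriv[OF e, of h] dG_cont, of x1 2]
      unfolding D_def[abs_def] y_def[abs_def] s_def[abs_def] by (simp add: eval_nat_numeral)
    have sub': "cball x1 (r + 2 * h) \<subseteq> ball x0 (2 * R)" using sub h subset_cball[of "r + 2 * h" "2 * r" x1] by auto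
    have iy: "integrable lborel (\<lambda>x. s x ^ 4 * (norm (y x))\<^sup>2)"
      by (rule integrable_continuous_compact_support[of _ "cball x1 r"])
        (auto intro!: continuous_intros cs dG_cont simp: s0 y_def[abs_def])
    define X where "X = (LBINT x. s x ^ 4 * (norm (y x))\<^sup>2)"
    have b1: "0 \<le> b1"
    proof -
      have "0 < hi" using A(2)[of "L + 1"] \<delta>L A(1) by auto
      then show ?thesis using M c L(1) r by (auto simp: b1_def Cq_def intro!: mult_nonneg_nonneg add_nonneg_nonneg)
    qed
    \<comment> \<open>From the coercivity constant \<open>c\<close>, one half is lost to the
      linearisation error and a further quarter to the gradient of the cutoff, leaving
      \<open>c / 4\<close>.\<close>
    have low: "c / 4 * (s x ^ 4 * (norm (y x))\<^sup>2) - b2 * indicator (cball x1 r) x \<le> dF h e x \<bullet> D x" for x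
    proof (cases "x \<in> cball x1 r")
      case True
      have dx: "dist x1 x \<le> r" using True by simp
      have n: "\<delta> \<le> norm (dq h x)" using G[OF True] h0(3)[OF h(1) hh, of x] norm_triangle_ineq2[of "G x" "dq h x"] norm_minus_commute[of "G x" "dq h x"] by linarith
      note n2 = h0(2)[OF h(1) hh, of x]
      have nz: "dq h x \<noteq> 0" using n \<delta> by auto
      have A2: "lo \<le> A (norm (dq h x))" "A (norm (dq h x)) \<le> hi" using A(2)[OF n n2] by auto
      note ap = h0(4)[OF h(1) hh e n]
      have q1: "c * (norm (y x))\<^sup>2 \<le> dflux (dq h x) (y x) \<bullet> y x"
      proof -
        have "c * (norm (y x))\<^sup>2 \<le> c0 * A (norm (dq h x)) * (norm (y x))\<^sup>2"
          unfolding c_def using A2 c0 by (intro mult_right_mono mult_left_mono) auto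
        then show ?thesis using dflux_coercive[OF nz, of "y x"] by linarith
      qed
      have q2: "c / 2 * (norm (y x))\<^sup>2 \<le> dF h e x \<bullet> y x"
      proof -
        have "\<bar>(dF h e x - dflux (dq h x) (y x)) \<bullet> y x\<bar> \<le> norm (dF h e x - dflux (dq h x) (y x)) * norm (y x)"
          by (rule Cauchy_Schwarz_ineq2)
        also have "\<dots> \<le> c / 2 * norm (y x) * norm (y x)"
          using ap by (intro mult_right_mono) (auto simp: y_def)
        also have "\<dots> = c / 2 * (norm (y x))\<^sup>2" by (simp add: power2_eq_square)
        finally have "\<bar>dF h e x \<bullet> y x - dflux (dq h x) (y x) \<bullet> y x\<bar> \<le> c / 2 * (norm (y x))\<^sup>2"
          by (simp only: inner_diff_left)
        then show ?thesis using q1 by linarith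
      qed
      have q3: "norm (dF h e x) \<le> Cq * norm (y x)"
      proof -
        have "norm (dF h e x) \<le> norm (dflux (dq h x) (y x)) + c / 2 * norm (y x)"
          using ap norm_triangle_ineq2[of "dF h e x" "dflux (dq h x) (y x)"] by (simp add: y_def)
        moreover have "norm (dflux (dq h x) (y x)) \<le> (2 + M) * hi * norm (y x)"
        proof -
          have "(2 + M) * A (norm (dq h x)) * norm (y x) \<le> (2 + M) * hi * norm (y x)"
            using A2 M by (intro mult_right_mono mult_left_mono) auto
          then show ?thesis using norm_dflux_le[OF nz, of "y x"] by linarith
        qed
        ultimately show ?thesis by (simp add: Cq_def algebra_simps)
      qed
      have Cq0: "0 \<le> Cq"
      proof -
        have "0 < hi" using A2 A(1) by linarith
        then show ?thesis using M c by (auto simp: Cq_def intro!: mult_nonneg_nonneg add_nonneg_nonneg)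
      qed
      have "\<bar>dF h e x \<bullet> (((dq h x \<bullet> e) * (- 8 * s x ^ 3)) *\<^sub>R (x - x1))\<bar> \<le> b1 * (s x ^ 3 * norm (y x))"
      proof -
        have "\<bar>dF h e x \<bullet> (((dq h x \<bullet> e) * (- 8 * s x ^ 3)) *\<^sub>R (x - x1))\<bar> \<le> norm (dF h e x) * norm (((dq h x \<bullet> e) * (- 8 * s x ^ 3)) *\<^sub>R (x - x1))"
          by (rule Cauchy_Schwarz_ineq2)
        also have "\<dots> = norm (dF h e x) * (\<bar>dq h x \<bullet> e\<bar> * (8 * s x ^ 3) * norm (x - x1))"
          using s(1)[of x] by (simp add: abs_mult)
        also have "\<dots> \<le> (Cq * norm (y x)) * ((L + 1) * (8 * s x ^ 3) * r)"
          using q3 n2 Basis_le_norm[OF e, of "dq h x"] s(1)[of x] dx r L(1) Cq0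
          by (intro mult_mono) (auto simp: dist_norm norm_minus_commute)
        also have "\<dots> = b1 * (s x ^ 3 * norm (y x))" by (simp add: b1_def algebra_simps)
        finally show ?thesis .
      qed
      also have "b1 * (s x ^ 3 * norm (y x)) \<le> c / 4 * (s x ^ 4 * (norm (y x))\<^sup>2) + b1\<^sup>2 * (s x)\<^sup>2 / c"
      proof -
        have "0 \<le> (c / 2 * ((s x)\<^sup>2 * norm (y x)) - b1 * s x)\<^sup>2 / c" using c by simp
        also have "\<dots> = c / 4 * (s x ^ 4 * (norm (y x))\<^sup>2) + b1\<^sup>2 * (s x)\<^sup>2 / c - b1 * (s x ^ 3 * norm (y x))"
          using c by (simp add: field_simps power2_eq_square power3_eq_cube power4_eq_xxxx)
        finally show ?thesis by simp
      qed
      also have "b1\<^sup>2 * (s x)\<^sup>2 / c \<le> b2"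
      proof -
        have "(s x)\<^sup>2 \<le> (r\<^sup>2)\<^sup>2" using s[of x] by (intro power_mono) auto
        then show ?thesis unfolding b2_def using c by (intro divide_right_mono mult_left_mono) (auto simp: power_mult[symmetric])
      qed
      finally have "\<bar>dF h e x \<bullet> (((dq h x \<bullet> e) * (- 8 * s x ^ 3)) *\<^sub>R (x - x1))\<bar> \<le> c / 4 * (s x ^ 4 * (norm (y x))\<^sup>2) + b2" by simp
      moreover have "s x ^ 4 * (c / 2 * (norm (y x))\<^sup>2) \<le> s x ^ 4 * (dF h e x \<bullet> y x)"
        using q2 s(1)[of x] by (intro mult_left_mono) auto
      moreover have "dF h e x \<bullet> D x = s x ^ 4 * (dF h e x \<bullet> y x) + dF h e x \<bullet> (((dq h x \<bullet> e) * (- 8 * s x ^ 3)) *\<^sub>R (x - x1))"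
        unfolding D_def by (simp only: inner_add_right inner_scaleR_right)
      ultimately show ?thesis using True by (simp add: algebra_simps)
    next
      case False
      then show ?thesis by (simp add: s0 D_def)
    qed
    have up: "(norm (D x))\<^sup>2 \<le> 2 * r ^ 8 * (s x ^ 4 * (norm (y x))\<^sup>2) + b3 * indicator (cball x1 r) x" for x
    proof (cases "x \<in> cball x1 r")
      case True
      have dx: "dist x1 x \<le> r" using True by simp
      have n1: "norm (s x ^ 4 *\<^sub>R y x) = s x ^ 4 * norm (y x)" using s(1)[of x] by simp
      have n2: "norm (((dq h x \<bullet> e) * (- 8 * s x ^ 3)) *\<^sub>R (x - x1)) \<le> (L + 1) * (8 * (r\<^sup>2) ^ 3) * r"
      proof -
        have "norm (((dq h x \<bullet> e) * (- 8 * s x ^ 3)) *\<^sub>R (x - x1)) = \<bar>dq h x \<bullet> e\<bar> * (8 * s x ^ 3) * norm (x - x1)"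
          using s(1)[of x] by (simp add: abs_mult)
        also have "\<dots> \<le> (L + 1) * (8 * (r\<^sup>2) ^ 3) * r"
          using h0(2)[OF h(1) hh, of x] Basis_le_norm[OF e, of "dq h x"] s[of x] dx r L(1)
          by (intro mult_mono power_mono) (auto simp: dist_norm norm_minus_commute)
        finally show ?thesis .
      qed
      have "norm (D x) \<le> s x ^ 4 * norm (y x) + (L + 1) * (8 * (r\<^sup>2) ^ 3) * r"
        unfolding D_def using norm_triangle_ineq[of "s x ^ 4 *\<^sub>R y x"] n1 n2 by (smt (verit))
      then have "(norm (D x))\<^sup>2 \<le> (s x ^ 4 * norm (y x) + (L + 1) * (8 * (r\<^sup>2) ^ 3) * r)\<^sup>2" by (intro power_mono) auto
      also have "\<dots> \<le> 2 * (s x ^ 4 * norm (y x))\<^sup>2 + 2 * ((L + 1) * (8 * (r\<^sup>2) ^ 3) * r)\<^sup>2"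
        by (rule square_add_le)
      also have "2 * ((L + 1) * (8 * (r\<^sup>2) ^ 3) * r)\<^sup>2 = b3"
        unfolding b3_def by (simp add: eval_nat_numeral)
      also have "2 * (s x ^ 4 * norm (y x))\<^sup>2 \<le> 2 * r ^ 8 * (s x ^ 4 * (norm (y x))\<^sup>2)"
      proof -
        have "s x ^ 4 \<le> (r\<^sup>2) ^ 4" using s[of x] by (intro power_mono) auto
        then have "s x ^ 4 * (s x ^ 4 * (norm (y x))\<^sup>2) \<le> (r\<^sup>2) ^ 4 * (s x ^ 4 * (norm (y x))\<^sup>2)"
          by (intro mult_right_mono) auto
        then show ?thesis by (simp add: power_mult_distrib power_mult[symmetric] mult.assoc)
      qed
      finally show ?thesis using True by simp
    next
      case False
      then show ?thesis by (simp add: s0 D_def)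
    qed
    note T = flux_diffquot_test[OF C h(1) sub' e, folded dF_def]
    have ilow: "integrable lborel (\<lambda>x. c / 4 * (s x ^ 4 * (norm (y x))\<^sup>2) - b2 * indicator (cball x1 r) x)"
      using iy icb by auto
    have iup: "integrable lborel (\<lambda>x. 2 * r ^ 8 * (s x ^ 4 * (norm (y x))\<^sup>2) + b3 * indicator (cball x1 r) x)"
      using iy icb by auto
    have "c / 4 * X - b2 * m = (LBINT x. c / 4 * (s x ^ 4 * (norm (y x))\<^sup>2) - b2 * indicator (cball x1 r) x)"
      using iy icb by (simp add: X_def m_def)
    also have "\<dots> \<le> (LBINT x. dF h e x \<bullet> D x)"
      by (rule integral_mono[OF ilow T(2)]) (rule low)
    also have "\<dots> \<le> \<bar>(LBINT x. g x * ((s x ^ 4 * (dq h x \<bullet> e) - s (x - h *\<^sub>R e) ^ 4 * (dq h (x - h *\<^sub>R e) \<bullet> e)) / h))\<bar>"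
      unfolding T(1) by (rule abs_ge_minus_self)
    also have "\<dots> \<le> Ig / (2 * \<kappa>) + \<kappa> / 2 * (LBINT x. (norm (D x))\<^sup>2)"
      unfolding Ig_def by (rule young_diffquot[OF C _ h(1) \<kappa> g_meas g_square_integrable]) (use e in auto)
    also have "\<dots> \<le> Ig / (2 * \<kappa>) + \<kappa> / 2 * (LBINT x. 2 * r ^ 8 * (s x ^ 4 * (norm (y x))\<^sup>2) + b3 * indicator (cball x1 r) x)"
    proof (intro add_left_mono mult_left_mono integral_mono[OF _ iup])
      show "integrable lborel (\<lambda>x. (norm (D x))\<^sup>2)"
        by (rule integrable_continuous_compact_support[of _ "cball x1 r"])
          (intro continuous_intros C1c_D(2)[OF C], auto simp: s0 D_def)
    qed (use \<kappa> up in auto)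
    also have "\<dots> = Ig / (2 * \<kappa>) + \<kappa> / 2 * (2 * r ^ 8 * X + b3 * m)"
      using iy icb by (simp add: X_def m_def)
    also have "\<dots> = Ig / (2 * \<kappa>) + c / 8 * X + \<kappa> / 2 * (b3 * m)"
      using r by (simp add: \<kappa>_def distrib_left)
    finally have "c / 8 * X \<le> b2 * m + Ig / (2 * \<kappa>) + \<kappa> / 2 * (b3 * m)" by linarith
    then have "8 / c * (c / 8 * X) \<le> 8 / c * (b2 * m + Ig / (2 * \<kappa>) + \<kappa> / 2 * (b3 * m))"
      using c by (intro mult_left_mono) auto
    then have "X \<le> 8 / c * (b2 * m + Ig / (2 * \<kappa>) + \<kappa> / 2 * (b3 * m))" using c by simp
    then show "(LBINT x. cap x1 r x ^ 4 * (norm (dG h e x))\<^sup>2) \<le> 8 / c * (b2 * m + Ig / (2 * \<kappa>) + \<kappa> / 2 * (b3 * m))"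
      by (simp add: X_def s_def y_def)
  qed
qed

text \<open>The part of the closed ball where \<open>norm (G x)\<close> is at least
  \<open>\<delta>\<close> is compact. Finitely many balls of half radius cover it, and on each of
  them the local cap is bounded away from zero, so the local energies add up to the claim.\<close>

lemma difference_energy:
  assumes \<delta>: "0 < \<delta>"
  obtains C h0 where "0 < h0" "0 \<le> C" "\<And>h e. 0 < h \<Longrightarrow> h < h0 \<Longrightarrow> e \<in> Basis \<Longrightarrow>
     (LBINT x. indicator {x \<in> cball x0 R. \<delta> \<le> norm (G x)} x * (norm (dG h e x))\<^sup>2) \<le> C"
proof -
  define K where "K = {x \<in> cball x0 R. \<delta> \<le> norm (G x)}"
  have "closed {x. \<delta> \<le> norm (G x)}" by (intro closed_Collect_le continuous_intros G_cont)
  then have "compact (cball x0 R \<inter> {x. \<delta> \<le> norm (G x)})" by (intro compact_Int_closed) auto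
  moreover have "K = cball x0 R \<inter> {x. \<delta> \<le> norm (G x)}" by (auto simp: K_def)
  ultimately have K: "compact K" by simp
  have "\<exists>r>0. cball x1 (2 * r) \<subseteq> ball x0 (2 * R) \<and> (\<forall>x\<in>cball x1 r. 2 * (\<delta> / 3) \<le> norm (G x))" if "x1 \<in> K" for x1
  proof -
    have "x1 \<in> ball x0 (2 * R)" using that R by (simp add: K_def)
    then obtain r1 where r1: "0 < r1" "cball x1 r1 \<subseteq> ball x0 (2 * R)" using open_contains_cball[of "ball x0 (2 * R)"] open_ball by blast
    obtain r2 where r2: "0 < r2" "\<And>x. dist x x1 < r2 \<Longrightarrow> dist (G x) (G x1) < \<delta> / 3"
      using G_cont[of UNIV] \<delta> unfolding continuous_on_iff by (metis UNIV_I divide_pos_pos zero_less_numeral)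
    show ?thesis
    proof (intro exI[of _ "min (r1 / 2) (r2 / 2)"] conjI ballI)
      show "0 < min (r1 / 2) (r2 / 2)" using r1 r2 by simp
      show "cball x1 (2 * min (r1 / 2) (r2 / 2)) \<subseteq> ball x0 (2 * R)"
        by (rule order_trans[OF subset_cball r1(2)]) auto
      fix x assume "x \<in> cball x1 (min (r1 / 2) (r2 / 2))"
      then have "dist x x1 < r2" using r2(1) by (auto simp: dist_commute)
      then have "norm (G x - G x1) < \<delta> / 3" using r2(2) by (simp add: dist_norm)
      then show "2 * (\<delta> / 3) \<le> norm (G x)"
        using that norm_triangle_ineq2[of "G x1" "G x"] norm_minus_commute[of "G x" "G x1"] by (simp add: K_def)
    qed
  qed
  then obtain r where r: "\<And>x. x \<in> K \<Longrightarrow> 0 < r x" "\<And>x1. x1 \<in> K \<Longrightarrow> cball x1 (2 * r x1) \<subseteq> ball x0 (2 * R)"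
     "\<And>x1 x. x1 \<in> K \<Longrightarrow> x \<in> cball x1 (r x1) \<Longrightarrow> 2 * (\<delta> / 3) \<le> norm (G x)"
    by metis
  define Q where "Q x1 C h0 \<longleftrightarrow> 0 < h0 \<and> (\<forall>h e. 0 < h \<longrightarrow> h < h0 \<longrightarrow> e \<in> Basis \<longrightarrow>
     (LBINT x. cap x1 (r x1) x ^ 4 * (norm (dG h e x))\<^sup>2) \<le> C)" for x1 C h0
  have "\<exists>C h0. Q x1 C h0" if "x1 \<in> K" for x1
    unfolding Q_def
    by (rule difference_energy_local[OF r(1)[OF that] r(2)[OF that] _ r(3)[OF that]]) (use \<delta> in auto)
  then obtain C h0 where "\<And>x1. x1 \<in> K \<Longrightarrow> Q x1 (C x1) (h0 x1)" by metis
  then have Ch: "\<And>x1. x1 \<in> K \<Longrightarrow> 0 < h0 x1"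
     "\<And>x1 h e. x1 \<in> K \<Longrightarrow> 0 < h \<Longrightarrow> h < h0 x1 \<Longrightarrow> e \<in> Basis \<Longrightarrow>
     (LBINT x. cap x1 (r x1) x ^ 4 * (norm (dG h e x))\<^sup>2) \<le> C x1"
    unfolding Q_def by auto
  obtain F where F: "F \<subseteq> K" "finite F" "K \<subseteq> (\<Union>x1\<in>F. ball x1 (r x1 / 2))"
    using compactE_image[OF K, of K "\<lambda>x1. ball x1 (r x1 / 2)"] r(1) by (metis (no_types, lifting) UN_I centre_in_ball half_gt_zero open_ball subsetI)
  \<comment> \<open>Inserting 1 keeps the minimum defined when the cover is empty, which happens if
    the gradient is small on the whole ball.\<close>
  define hm where "hm = Min (insert 1 (h0 ` F))"
  have hm: "0 < hm" "\<And>x1. x1 \<in> F \<Longrightarrow> hm \<le> h0 x1" using F Ch(1) by (auto simp: hm_def)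
  \<comment> \<open>A lower bound for the fourth power of the cap on the ball of half
    radius.\<close>
  define a where "a x1 = ((r x1)\<^sup>2 / 2) ^ 4" for x1
  have a: "0 < a x1" if "x1 \<in> F" for x1
  proof -
    have "0 < r x1" using that F r(1) by auto
    then show ?thesis by (simp add: a_def)
  qed
  define CC where "CC = (\<Sum>x1\<in>F. C x1 / a x1)"
  show thesis
  proof (rule that[OF hm(1), of "max 0 CC"])
    fix h :: real and e :: 'a assume h: "0 < h" "h < hm" and e: "e \<in> Basis"
    have i: "integrable lborel (\<lambda>x. cap x1 (r x1) x ^ 4 * (norm (dG h e x))\<^sup>2)" if "x1 \<in> F" for x1
    proof -
      have "0 < r x1" using that F r(1) by auto
      then show ?thesis by (intro integrable_continuous_compact_support[of _ "cball x1 (r x1)"])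
          (auto intro!: continuous_intros cap_continuous dG_cont simp: cap_outside)
    qed
    have "(LBINT x. indicator K x * (norm (dG h e x))\<^sup>2)
       \<le> (LBINT x. \<Sum>x1\<in>F. cap x1 (r x1) x ^ 4 * (norm (dG h e x))\<^sup>2 / a x1)"
    proof (rule integral_mono)
      have "integrable lborel (\<lambda>x. indicator K x *\<^sub>R (norm (dG h e x))\<^sup>2)"
        by (intro borel_integrable_compact K continuous_intros dG_cont)
      then show "integrable lborel (\<lambda>x. indicator K x * (norm (dG h e x))\<^sup>2)" by simp
      show "integrable lborel (\<lambda>x. \<Sum>x1\<in>F. cap x1 (r x1) x ^ 4 * (norm (dG h e x))\<^sup>2 / a x1)"
        by (intro Bochner_Integration.integrable_sum integrable_divide_zero i)
      fix x
      have nn: "0 \<le> cap x1 (r x1) x ^ 4 * (norm (dG h e x))\<^sup>2 / a x1" if "x1 \<in> F" for x1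
        using a[OF that] by (intro divide_nonneg_pos mult_nonneg_nonneg zero_le_power cap_nonneg) auto
      show "indicator K x * (norm (dG h e x))\<^sup>2 \<le> (\<Sum>x1\<in>F. cap x1 (r x1) x ^ 4 * (norm (dG h e x))\<^sup>2 / a x1)"
      proof (cases "x \<in> K")
        case True
        then obtain x1 where x1: "x1 \<in> F" "x \<in> ball x1 (r x1 / 2)" using F by blast
        have r0: "0 < r x1" using x1 F r(1) by auto
        have "a x1 \<le> cap x1 (r x1) x ^ 4"
          unfolding a_def using x1 r0 by (intro power_mono cap_lower) auto
        then have "a x1 * (norm (dG h e x))\<^sup>2 \<le> cap x1 (r x1) x ^ 4 * (norm (dG h e x))\<^sup>2" by (intro mult_right_mono) auto
        then have "(norm (dG h e x))\<^sup>2 \<le> cap x1 (r x1) x ^ 4 * (norm (dG h e x))\<^sup>2 / a x1"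
          using a[OF x1(1)] by (simp add: field_simps)
        also have "\<dots> \<le> (\<Sum>x1\<in>F. cap x1 (r x1) x ^ 4 * (norm (dG h e x))\<^sup>2 / a x1)"
          by (rule member_le_sum[OF x1(1) _ F(2)]) (use nn in auto)
        finally show ?thesis using True by simp
      qed (use nn in \<open>auto intro: sum_nonneg\<close>)
    qed
    also have "\<dots> = (\<Sum>x1\<in>F. (LBINT x. cap x1 (r x1) x ^ 4 * (norm (dG h e x))\<^sup>2) / a x1)"
      using i by (simp add: Bochner_Integration.integral_sum)
    also have "\<dots> \<le> CC" unfolding CC_def
    proof (intro sum_mono divide_right_mono)
      fix x1 assume "x1 \<in> F"
      then show "(LBINT x. cap x1 (r x1) x ^ 4 * (norm (dG h e x))\<^sup>2) \<le> C x1"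
        using Ch(2)[of x1 h e] F h e hm(2)[of x1] by auto
      show "0 \<le> a x1" by (simp add: a_def)
    qed
    finally show "(LBINT x. indicator {x \<in> cball x0 R. \<delta> \<le> norm (G x)} x * (norm (dG h e x))\<^sup>2) \<le> max 0 CC"
      by (simp add: K_def)
  qed simp
qed

end

section \<open>Energy of the truncated flux\<close>

context flux_equation
begin

text \<open>The formula for the gradient of \<open>norm (dq h x)\<close>, valid where
  \<open>dq h x\<close> is nonzero.\<close>

definition slope :: "real \<Rightarrow> 'a \<Rightarrow> 'a" where
  "slope h x = (\<Sum>e\<in>Basis. (sgn (dq h x) \<bullet> e) *\<^sub>R dG h e x)"

definition tW :: "real \<Rightarrow> real \<Rightarrow> 'a \<Rightarrow> 'a \<Rightarrow> real" where
  "tW d h e x = tweight d (norm (dq h x)) * (dq h x \<bullet> e)"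

definition tDW :: "real \<Rightarrow> real \<Rightarrow> 'a \<Rightarrow> 'a \<Rightarrow> 'a" where
  "tDW d h e x = tweight d (norm (dq h x)) *\<^sub>R dG h e x + (tweight' d (norm (dq h x)) * (dq h x \<bullet> e)) *\<^sub>R slope h x"

lemma tDW_below: "norm (dq h x) \<le> d \<Longrightarrow> tDW d h e x = 0" "norm (dq h x) \<le> d \<Longrightarrow> tW d h e x = 0"
  by (simp_all add: tDW_def tW_def tweight_below)

lemma GDERIV_norm_dq:
  assumes "dq h x \<noteq> 0" shows "GDERIV (\<lambda>x. norm (dq h x)) x :> slope h x"
proof -
  have "((\<lambda>x. \<Sum>e\<in>Basis. (dq h x \<bullet> e) *\<^sub>R e) has_derivative (\<lambda>v. \<Sum>e\<in>Basis. (v \<bullet> dG h e x) *\<^sub>R e)) (at x)"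
    by (intro has_derivative_sum has_derivative_scaleR_left dq_deriv[unfolded gderiv_def])
  then have "(dq h has_derivative (\<lambda>v. \<Sum>e\<in>Basis. (v \<bullet> dG h e x) *\<^sub>R e)) (at x)"
    by (simp add: euclidean_representation)
  from has_derivative_compose[OF this has_derivative_norm[OF assms]]
  have "((\<lambda>x. norm (dq h x)) has_derivative (\<lambda>v. (\<Sum>e\<in>Basis. (v \<bullet> dG h e x) *\<^sub>R e) \<bullet> sgn (dq h x))) (at x)"
    by (simp add: gderiv_def inner_commute)
  moreover have "(\<Sum>e\<in>Basis. (v \<bullet> dG h e x) *\<^sub>R e) \<bullet> sgn (dq h x) = v \<bullet> slope h x" for v
    by (simp add: slope_def inner_sum_left inner_sum_right inner_commute mult.commute)
  ultimately show ?thesis by (simp add: gderiv_def)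
qed

text \<open>For positive d these two open sets cover the space. On the first the truncated field is
  identically zero, on the second the norm is differentiable, so the singularity of the norm at the
  origin never interferes.\<close>

lemma dq_regions:
  "open {x. norm (dq h x) < d}" "open {x. dq h x \<noteq> 0}"
  by (auto intro!: open_Collect_less open_Collect_neq continuous_intros dq_cont)

lemma GDERIV_tW:
  assumes d: "0 < d" and e: "e \<in> Basis" shows "GDERIV (tW d h e) x :> tDW d h e x"
proof (cases "norm (dq h x) < d")
  case True
  have "(tW d h e has_derivative (\<lambda>h. 0)) (at x)"
    using has_derivative_transform_within_open[of "\<lambda>_. 0" "\<lambda>h. 0" x UNIV "{x. norm (dq h x) < d}" "tW d h e"]
      True dq_regions(1) tDW_below(2) by (auto simp: less_imp_le)
  then show ?thesis using True by (simp add: gderiv_def tDW_below)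
next
  case False
  then have n: "dq h x \<noteq> 0" "0 < norm (dq h x)" using d by auto
  have "GDERIV (\<lambda>x. tweight d (norm (dq h x))) x :> tweight' d (norm (dq h x)) *\<^sub>R slope h x"
    by (rule GDERIV_DERIV_compose[OF GDERIV_norm_dq[OF n(1)] tweight_deriv[OF n(2)]])
  from GDERIV_mult[OF this dq_deriv[OF e, of h x]]
  show ?thesis unfolding tW_def[abs_def] tDW_def by (simp add: mult.commute)
qed

lemma tDW_cont: assumes d: "0 < d" shows "continuous_on UNIV (tDW d h e)"
proof -
  have "continuous_on {x. norm (dq h x) < d} (\<lambda>x. 0::'a)" by simp
  then have 1: "continuous_on {x. norm (dq h x) < d} (tDW d h e)"
    by (rule continuous_on_eq) (auto simp: tDW_below less_imp_le)
  have 2: "continuous_on {x. dq h x \<noteq> 0} (tDW d h e)"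
    unfolding tDW_def[abs_def] slope_def sgn_div_norm
    by (intro continuous_intros dq_cont dG_cont continuous_on_compose2[OF tweight_cont(1)]
        continuous_on_compose2[OF tweight_cont(2)]) auto
  have "{x. norm (dq h x) < d} \<union> {x. dq h x \<noteq> 0} = UNIV" using d by auto
  then show ?thesis using continuous_on_open_Un[OF dq_regions 1 2] by simp
qed

text \<open>The coercivity constant \<open>c0 * A t\<close> of the flux and the bound
  \<open>(2 + M) * A t\<close> of the truncation share the factor \<open>A t\<close>. It cancels in
  their quotient, and with it all dependence on t and d.\<close>

lemma tDW_coercive:
  assumes d: "0 < d"
  shows "c0 / (2 + M) * (\<Sum>e\<in>Basis. (norm (tDW d h e x))\<^sup>2) \<le> (\<Sum>e\<in>Basis. dflux (dq h x) (dG h e x) \<bullet> tDW d h e x)"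
proof (cases "norm (dq h x) \<le> d")
  case True
  then show ?thesis by (simp add: tDW_below)
next
  case False
  define t where "t = norm (dq h x)"
  have t: "0 < t" using False d unfolding t_def by linarith
  have n: "dq h x \<noteq> 0" using t by (auto simp: t_def)
  define k where "k = tweight d t"
  define r where "r = tweight d t + t * tweight' d t"
  \<comment> \<open>The radial derivative contributes \<open>t * tweight' d t = r - k\<close>; the
    factor t is supplied by writing \<open>dq h x\<close> as its norm times its direction.\<close>
  have D: "tDW d h e x = k *\<^sub>R dG h e x + ((r - k) * (sgn (dq h x) \<bullet> e)) *\<^sub>R (\<Sum>e\<in>Basis. (sgn (dq h x) \<bullet> e) *\<^sub>R dG h e x)" for e
    using t by (simp add: tDW_def slope_def k_def r_def t_def[symmetric] sgn_div_norm)
  have "c0 * A t / ((2 + M) * A t) * (\<Sum>e\<in>Basis. (norm (tDW d h e x))\<^sup>2) \<le> (\<Sum>e\<in>Basis. dflux (dq h x) (dG h e x) \<bullet> tDW d h e x)"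
    unfolding D
  proof (rule rank_one_coercivity[OF linear_dflux])
    show "c0 * A t * (norm v)\<^sup>2 \<le> dflux (dq h x) v \<bullet> v" for v
      using dflux_coercive[OF n, of v] by (simp add: t_def)
  qed (use tweight_bounds[OF t d] A_pos[OF t] c0 M n in \<open>auto simp: k_def r_def norm_sgn intro: order_trans[OF tweight_bounds(2)[OF t d]]\<close>)
  then show ?thesis using A_pos[OF t] by simp
qed

lemma norm_slope_le: "norm (slope h x) \<le> (\<Sum>e\<in>Basis. norm (dG h e x))"
proof -
  have "\<bar>sgn (dq h x) \<bullet> e\<bar> \<le> 1" if "e \<in> Basis" for e
    using Basis_le_norm[OF that, of "sgn (dq h x)"] by (simp add: norm_sgn split: if_splits)
  then show ?thesis unfolding slope_def
    by (intro order_trans[OF norm_sum sum_mono]) (auto intro: mult_left_le_one_le)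
qed

text \<open>The number \<open>hi\<close> bounds \<open>A\<close> on the interval from d to
  \<open>L + 1\<close> and may grow as d tends to zero. That is harmless, since this estimate serves
  only the linearisation error, which is made small after d has been fixed.\<close>

lemma norm_tDW_le:
  assumes d: "0 < d" and hi: "\<And>t. d \<le> t \<Longrightarrow> t \<le> L + 1 \<Longrightarrow> A t \<le> hi" "0 \<le> hi" and x: "norm (dq h x) \<le> L + 1" and e: "e \<in> Basis"
  shows "norm (tDW d h e x) \<le> (4 + M) * hi * (\<Sum>e\<in>Basis. norm (dG h e x))"
proof (cases "norm (dq h x) \<le> d")
  case True
  then show ?thesis using hi M by (auto simp: tDW_below intro!: mult_nonneg_nonneg sum_nonneg)
next
  case False
  define t where "t = norm (dq h x)"
  have t: "0 < t" using False d unfolding t_def by linarith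
  define Y where "Y = (\<Sum>e\<in>Basis. norm (dG h e x))"
  have A: "A t \<le> hi" using hi(1)[of t] False x by (simp add: t_def)
  note b = tweight_bounds[OF t d]
  have MA: "(2 + M) * A t \<le> (2 + M) * hi" using A M by (intro mult_left_mono) auto
  have 1: "norm (tweight d t *\<^sub>R dG h e x) \<le> hi * Y"
  proof -
    have "norm (dG h e x) \<le> Y" unfolding Y_def by (rule member_le_sum[OF e]) auto
    then show ?thesis using b A hi by (auto intro!: mult_mono)
  qed
  have 2: "norm ((tweight' d t * (dq h x \<bullet> e)) *\<^sub>R slope h x) \<le> ((3 + M) * hi) * Y"
  proof -
    have "\<bar>t * tweight' d t\<bar> \<le> (3 + M) * hi" using b MA A hi by (simp add: algebra_simps abs_le_iff)
    moreover have "\<bar>tweight' d t * (dq h x \<bullet> e)\<bar> \<le> \<bar>t * tweight' d t\<bar>"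
      unfolding abs_mult using Basis_le_norm[OF e, of "dq h x"] by (simp add: t_def mult.commute mult_right_mono)
    ultimately show ?thesis using norm_slope_le[of h x] unfolding Y_def by (auto intro!: mult_mono sum_nonneg)
  qed
  have "norm (tDW d h e x) \<le> hi * Y + ((3 + M) * hi) * Y"
    unfolding tDW_def t_def[symmetric] by (rule order_trans[OF norm_triangle_ineq add_mono[OF 1 2]])
  then show ?thesis by (simp add: Y_def algebra_simps)
qed

text \<open>The weight is below \<open>A t\<close> and \<open>t * A t\<close> is increasing, so the
  bound is independent of d.\<close>

lemma tW_bound:
  assumes d: "0 < d" and x: "norm (dq h x) \<le> L + 1" and e: "e \<in> Basis"
  shows "\<bar>tW d h e x\<bar> \<le> (L + 1) * A (L + 1)"
proof (cases "dq h x = 0")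
  case False
  define t where "t = norm (dq h x)"
  have t: "0 < t" using False by (simp add: t_def)
  have "\<bar>tW d h e x\<bar> \<le> A t * t"
    unfolding tW_def abs_mult t_def[symmetric] using tweight_bounds[OF t d] Basis_le_norm[OF e, of "dq h x"] A_pos[OF t]
    by (intro mult_mono) (auto simp: t_def)
  also have "\<dots> \<le> (L + 1) * A (L + 1)" using mono_onD[OF A_mono, of t "L + 1"] t x by (simp add: t_def mult.commute)
  finally show ?thesis .
qed (use L A_pos[of "L + 1"] in \<open>auto simp: tW_def\<close>)

text \<open>A bound for the squared L2 norm of any component of the flux on the ball where the
  equation holds.\<close>

definition flux_bound :: real where
  "flux_bound = (L * A L)\<^sup>2 * measure lborel (ball x0 (2 * R))"

text \<open>This controls the terms in which the cutoff is differentiated. The difference quotient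
  of the flux has no bound uniform in d, so it is moved onto \<open>\<psi>\<close>; what remains is
  the flux itself, which is bounded, and the gradient energy of \<open>\<psi>\<close>, which can be
  absorbed.\<close>

lemma flux_diffquot_pairing:
  assumes \<psi>: "C1c (cball x1 r) \<psi> D" and h: "0 < h" and sub: "cball x1 (r + 2 * h) \<subseteq> ball x0 (2 * R)" and e: "e \<in> Basis"
    and j: "j \<in> Basis" and \<kappa>: "0 < \<kappa>"
  shows "\<bar>(LBINT x. (dF h e x \<bullet> j) * \<psi> x)\<bar> \<le> flux_bound / (2 * \<kappa>) + \<kappa> / 2 * (LBINT x. (norm (D x))\<^sup>2)"
    and "integrable lborel (\<lambda>x. (dF h e x \<bullet> j) * \<psi> x)"
proof -
  \<comment> \<open>Restricting to the ball makes the bounded flux square integrable. Nothing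
    changes in the pairing, because \<open>\<psi>\<close> and its translate both vanish outside the
    ball.\<close>
  define v where "v x = (flux (G x) \<bullet> j) * indicator (ball x0 (2 * R)) x" for x
  have [measurable]: "ball x0 (2 * R) \<in> sets borel" by simp
  have [measurable]: "v \<in> borel_measurable borel" unfolding v_def by measurable
  obtain K where K: "compact K" "K \<subseteq> cball x1 r" "\<And>x. x \<notin> K \<Longrightarrow> \<psi> x = 0"
    using \<psi> by (rule C1c_support) blast
  have \<psi>0: "\<psi> x = 0" if "x \<notin> cball x1 r" for x using K(2) K(3)[of x] that by blast
  have fj: "\<bar>flux (G x) \<bullet> j\<bar> \<le> L * A L" for x using Basis_le_norm[OF j, of "flux (G x)"] flux_G_bound[of x] by linarith
  have i: "integrable lborel (\<lambda>x. (flux (G (x + c)) \<bullet> j) * \<psi> x)" for c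
    using integrable_bounded_inner[of "\<lambda>x. flux (G (x + c)) \<bullet> j" "L * A L" \<psi> K] fj C1c_D(3)[OF \<psi>] K by auto
  have [measurable]: "\<psi> \<in> borel_measurable borel" using C1c_D(3)[OF \<psi>] by (rule borel_measurable_continuous_onI)
  have eq: "(dF h e x \<bullet> j) * \<psi> x = ((flux (G (x + h *\<^sub>R e)) \<bullet> j) * \<psi> x - (flux (G (x + 0)) \<bullet> j) * \<psi> x) / h" for x
    by (simp add: dF_def inner_diff_left divide_inverse algebra_simps)
  show "integrable lborel (\<lambda>x. (dF h e x \<bullet> j) * \<psi> x)"
    unfolding eq by (intro integrable_divide_zero Bochner_Integration.integrable_diff i)
  have tr: "(LBINT x. (flux (G (x + h *\<^sub>R e)) \<bullet> j) * \<psi> x) = (LBINT x. (flux (G x) \<bullet> j) * \<psi> (x - h *\<^sub>R e))"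
    using lborel_integral_translate[of "\<lambda>x. (flux (G x) \<bullet> j) * \<psi> (x - h *\<^sub>R e)" "h *\<^sub>R e"] by simp
  have itr: "integrable lborel (\<lambda>x. (flux (G x) \<bullet> j) * \<psi> (x - h *\<^sub>R e))"
    using lborel_integrable_translate[OF i[of "h *\<^sub>R e"], of "- (h *\<^sub>R e)"] by simp
  have "(LBINT x. (dF h e x \<bullet> j) * \<psi> x) = 
      ((LBINT x. (flux (G x) \<bullet> j) * \<psi> (x - h *\<^sub>R e)) - (LBINT x. (flux (G (x + 0)) \<bullet> j) * \<psi> x)) / h"
    unfolding eq using i[of 0] i[of "h *\<^sub>R e"] tr by simp
  also have "\<dots> = (LBINT x. ((flux (G x) \<bullet> j) * \<psi> (x - h *\<^sub>R e) - (flux (G (x + 0)) \<bullet> j) * \<psi> x) / h)"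
    using itr i[of 0] by simp
  also have "\<dots> = (LBINT x. - (v x * ((\<psi> x - \<psi> (x - h *\<^sub>R e)) / h)))"
  proof (rule Bochner_Integration.integral_cong[OF refl])
    fix x
    show "((flux (G x) \<bullet> j) * \<psi> (x - h *\<^sub>R e) - (flux (G (x + 0)) \<bullet> j) * \<psi> x) / h = - (v x * ((\<psi> x - \<psi> (x - h *\<^sub>R e)) / h))"
    proof (cases "x \<in> ball x0 (2 * R)")
      case True
      then show ?thesis by (simp add: v_def right_diff_distrib diff_divide_distrib)
    next
      case False
      then have "x \<notin> cball x1 (r + 2 * h)" using sub by blast
      moreover have "dist x1 x \<le> dist x1 (x - h *\<^sub>R e) + h"
        using norm_triangle_ineq4[of "x1 - (x - h *\<^sub>R e)" "h *\<^sub>R e"] h e by (simp add: dist_norm)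
      ultimately have "x \<notin> cball x1 r" "x - h *\<^sub>R e \<notin> cball x1 r" using h unfolding mem_cball by linarith+
      then show ?thesis using \<psi>0 by simp
    qed
  qed
  also have "\<bar>\<dots>\<bar> = \<bar>(LBINT x. v x * ((\<psi> x - \<psi> (x - h *\<^sub>R e)) / h))\<bar>" by simp
  also have "\<dots> \<le> (LBINT x. (v x)\<^sup>2) / (2 * \<kappa>) + \<kappa> / 2 * (LBINT x. (norm (D x))\<^sup>2)"
  proof (rule young_diffquot[OF \<psi> _ h \<kappa>])
    have ib: "integrable lborel (\<lambda>x. (L * A L)\<^sup>2 * indicator (ball x0 (2 * R)) x)"
      using emeasure_lborel_ball_finite by (intro integrable_mult_right integrable_real_indicator) auto
    have "\<bar>v x\<bar>\<^sup>2 \<le> (L * A L)\<^sup>2 * indicator (ball x0 (2 * R)) x" for x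
      unfolding v_def using power_mono[OF fj[of x] abs_ge_zero, of 2] by (auto simp: indicator_def)
    then have vb: "(v x)\<^sup>2 \<le> (L * A L)\<^sup>2 * indicator (ball x0 (2 * R)) x" for x by simp
    show iv: "integrable lborel (\<lambda>x. (v x)\<^sup>2)"
      by (rule Bochner_Integration.integrable_bound[OF ib]) (use order_trans[OF vb abs_ge_self] in auto)
  qed (use e in auto)
  also have "\<dots> \<le> flux_bound / (2 * \<kappa>) + \<kappa> / 2 * (LBINT x. (norm (D x))\<^sup>2)"
  proof -
    have ib: "integrable lborel (\<lambda>x. (L * A L)\<^sup>2 * indicator (ball x0 (2 * R)) x)"
      using emeasure_lborel_ball_finite by (intro integrable_mult_right integrable_real_indicator) auto
    have "\<bar>v x\<bar>\<^sup>2 \<le> (L * A L)\<^sup>2 * indicator (ball x0 (2 * R)) x" for x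
      unfolding v_def using power_mono[OF fj[of x] abs_ge_zero, of 2] by (auto simp: indicator_def)
    then have "(LBINT x. (v x)\<^sup>2) \<le> (LBINT x. (L * A L)\<^sup>2 * indicator (ball x0 (2 * R)) x)"
      by (intro integral_mono_AE' ib) auto
    also have "\<dots> = flux_bound" by (simp add: flux_bound_def)
    finally show ?thesis using \<kappa> by (intro add_right_mono divide_right_mono) auto
  qed
  finally show "\<bar>(LBINT x. (dF h e x \<bullet> j) * \<psi> x)\<bar> \<le> flux_bound / (2 * \<kappa>) + \<kappa> / 2 * (LBINT x. (norm (D x))\<^sup>2)" .
qed

text \<open>The order of quantifiers is the point: \<open>C\<close> is fixed before d, and only the
  admissible range of h depends on d. All d-dependent quantities occur in the linearisation error,
  which is forced below 1 by the choice of \<open>\<omega>\<close>.\<close>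

lemma truncated_flux_energy:
  obtains C where "\<And>d. 0 < d \<Longrightarrow> \<exists>h0>0. \<forall>h. 0 < h \<and> h < h0 \<longrightarrow>
    (LBINT x. cap x0 R x ^ 4 * (\<Sum>e\<in>Basis. (norm (tDW d h e x))\<^sup>2)) \<le> C"
proof -
  define N where "N = real DIM('a)"
  have N: "1 \<le> N" using DIM_positive[where 'a='a] unfolding N_def by linarith
  define cs where "cs = c0 / (2 + M)"
  have cs: "0 < cs" using c0 M by (simp add: cs_def)
  define Bw where "Bw = (L + 1) * A (L + 1)"
  have Bw: "0 \<le> Bw" using L A_pos[of "L + 1"] by (auto simp: Bw_def)
  \<comment> \<open>\<open>K1\<close> and \<open>K2\<close> are taken large enough to serve two
    gradients at once: that of the test function, and that of the function onto which the cutoff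
    term is shifted.\<close>
  define K1 where "K1 = 2 * R ^ 8 + 2 * R ^ 6"
  define K2 where "K2 = 2 * (8 * R ^ 7 * Bw)\<^sup>2 + 2 * (7 * R ^ 6 * Bw)\<^sup>2"
  have K1: "0 < K1" using R by (simp add: K1_def add_pos_pos)
  define m where "m = measure lborel (cball x0 R)"
  \<comment> \<open>There are N test functions, one for each index, and N * N cutoff terms, each
    carrying a factor 8. Together they produce the factor \<open>1 + 8 * N\<close>, so this choice
    makes the absorbed energy exactly half of the coercive part.\<close>
  define \<kappa> where "\<kappa> = cs / (K1 * (1 + 8 * N))"
  have \<kappa>: "0 < \<kappa>" using cs K1 N by (simp add: \<kappa>_def)
  define Ig where "Ig = (LBINT x. (g x)\<^sup>2)"
  define C where "C = 2 / cs * (1 + N * (Ig / (2 * \<kappa>) + \<kappa> / 2 * (K2 * m)) + 8 * N * N * (flux_bound / (2 * \<kappa>) + \<kappa> / 2 * (K2 * m)))"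
  have icb: "integrable lborel (indicat_real (cball x0 R))"
    using emeasure_lborel_cball_finite by (intro integrable_real_indicator) auto
  show thesis
  proof (rule that[of C])
    fix d :: real assume d: "0 < d"
    have "0 < d / 2" using d by simp
    then obtain C1 h1 where C1: "0 < h1" "0 \<le> C1" "\<And>h e. 0 < h \<Longrightarrow> h < h1 \<Longrightarrow> e \<in> Basis \<Longrightarrow>
       (LBINT x. indicator {x \<in> cball x0 R. d / 2 \<le> norm (G x)} x * (norm (dG h e x))\<^sup>2) \<le> C1"
      by (rule difference_energy) blast
    obtain hi where hi: "0 \<le> hi" "\<And>t. d \<le> t \<Longrightarrow> t \<le> L + 1 \<Longrightarrow> A t \<le> hi"
    proof (cases "d \<le> L + 1")
      case True
      obtain lo hi' where "0 < lo" "\<And>t. d \<le> t \<Longrightarrow> t \<le> L + 1 \<Longrightarrow> lo \<le> A t \<and> A t \<le> hi'"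
        by (rule A_bounds[OF d True]) blast
      then show ?thesis using that[of "max 0 hi'"] by fastforce
    qed (use that[of 0] in auto)
    define Cd where "Cd = (4 + M) * hi * N"
    have Cd: "0 \<le> Cd" using M hi N by (auto simp: Cd_def)
    \<comment> \<open>The total linearisation error is at most \<open>\<omega>\<close> times
      \<open>Cd * R ^ 8 * N * C1\<close>. Adding 1 in the denominator covers the case in which this
      product is zero.\<close>
    define \<omega> where "\<omega> = 1 / (Cd * R ^ 8 * N * C1 + 1)"
    have den: "0 \<le> Cd * R ^ 8 * N * C1" using Cd N C1(2) R by auto
    have \<omega>: "0 < \<omega>" "\<omega> * (Cd * R ^ 8 * N * C1) \<le> 1" using den by (auto simp: \<omega>_def)
    obtain h2 where h2: "0 < h2" "\<And>h x. 0 < h \<Longrightarrow> h < h2 \<Longrightarrow> norm (dq h x) \<le> L + 1"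
      "\<And>h x. 0 < h \<Longrightarrow> h < h2 \<Longrightarrow> norm (dq h x - G x) < d / 2"
      "\<And>h x e. 0 < h \<Longrightarrow> h < h2 \<Longrightarrow> e \<in> Basis \<Longrightarrow> d / 2 \<le> norm (dq h x) \<Longrightarrow>
         norm (dF h e x - dflux (dq h x) (dG h e x)) \<le> \<omega> * norm (dG h e x)"
      by (rule dF_approx[OF \<open>0 < d / 2\<close> \<omega>(1)]) blast
    have "(LBINT x. cap x0 R x ^ 4 * (\<Sum>e\<in>Basis. (norm (tDW d h e x))\<^sup>2)) \<le> C"
      if h: "0 < h" "h < min (R / 2) (min h1 h2)" for h
    proof -
      have hh1: "h < h1" and hh2: "h < h2" and hR: "h < R / 2" using h by auto
      have sub: "cball x0 (R + 2 * h) \<subseteq> ball x0 (2 * R)" using hR by auto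
      define s where "s x = cap x0 R x" for x
      have s: "0 \<le> s x" "s x \<le> R\<^sup>2" for x using cap_nonneg cap_le by (auto simp: s_def)
      have s0: "s x = 0" if "x \<notin> cball x0 R" for x using cap_outside[OF that R] by (simp add: s_def)
      have cs': "continuous_on UNIV s" unfolding s_def[abs_def] by (rule cap_continuous)
      have sp: "s x ^ n \<le> R ^ (2 * n)" for x n
        using power_mono[OF s(2)[of x] s(1)[of x], of n] by (simp add: power_mult)
      define E where "E e x = tDW d h e x" for e x
      define w where "w e x = tW d h e x" for e x
      have E: "continuous_on UNIV (E e)" for e unfolding E_def[abs_def] by (rule tDW_cont[OF d])
      have wb: "\<bar>w e x\<bar> \<le> Bw" if "e \<in> Basis" for e x
        unfolding w_def Bw_def by (rule tW_bound[OF d h2(2)[OF h(1) hh2] that])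
      have wd: "GDERIV (w e) x :> E e x" if "e \<in> Basis" for e x
        using GDERIV_tW[OF d that, of h x] by (simp add: w_def[abs_def] E_def)
      have iE: "integrable lborel (\<lambda>x. s x ^ 4 * (norm (E e x))\<^sup>2)" for e
        by (rule integrable_continuous_compact_support[of _ "cball x0 R"])
          (intro continuous_intros cs' E, auto simp: s0)
      define X where "X e = (LBINT x. s x ^ 4 * (norm (E e x))\<^sup>2)" for e
      define XX where "XX = (\<Sum>e\<in>Basis. X e)"

      define D where "D e x = s x ^ 4 *\<^sub>R E e x + (w e x * (- 8 * s x ^ 3)) *\<^sub>R (x - x0)" for e x
      have DC: "C1c (cball x0 R) (\<lambda>x. s x ^ 4 * w e x) (D e)" if e: "e \<in> Basis" for e
        using C1c_cap_mult[OF R wd[OF e] E, of x0 2]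
        unfolding D_def[abs_def] s_def[abs_def] by (simp add: eval_nat_numeral)
      \<comment> \<open>The gradient of \<open>s ^ 3\<close> times a coordinate of
        \<open>x - x0\<close> times \<open>w e\<close>. The third power is what differentiation
        leaves of \<open>s ^ 4\<close>; the square of \<open>s ^ 3\<close> is still dominated by a
        multiple of \<open>s ^ 4\<close>, so the energy can absorb it.\<close>
      define D' where "D' e j x = s x ^ 3 *\<^sub>R (((x - x0) \<bullet> j) *\<^sub>R E e x + w e x *\<^sub>R j)
          + (((x - x0) \<bullet> j * w e x) * (- 6 * s x ^ 2)) *\<^sub>R (x - x0)" for e j x
      have DC': "C1c (cball x0 R) (\<lambda>x. s x ^ 3 * ((x - x0) \<bullet> j * w e x)) (D' e j)" if e: "e \<in> Basis" for e j
      proof -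
        have "GDERIV (\<lambda>x. (x - x0) \<bullet> j) x :> j" for x
          unfolding gderiv_def by (auto intro!: derivative_eq_intros)
        from GDERIV_mult[OF this wd[OF e]]
        have "GDERIV (\<lambda>x. (x - x0) \<bullet> j * w e x) x :> ((x - x0) \<bullet> j) *\<^sub>R E e x + w e x *\<^sub>R j" for x by simp
        moreover have "continuous_on UNIV (w e)" using wd[OF e] by (rule GDERIV_continuous_on)
        then have "continuous_on UNIV (\<lambda>x. ((x - x0) \<bullet> j) *\<^sub>R E e x + w e x *\<^sub>R j)"
          by (intro continuous_intros E)
        ultimately show ?thesis
          using C1c_cap_mult[OF R, of "\<lambda>x. (x - x0) \<bullet> j * w e x" "\<lambda>x. ((x - x0) \<bullet> j) *\<^sub>R E e x + w e x *\<^sub>R j" x0 1]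
          unfolding D'_def[abs_def] s_def[abs_def] by (simp add: eval_nat_numeral)
      qed

      have Db: "(norm (D e x))\<^sup>2 \<le> K1 * (s x ^ 4 * (norm (E e x))\<^sup>2) + K2 * indicator (cball x0 R) x"
        if e: "e \<in> Basis" for e x
      proof (cases "x \<in> cball x0 R")
        case True
        have dx: "norm (x - x0) \<le> R" using True by (simp add: dist_norm norm_minus_commute)
        have "norm (D e x) \<le> norm (s x ^ 4 *\<^sub>R E e x) + norm ((w e x * (- 8 * s x ^ 3)) *\<^sub>R (x - x0))"
          unfolding D_def by (rule norm_triangle_ineq)
        also have "norm (s x ^ 4 *\<^sub>R E e x) = s x ^ 4 * norm (E e x)" using s(1)[of x] by simp
        also have "norm ((w e x * (- 8 * s x ^ 3)) *\<^sub>R (x - x0)) = \<bar>w e x\<bar> * (8 * s x ^ 3) * norm (x - x0)"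
          using s(1)[of x] by (simp add: abs_mult)
        also have "\<dots> \<le> Bw * (8 * R ^ (2 * 3)) * R"
          using wb[OF e] sp[of x 3] s(1)[of x] dx R Bw by (intro mult_mono) auto
        also have "Bw * (8 * R ^ (2 * 3)) * R = 8 * R ^ 7 * Bw" by (simp add: eval_nat_numeral)
        finally have "(norm (D e x))\<^sup>2 \<le> (s x ^ 4 * norm (E e x) + 8 * R ^ 7 * Bw)\<^sup>2" by (intro power_mono) auto
        also have "\<dots> \<le> 2 * (s x ^ 4 * norm (E e x))\<^sup>2 + 2 * (8 * R ^ 7 * Bw)\<^sup>2" by (rule square_add_le)
        also have "2 * (s x ^ 4 * norm (E e x))\<^sup>2 = 2 * s x ^ 4 * (s x ^ 4 * (norm (E e x))\<^sup>2)" by (simp add: power_mult_distrib eval_nat_numeral)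
        also have "\<dots> \<le> K1 * (s x ^ 4 * (norm (E e x))\<^sup>2)"
        proof (intro mult_right_mono)
          have "s x ^ 4 \<le> R ^ 8" "0 \<le> R ^ 6" using sp[of x 4] R by auto
          then show "2 * s x ^ 4 \<le> K1" unfolding K1_def by linarith
        qed (use s(1)[of x] in auto)
        finally have "(norm (D e x))\<^sup>2 \<le> K1 * (s x ^ 4 * (norm (E e x))\<^sup>2) + K2"
          using zero_le_power2[of "7 * R ^ 6 * Bw"] unfolding K2_def by linarith
        then show ?thesis using True by simp
      qed (simp add: D_def s0)
      have Db': "(norm (D' e j x))\<^sup>2 \<le> K1 * (s x ^ 4 * (norm (E e x))\<^sup>2) + K2 * indicator (cball x0 R) x"
        if e: "e \<in> Basis" and j: "j \<in> Basis" for e j x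
      proof (cases "x \<in> cball x0 R")
        case True
        have dx: "norm (x - x0) \<le> R" using True by (simp add: dist_norm norm_minus_commute)
        have dj: "\<bar>(x - x0) \<bullet> j\<bar> \<le> R" using Basis_le_norm[OF j, of "x - x0"] dx by linarith
        have nj: "norm j = 1" using j by simp
        have "norm (D' e j x) \<le> norm ((s x ^ 3 * ((x - x0) \<bullet> j)) *\<^sub>R E e x) + (norm ((s x ^ 3 * w e x) *\<^sub>R j)
            + norm ((((x - x0) \<bullet> j * w e x) * (- 6 * s x ^ 2)) *\<^sub>R (x - x0)))"
        proof -
          have "D' e j x = (s x ^ 3 * ((x - x0) \<bullet> j)) *\<^sub>R E e x + ((s x ^ 3 * w e x) *\<^sub>R j
            + (((x - x0) \<bullet> j * w e x) * (- 6 * s x ^ 2)) *\<^sub>R (x - x0))"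
            unfolding D'_def by (simp add: scaleR_add_right)
          then show ?thesis by (metis norm_triangle_le norm_triangle_ineq add_left_mono)
        qed
        also have "norm ((s x ^ 3 * ((x - x0) \<bullet> j)) *\<^sub>R E e x) \<le> (s x ^ 3 * R) * norm (E e x)"
          using s(1)[of x] dj by (auto simp: abs_mult intro!: mult_mono)
        also have "norm ((s x ^ 3 * w e x) *\<^sub>R j) \<le> R ^ (2 * 3) * Bw"
          using s(1)[of x] sp[of x 3] wb[OF e] R nj by (simp add: abs_mult) (intro mult_mono, auto)
        also have "norm ((((x - x0) \<bullet> j * w e x) * (- 6 * s x ^ 2)) *\<^sub>R (x - x0)) = \<bar>(x - x0) \<bullet> j\<bar> * \<bar>w e x\<bar> * (6 * s x ^ 2) * norm (x - x0)"
          by (simp add: abs_mult)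
        also have "\<dots> \<le> R * Bw * (6 * R ^ (2 * 2)) * R"
          using wb[OF e] sp[of x 2] dx dj R Bw by (intro mult_mono) auto
        also have "R ^ (2 * 3) * Bw + R * Bw * (6 * R ^ (2 * 2)) * R = 7 * R ^ 6 * Bw" by (simp add: eval_nat_numeral)
        finally have "norm (D' e j x) \<le> (s x ^ 3 * R) * norm (E e x) + 7 * R ^ 6 * Bw" by simp
        then have "(norm (D' e j x))\<^sup>2 \<le> ((s x ^ 3 * R) * norm (E e x) + 7 * R ^ 6 * Bw)\<^sup>2" by (intro power_mono) auto
        also have "\<dots> \<le> 2 * ((s x ^ 3 * R) * norm (E e x))\<^sup>2 + 2 * (7 * R ^ 6 * Bw)\<^sup>2" by (rule square_add_le)
        also have "2 * ((s x ^ 3 * R) * norm (E e x))\<^sup>2 = (2 * (s x ^ 2 * R ^ 2)) * (s x ^ 4 * (norm (E e x))\<^sup>2)" by (simp add: power_mult_distrib eval_nat_numeral)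
        also have "\<dots> \<le> K1 * (s x ^ 4 * (norm (E e x))\<^sup>2)"
        proof (intro mult_right_mono)
          have "s x ^ 2 * R ^ 2 \<le> R ^ (2 * 2) * R ^ 2" using sp[of x 2] by (intro mult_right_mono) auto
          also have "\<dots> = R ^ 6" by (simp flip: power_add)
          finally have "s x ^ 2 * R ^ 2 \<le> R ^ 6" .
          moreover have "0 \<le> R ^ 8" by simp
          ultimately show "2 * (s x ^ 2 * R ^ 2) \<le> K1" unfolding K1_def by linarith
        qed auto
        finally have "(norm (D' e j x))\<^sup>2 \<le> K1 * (s x ^ 4 * (norm (E e x))\<^sup>2) + K2"
          using zero_le_power2[of "8 * R ^ 7 * Bw"] unfolding K2_def by linarith
        then show ?thesis using True by simp
      qed (simp add: D'_def s0)

      have iup: "integrable lborel (\<lambda>x. K1 * (s x ^ 4 * (norm (E e x))\<^sup>2) + K2 * indicator (cball x0 R) x)" for e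
        using iE icb by auto
      have iupv: "(LBINT x. K1 * (s x ^ 4 * (norm (E e x))\<^sup>2) + K2 * indicator (cball x0 R) x) = K1 * X e + K2 * m" for e
        using iE icb by (simp add: X_def m_def)
      have ID: "(LBINT x. (norm (D e x))\<^sup>2) \<le> K1 * X e + K2 * m" if e: "e \<in> Basis" for e
        unfolding iupv[symmetric] by (rule integral_mono_AE'[OF iup]) (use Db[OF e] order_trans[OF zero_le_power2 Db[OF e]] in auto)
      have ID': "(LBINT x. (norm (D' e j x))\<^sup>2) \<le> K1 * X e + K2 * m" if e: "e \<in> Basis" and j: "j \<in> Basis" for e j
        unfolding iupv[symmetric] by (rule integral_mono_AE'[OF iup]) (use Db'[OF e j] order_trans[OF zero_le_power2 Db'[OF e j]] in auto)

      have T: "(LBINT x. dF h e x \<bullet> D e x) \<le> Ig / (2 * \<kappa>) + \<kappa> / 2 * (K1 * X e + K2 * m)"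
           "integrable lborel (\<lambda>x. dF h e x \<bullet> D e x)" if e: "e \<in> Basis" for e
      proof -
        note T = flux_diffquot_test[OF DC[OF e] h(1) sub e, folded dF_def]
        show "integrable lborel (\<lambda>x. dF h e x \<bullet> D e x)" by (rule T(2))
        have "(LBINT x. dF h e x \<bullet> D e x) \<le> \<bar>(LBINT x. g x * ((s x ^ 4 * w e x - s (x - h *\<^sub>R e) ^ 4 * w e (x - h *\<^sub>R e)) / h))\<bar>"
          unfolding T(1) by (rule abs_ge_minus_self)
        also have "\<dots> \<le> Ig / (2 * \<kappa>) + \<kappa> / 2 * (LBINT x. (norm (D e x))\<^sup>2)"
          unfolding Ig_def by (rule young_diffquot[OF DC[OF e] _ h(1) \<kappa> g_meas g_square_integrable]) (use e in auto)
        also have "\<dots> \<le> Ig / (2 * \<kappa>) + \<kappa> / 2 * (K1 * X e + K2 * m)"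
          using ID[OF e] \<kappa> by (intro add_left_mono mult_left_mono) auto
        finally show "(LBINT x. dF h e x \<bullet> D e x) \<le> Ig / (2 * \<kappa>) + \<kappa> / 2 * (K1 * X e + K2 * m)" .
      qed
      define P where "P e j x = (dF h e x \<bullet> j) * (s x ^ 3 * ((x - x0) \<bullet> j * w e x))" for e j x
      have T': "integral\<^sup>L lborel (P e j) \<le> flux_bound / (2 * \<kappa>) + \<kappa> / 2 * (K1 * X e + K2 * m)"
           "integrable lborel (P e j)" if e: "e \<in> Basis" and j: "j \<in> Basis" for e j
      proof -
        note T = flux_diffquot_pairing[OF DC'[OF e] h(1) sub e j \<kappa>, folded P_def]
        show "integrable lborel (P e j)" unfolding P_def[abs_def] by (rule T(2)[unfolded P_def])
        have "integral\<^sup>L lborel (P e j) \<le> flux_bound / (2 * \<kappa>) + \<kappa> / 2 * (LBINT x. (norm (D' e j x))\<^sup>2)"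
          using T(1)[of j] unfolding P_def[abs_def] by linarith
        also have "\<dots> \<le> flux_bound / (2 * \<kappa>) + \<kappa> / 2 * (K1 * X e + K2 * m)"
          using ID'[OF e j] \<kappa> by (intro add_left_mono mult_left_mono) auto
        finally show "integral\<^sup>L lborel (P e j) \<le> flux_bound / (2 * \<kappa>) + \<kappa> / 2 * (K1 * X e + K2 * m)" .
      qed

      define I where "I e x = indicator {x \<in> cball x0 R. d / 2 \<le> norm (G x)} x * (norm (dG h e x))\<^sup>2" for e x
      have iI: "integrable lborel (I e)" for e
      proof -
        have "closed {x. d / 2 \<le> norm (G x)}" by (intro closed_Collect_le continuous_intros G_cont)
        then have "compact (cball x0 R \<inter> {x. d / 2 \<le> norm (G x)})" by (intro compact_Int_closed) auto
        moreover have "{x \<in> cball x0 R. d / 2 \<le> norm (G x)} = cball x0 R \<inter> {x. d / 2 \<le> norm (G x)}" by auto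
        ultimately have "integrable lborel (\<lambda>x. indicator {x \<in> cball x0 R. d / 2 \<le> norm (G x)} x *\<^sub>R (norm (dG h e x))\<^sup>2)"
          by (intro borel_integrable_compact continuous_intros dG_cont) simp
        then show ?thesis by (simp add: I_def[abs_def])
      qed
      define c3 where "c3 = \<omega> * Cd * R ^ 8"
      have c3: "0 \<le> c3" using \<omega> Cd R by (simp add: c3_def)
      have pt: "cs * (\<Sum>e\<in>Basis. s x ^ 4 * (norm (E e x))\<^sup>2) - c3 * (\<Sum>e\<in>Basis. I e x)
          \<le> (\<Sum>e\<in>Basis. dF h e x \<bullet> D e x) + 8 * (\<Sum>e\<in>Basis. \<Sum>j\<in>Basis. P e j x)" for x
      proof (cases "x \<in> cball x0 R")
        case True
        \<comment> \<open>Adding the \<open>P\<close> terms removes exactly the contribution of the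
          differentiated cutoff, and the pure energy pairing is left. The constant 8 is the exponent
          4 times the 2 from differentiating the squared norm.\<close>
        have PD: "dF h e x \<bullet> D e x + 8 * (\<Sum>j\<in>Basis. P e j x) = s x ^ 4 * (dF h e x \<bullet> E e x)" for e
        proof -
          have "(\<Sum>j\<in>Basis. P e j x) = (s x ^ 3 * w e x) * (\<Sum>j\<in>Basis. (dF h e x \<bullet> j) * ((x - x0) \<bullet> j))"
            unfolding P_def sum_distrib_left by (simp add: algebra_simps)
          also have "(\<Sum>j\<in>Basis. (dF h e x \<bullet> j) * ((x - x0) \<bullet> j)) = dF h e x \<bullet> (x - x0)"
            by (rule euclidean_inner[symmetric])
          finally show ?thesis unfolding D_def inner_add_right inner_scaleR_right by (simp add: algebra_simps)
        qed
        have main: "cs * (\<Sum>e\<in>Basis. (norm (E e x))\<^sup>2) - \<omega> * Cd * (\<Sum>e\<in>Basis. I e x) \<le> (\<Sum>e\<in>Basis. dF h e x \<bullet> E e x)"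
        proof (cases "norm (dq h x) \<le> d")
          case True
          have "0 \<le> I e x" for e by (simp add: I_def)
          then have "0 \<le> \<omega> * Cd * (\<Sum>e\<in>Basis. I e x)" using \<omega> Cd by (intro mult_nonneg_nonneg sum_nonneg) auto
          then show ?thesis using True by (simp add: E_def tDW_below)
        next
          case False
          \<comment> \<open>Where the truncation is active, the true gradient has norm at least
            \<open>d / 2\<close>. This confines the error to the region in which second differences
            are already bounded in L2.\<close>
          have "d / 2 \<le> norm (G x)" using False h2(3)[OF h(1) hh2, of x] norm_triangle_ineq2[of "dq h x" "G x"] by linarith
          then have Ie: "I e x = (norm (dG h e x))\<^sup>2" for e using \<open>x \<in> cball x0 R\<close> by (simp add: I_def)
          define Y where "Y = (\<Sum>e\<in>Basis. norm (dG h e x))"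
          have Y2: "Y\<^sup>2 \<le> N * (\<Sum>e\<in>Basis. I e x)"
            unfolding Y_def Ie N_def using sum_squared_le_sum_of_squares[of "\<lambda>e. norm (dG h e x)" Basis] by (simp add: mult.commute)
          have "dflux (dq h x) (dG h e x) \<bullet> E e x - \<omega> * norm (dG h e x) * ((4 + M) * hi * Y) \<le> dF h e x \<bullet> E e x" if e: "e \<in> Basis" for e
          proof -
            have "norm (E e x) \<le> (4 + M) * hi * Y"
              unfolding E_def Y_def by (rule norm_tDW_le[OF d hi(2,1) h2(2)[OF h(1) hh2] e])
            moreover have "norm (dF h e x - dflux (dq h x) (dG h e x)) \<le> \<omega> * norm (dG h e x)"
              using h2(4)[OF h(1) hh2 e, of x] False d by simp
            ultimately have "norm (dF h e x - dflux (dq h x) (dG h e x)) * norm (E e x) \<le> \<omega> * norm (dG h e x) * ((4 + M) * hi * Y)"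
              using \<omega> by (intro mult_mono) auto
            moreover have "\<bar>(dF h e x - dflux (dq h x) (dG h e x)) \<bullet> E e x\<bar> \<le> norm (dF h e x - dflux (dq h x) (dG h e x)) * norm (E e x)"
              by (rule Cauchy_Schwarz_ineq2)
            ultimately show ?thesis unfolding inner_diff_left by linarith
          qed
          then have "(\<Sum>e\<in>Basis. dflux (dq h x) (dG h e x) \<bullet> E e x - \<omega> * norm (dG h e x) * ((4 + M) * hi * Y)) \<le> (\<Sum>e\<in>Basis. dF h e x \<bullet> E e x)"
            by (rule sum_mono)
          moreover have "(\<Sum>e\<in>Basis. \<omega> * norm (dG h e x) * ((4 + M) * hi * Y)) = \<omega> * ((4 + M) * hi) * Y\<^sup>2"
            unfolding sum_distrib_right[symmetric] sum_distrib_left[symmetric] Y_def[symmetric] by (simp add: power2_eq_square)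
          moreover have "\<omega> * ((4 + M) * hi) * Y\<^sup>2 \<le> \<omega> * ((4 + M) * hi) * (N * (\<Sum>e\<in>Basis. I e x))"
            using Y2 \<omega> hi M by (intro mult_left_mono) auto
          moreover have "\<omega> * ((4 + M) * hi) * (N * (\<Sum>e\<in>Basis. I e x)) = \<omega> * Cd * (\<Sum>e\<in>Basis. I e x)" by (simp add: Cd_def)
          ultimately show ?thesis using tDW_coercive[OF d, of h x]
            unfolding cs_def E_def sum_subtractf by linarith
        qed
        have "s x ^ 4 * (cs * (\<Sum>e\<in>Basis. (norm (E e x))\<^sup>2) - \<omega> * Cd * (\<Sum>e\<in>Basis. I e x)) \<le> s x ^ 4 * (\<Sum>e\<in>Basis. dF h e x \<bullet> E e x)"
          using main s(1)[of x] by (intro mult_left_mono) auto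
        moreover have "s x ^ 4 * (\<omega> * Cd * (\<Sum>e\<in>Basis. I e x)) \<le> R ^ 8 * (\<omega> * Cd * (\<Sum>e\<in>Basis. I e x))"
          using sp[of x 4] \<omega> Cd by (intro mult_right_mono mult_nonneg_nonneg sum_nonneg) (auto simp: I_def)
        moreover have "s x ^ 4 * (\<Sum>e\<in>Basis. dF h e x \<bullet> E e x) = (\<Sum>e\<in>Basis. dF h e x \<bullet> D e x) + 8 * (\<Sum>e\<in>Basis. \<Sum>j\<in>Basis. P e j x)"
          unfolding sum_distrib_left[of "s x ^ 4"] PD[symmetric] by (simp add: sum.distrib sum_distrib_left)
        ultimately show ?thesis unfolding c3_def by (simp add: sum_distrib_left[symmetric] algebra_simps)
      next
        case False
        then show ?thesis by (simp add: s0 I_def P_def D_def)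
      qed
      have iR: "integrable lborel (\<lambda>x. (\<Sum>e\<in>Basis. dF h e x \<bullet> D e x) + 8 * (\<Sum>e\<in>Basis. \<Sum>j\<in>Basis. P e j x))"
        by (intro Bochner_Integration.integrable_add integrable_mult_right Bochner_Integration.integrable_sum T(2) T'(2)) auto
      have iL: "integrable lborel (\<lambda>x. cs * (\<Sum>e\<in>Basis. s x ^ 4 * (norm (E e x))\<^sup>2) - c3 * (\<Sum>e\<in>Basis. I e x))"
        by (intro Bochner_Integration.integrable_diff integrable_mult_right Bochner_Integration.integrable_sum iE iI) 
      have XXe: "(LBINT x. \<Sum>e\<in>Basis. s x ^ 4 * (norm (E e x))\<^sup>2) = XX"
        unfolding XX_def X_def by (rule Bochner_Integration.integral_sum) (rule iE)
      have L1: "(LBINT x. cs * (\<Sum>e\<in>Basis. s x ^ 4 * (norm (E e x))\<^sup>2) - c3 * (\<Sum>e\<in>Basis. I e x))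
        = cs * XX - c3 * (\<Sum>e\<in>Basis. integral\<^sup>L lborel (I e))"
        using iE iI XXe by (simp add: Bochner_Integration.integral_sum Bochner_Integration.integrable_sum)
      have L2: "c3 * (\<Sum>e\<in>Basis. integral\<^sup>L lborel (I e)) \<le> 1"
      proof -
        have "(\<Sum>e\<in>Basis. integral\<^sup>L lborel (I e)) \<le> N * C1"
          unfolding N_def using C1(3)[OF h(1) hh1] by (intro sum_bounded_above) (auto simp: I_def[abs_def])
        then have "c3 * (\<Sum>e\<in>Basis. integral\<^sup>L lborel (I e)) \<le> c3 * (N * C1)" using c3 by (intro mult_left_mono)
        then show ?thesis using \<omega>(2) by (simp add: c3_def mult.assoc)
      qed
      have R1: "(LBINT x. (\<Sum>e\<in>Basis. dF h e x \<bullet> D e x) + 8 * (\<Sum>e\<in>Basis. \<Sum>j\<in>Basis. P e j x))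
         = (\<Sum>e\<in>Basis. (LBINT x. dF h e x \<bullet> D e x)) + 8 * (\<Sum>e\<in>Basis. \<Sum>j\<in>Basis. integral\<^sup>L lborel (P e j))"
        using T(2) T'(2) by (simp add: Bochner_Integration.integral_sum Bochner_Integration.integrable_sum)
      have R2: "(\<Sum>e\<in>Basis. (LBINT x. dF h e x \<bullet> D e x)) \<le> (\<Sum>e\<in>Basis. Ig / (2 * \<kappa>) + \<kappa> / 2 * (K1 * X e + K2 * m))"
        by (intro sum_mono T(1))
      have R3: "(\<Sum>e\<in>Basis. Ig / (2 * \<kappa>) + \<kappa> / 2 * (K1 * X e + K2 * m)) = N * (Ig / (2 * \<kappa>) + \<kappa> / 2 * (K2 * m)) + \<kappa> / 2 * K1 * XX"
        unfolding XX_def N_def sum_distrib_left by (simp add: sum.distrib distrib_left mult.assoc)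
      have R4: "(\<Sum>e\<in>Basis. \<Sum>j\<in>Basis. integral\<^sup>L lborel (P e j)) \<le> (\<Sum>e\<in>Basis. N * (flux_bound / (2 * \<kappa>) + \<kappa> / 2 * (K1 * X e + K2 * m)))"
        unfolding N_def by (intro sum_mono sum_bounded_above T'(1))
      have R5: "(\<Sum>e\<in>Basis. N * (flux_bound / (2 * \<kappa>) + \<kappa> / 2 * (K1 * X e + K2 * m))) = N * N * (flux_bound / (2 * \<kappa>) + \<kappa> / 2 * (K2 * m)) + N * (\<kappa> / 2 * K1 * XX)"
        unfolding XX_def N_def sum_distrib_left by (simp add: sum.distrib distrib_left mult.assoc mult.left_commute)
      \<comment> \<open>Here \<open>t\<close> stands for \<open>\<kappa> / 2 * K1 * XX\<close>, the
        energy to be absorbed; the inequality is isolated as linear arithmetic.\<close>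
      have gen: "cs / 2 * XX \<le> 1 + a + 8 * N * N * b"
        if "cs * XX - 1 \<le> a + t + 8 * (N * N * b + N * t)" "t + 8 * (N * t) = cs / 2 * XX" for a b t
        using that by argo
      have Le: "cs * XX - 1 \<le> (LBINT x. cs * (\<Sum>e\<in>Basis. s x ^ 4 * (norm (E e x))\<^sup>2) - c3 * (\<Sum>e\<in>Basis. I e x))"
        unfolding L1 using L2 by (rule diff_left_mono)
      have "cs * XX - 1 \<le> N * (Ig / (2 * \<kappa>) + \<kappa> / 2 * (K2 * m)) + \<kappa> / 2 * K1 * XX
          + 8 * (N * N * (flux_bound / (2 * \<kappa>) + \<kappa> / 2 * (K2 * m)) + N * (\<kappa> / 2 * K1 * XX))"
        by (rule order_trans[OF Le], rule order_trans[OF integral_mono[OF iL iR pt]], unfold R1,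
            intro add_mono mult_left_mono, rule R2[unfolded R3], rule R4[unfolded R5]) simp
      moreover have "\<kappa> / 2 * K1 * XX + 8 * (N * (\<kappa> / 2 * K1 * XX)) = cs / 2 * XX"
      proof -
        have "\<kappa> * (K1 * (1 + 8 * N)) = cs" using K1 N by (simp add: \<kappa>_def)
        then have "\<kappa> * (K1 * (1 + 8 * N)) * XX / 2 = cs * XX / 2" by simp
        then show ?thesis by (simp add: algebra_simps)
      qed
      ultimately have "cs / 2 * XX \<le> 1 + N * (Ig / (2 * \<kappa>) + \<kappa> / 2 * (K2 * m)) + 8 * N * N * (flux_bound / (2 * \<kappa>) + \<kappa> / 2 * (K2 * m))"
        by (rule gen)
      then have "2 / cs * (cs / 2 * XX) \<le> C" unfolding C_def using cs by (intro mult_left_mono) auto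
      then have "XX \<le> C" using cs by simp
      then show ?thesis unfolding XXe[symmetric] by (simp add: s_def E_def sum_distrib_left)
    qed
    then show "\<exists>h0>0. \<forall>h. 0 < h \<and> h < h0 \<longrightarrow>
      (LBINT x. cap x0 R x ^ 4 * (\<Sum>e\<in>Basis. (norm (tDW d h e x))\<^sup>2)) \<le> C"
      using R C1(1) h2(1) by (intro exI[of _ "min (R / 2) (min h1 h2)"]) auto
  qed
qed

end

section \<open>The source on the critical set\<close>

context flux_equation
begin

text \<open>The truncation level is 1 / (k + 1), and h is chosen below both the energy threshold and
  the one for uniform closeness. Closeness is required at the same scale as the truncation, so that
  \<open>dq\<close> falls below the level on the critical set and the truncated field vanishes
  there.\<close>

lemma truncation_sequence:
  obtains C h where "\<And>k::nat. 0 < h k"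
    "\<And>k. (LBINT x. cap x0 R x ^ 4 * (\<Sum>e\<in>Basis. (norm (tDW (1 / Suc k) (h k) e x))\<^sup>2)) \<le> C"
    "\<And>k x. norm (dq (h k) x - G x) < 1 / Suc k"
proof -
  obtain C where C: "\<And>d. 0 < d \<Longrightarrow> \<exists>h0>0. \<forall>h. 0 < h \<and> h < h0 \<longrightarrow>
    (LBINT x. cap x0 R x ^ 4 * (\<Sum>e\<in>Basis. (norm (tDW d h e x))\<^sup>2)) \<le> C"
    by (rule truncated_flux_energy) blast
  define Q where "Q k h \<longleftrightarrow> 0 < h \<and> (LBINT x. cap x0 R x ^ 4 * (\<Sum>e\<in>Basis. (norm (tDW (1 / Suc k) h e x))\<^sup>2)) \<le> C
     \<and> (\<forall>x. norm (dq h x - G x) < 1 / Suc k)" for k :: nat and h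
  have "\<exists>h. Q k h" for k
  proof -
    have d: "0 < 1 / real (Suc k)" by simp
    obtain h1 where h1: "0 < h1" "\<And>h. 0 < h \<Longrightarrow> h < h1 \<Longrightarrow>
       (LBINT x. cap x0 R x ^ 4 * (\<Sum>e\<in>Basis. (norm (tDW (1 / Suc k) h e x))\<^sup>2)) \<le> C"
      using C[OF d] by blast
    obtain h2 where h2: "0 < h2" "\<And>h x. 0 < h \<Longrightarrow> h < h2 \<Longrightarrow> norm (dq h x - G x) < 1 / Suc k"
      by (rule dq_close[OF d]) blast
    have "0 < min h1 h2 / 2" "min h1 h2 / 2 < h1" "min h1 h2 / 2 < h2" using h1(1) h2(1) by auto
    then show ?thesis unfolding Q_def using h1(2) h2(2) by blast
  qed
  then obtain h where "\<And>k. Q k (h k)" by metis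
  then show thesis using that unfolding Q_def by blast
qed

text \<open>The equation is tested with \<open>cap ^ 4 * \<zeta>\<close>. The flux is a bounded
  pointwise limit of the truncated fields, for which one integrates by parts. Their divergence is
  zero on the critical set, so \<open>\<zeta>\<close> may be diminished by its indicator; Young's
  inequality and the uniform energy bound finish the estimate.\<close>

lemma flux_pairing_bound:
  obtains C where "\<And>\<zeta> X \<kappa>. (\<And>x. GDERIV \<zeta> x :> X x) \<Longrightarrow> continuous_on UNIV X \<Longrightarrow> (\<And>x. 0 \<le> \<zeta> x \<and> \<zeta> x \<le> 1) \<Longrightarrow> 0 < \<kappa> \<Longrightarrow>
    \<bar>(LBINT x. g x * (cap x0 R x ^ 4 * \<zeta> x))\<bar>
      \<le> (LBINT x. cap x0 R x ^ 4 * (\<zeta> x - indicator {x. G x = 0} x)\<^sup>2) / (2 * \<kappa>) + \<kappa> / 2 * C"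
proof -
  obtain C h where h: "\<And>k::nat. 0 < h k"
    and en: "\<And>k. (LBINT x. cap x0 R x ^ 4 * (\<Sum>e\<in>Basis. (norm (tDW (1 / Suc k) (h k) e x))\<^sup>2)) \<le> C"
    and cl: "\<And>k x. norm (dq (h k) x - G x) < 1 / Suc k"
    by (rule truncation_sequence) blast
  define N where "N = real DIM('a)"
  define d where "d k = 1 / real (Suc k)" for k
  have d: "0 < d k" "d k \<le> 1" for k by (auto simp: d_def)
  have d0: "d \<longlonglongrightarrow> 0" using LIMSEQ_Suc[OF lim_const_over_n[of 1]] by (simp add: d_def[abs_def])
  define Z where "Z = {x. G x = 0}"
  have "closed Z" unfolding Z_def by (intro closed_Collect_eq continuous_intros G_cont)
  then have [measurable]: "Z \<in> sets borel" by simp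
  have nb: "norm (dq (h k) x) \<le> L + 1" for k x
    using cl[of k x] d(2)[of k] L(2)[of x] norm_triangle_ineq2[of "dq (h k) x" "G x"] unfolding d_def by linarith
  have dql: "(\<lambda>k. dq (h k) x) \<longlonglongrightarrow> G x" for x
  proof (rule LIM_zero_cancel, rule tendsto_norm_zero_cancel, rule tendsto_sandwich[OF _ _ tendsto_const d0])
    show "\<forall>\<^sub>F k in sequentially. norm (dq (h k) x - G x) \<le> d k" using cl by (auto simp: d_def less_imp_le)
  qed auto
  define W where "W k x = (\<Sum>e\<in>Basis. tW (d k) (h k) e x *\<^sub>R e)" for k x
  have W: "W k x = tweight (d k) (norm (dq (h k) x)) *\<^sub>R dq (h k) x" for k x
    unfolding W_def tW_def scaleR_scaleR[symmetric] scaleR_sum_right[symmetric] by (simp add: euclidean_representation)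
  have Wl: "(\<lambda>k. W k x) \<longlonglongrightarrow> flux (G x)" for x
  proof (cases "G x = 0")
    case True
    \<comment> \<open>On the critical set the truncated fields are exactly zero for every k, so no
      continuity of \<open>A\<close> at zero enters.\<close>
    have "W k x = 0" for k using cl[of k x] True by (simp add: W tweight_below d_def)
    then show ?thesis using True by simp
  next
    case False
    define t where "t k = norm (dq (h k) x)" for k
    have t: "t \<longlonglongrightarrow> norm (G x)" unfolding t_def by (intro tendsto_norm dql)
    have n: "0 < norm (G x)" using False by simp
    have "isCont A (norm (G x))" by (rule DERIV_isCont[OF A_deriv[OF n]])
    then have "(\<lambda>k. A (t k)) \<longlonglongrightarrow> A (norm (G x))" using t by (rule isCont_tendsto_compose)
    then have "(\<lambda>k. A (t k) * (max 0 (t k - d k))\<^sup>2 / (t k)\<^sup>2) \<longlonglongrightarrow> A (norm (G x)) * (max 0 (norm (G x) - 0))\<^sup>2 / (norm (G x))\<^sup>2"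
      using n by (intro tendsto_intros t d0) auto
    then have "(\<lambda>k. tweight (d k) (t k)) \<longlonglongrightarrow> A (norm (G x))" using n by (simp add: tweight_def)
    then show ?thesis unfolding W flux_def t_def[symmetric] by (intro tendsto_intros dql)
  qed
  have Wc: "continuous_on UNIV (tW (d k) (h k) e)" if "e \<in> Basis" for k e
    using GDERIV_tW[OF d(1) that] by (rule GDERIV_continuous_on)
  have Wb: "norm (W k x) \<le> N * ((L + 1) * A (L + 1))" for k x
  proof -
    have "norm (W k x) \<le> (\<Sum>e\<in>Basis. norm (tW (d k) (h k) e x *\<^sub>R e))" unfolding W_def by (rule norm_sum)
    also have "\<dots> \<le> N * ((L + 1) * A (L + 1))"
      unfolding N_def using tW_bound[OF d(1) nb] by (intro sum_bounded_above) auto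
    finally show ?thesis .
  qed
  show thesis
  proof (rule that[of "N * C"])
    fix \<zeta> :: "'a \<Rightarrow> real" and X :: "'a \<Rightarrow> 'a" and \<kappa> :: real
    assume \<zeta>: "\<And>x. GDERIV \<zeta> x :> X x" "continuous_on UNIV X" "\<And>x. 0 \<le> \<zeta> x \<and> \<zeta> x \<le> 1" and \<kappa>: "0 < \<kappa>"
    have \<zeta>c: "continuous_on UNIV \<zeta>" using \<zeta>(1) by (rule GDERIV_continuous_on)
    have [measurable]: "\<zeta> \<in> borel_measurable borel" using \<zeta>c by (rule borel_measurable_continuous_onI)
    define s where "s x = cap x0 R x" for x
    have s: "0 \<le> s x" "s x \<le> R\<^sup>2" for x using cap_nonneg cap_le by (auto simp: s_def)
    have s0: "s x = 0" if "x \<notin> cball x0 R" for x using cap_outside[OF that R] by (simp add: s_def)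
    have cs: "continuous_on UNIV s" unfolding s_def[abs_def] by (rule cap_continuous)
    have [measurable]: "s \<in> borel_measurable borel" using cs by (rule borel_measurable_continuous_onI)
    obtain D where D: "C1c (cball x0 R) (\<lambda>x. s x ^ 4 * \<zeta> x) D"
      using C1c_cap_mult[OF R \<zeta>(1,2), of x0 2] unfolding s_def[abs_def] by (auto simp: eval_nat_numeral)
    then have D2: "C1c (ball x0 (2 * R)) (\<lambda>x. s x ^ 4 * \<zeta> x) D" by (rule C1c_mono) (use R in auto)
    have DU: "C1c UNIV (\<lambda>x. s x ^ 4 * \<zeta> x) D" using D by (rule C1c_mono) auto
    obtain K where K: "compact K" "\<And>x. x \<notin> K \<Longrightarrow> D x = 0" using D by (rule C1c_support) blast
    have [measurable]: "D \<in> borel_measurable borel" using C1c_D(2)[OF D] by (rule borel_measurable_continuous_onI)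
    have iD: "integrable lborel D" by (rule integrable_continuous_compact_support[OF C1c_D(2)[OF D] K])
    define J where "J = (LBINT x. s x ^ 4 * (\<zeta> x - indicator Z x)\<^sup>2)"
    have i4: "integrable lborel (\<lambda>x. s x ^ 4)"
      by (rule integrable_continuous_compact_support[of _ "cball x0 R"]) (intro continuous_intros cs, auto simp: s0)
    have iJ: "integrable lborel (\<lambda>x. s x ^ 4 * (\<zeta> x - indicator Z x)\<^sup>2)"
    proof (rule Bochner_Integration.integrable_bound[OF i4])
      show "AE x in lborel. norm (s x ^ 4 * (\<zeta> x - indicator Z x)\<^sup>2) \<le> norm (s x ^ 4)"
      proof (intro always_eventually allI)
        fix x
        have "\<bar>\<zeta> x - indicator Z x\<bar> \<le> 1" using \<zeta>(3)[of x] by (auto simp: indicator_def)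
        then have "(\<zeta> x - indicator Z x)\<^sup>2 \<le> 1" by (simp add: abs_square_le_1)
        then show "norm (s x ^ 4 * (\<zeta> x - indicator Z x)\<^sup>2) \<le> norm (s x ^ 4)"
          using s(1)[of x] by (auto simp: abs_mult intro: mult_left_le)
      qed
    qed measurable
    have lim: "(\<lambda>k. (LBINT x. W k x \<bullet> D x)) \<longlonglongrightarrow> (LBINT x. flux (G x) \<bullet> D x)"
    proof (rule integral_dominated_convergence[where w="\<lambda>x. (N * ((L + 1) * A (L + 1))) * norm (D x)"])
      have [measurable]: "W k \<in> borel_measurable borel" for k
        unfolding W_def[abs_def] using Wc by (intro borel_measurable_continuous_onI continuous_intros) auto
      show "(\<lambda>x. W k x \<bullet> D x) \<in> borel_measurable lborel" for k by measurable
      show "AE x in lborel. (\<lambda>k. W k x \<bullet> D x) \<longlonglongrightarrow> flux (G x) \<bullet> D x"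
        using Wl by (intro always_eventually allI tendsto_intros)
      show "AE x in lborel. norm (W k x \<bullet> D x) \<le> N * ((L + 1) * A (L + 1)) * norm (D x)" for k
      proof (intro always_eventually allI)
        fix x have "norm (W k x \<bullet> D x) \<le> norm (W k x) * norm (D x)" by (simp add: Cauchy_Schwarz_ineq2)
        also have "\<dots> \<le> N * ((L + 1) * A (L + 1)) * norm (D x)" using Wb by (intro mult_right_mono) auto
        finally show "norm (W k x \<bullet> D x) \<le> N * ((L + 1) * A (L + 1)) * norm (D x)" .
      qed
      show "integrable lborel (\<lambda>x. N * ((L + 1) * A (L + 1)) * norm (D x))" using iD by auto
    qed measurable
    have bnd: "\<bar>(LBINT x. W k x \<bullet> D x)\<bar> \<le> J / (2 * \<kappa>) + \<kappa> / 2 * (N * C)" for k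
    proof -
      define E where "E e x = tDW (d k) (h k) e x" for e x
      have Ec: "continuous_on UNIV (E e)" for e unfolding E_def[abs_def] by (rule tDW_cont[OF d(1)])
      have bp: "(LBINT x. tW (d k) (h k) e x * (D x \<bullet> e)) = - (LBINT x. s x ^ 4 * \<zeta> x * (E e x \<bullet> e))"
        "integrable lborel (\<lambda>x. tW (d k) (h k) e x * (D x \<bullet> e))" "integrable lborel (\<lambda>x. s x ^ 4 * \<zeta> x * (E e x \<bullet> e))"
        if "e \<in> Basis" for e
        using C1c_integration_by_parts[OF DU open_UNIV GDERIV_tW[OF d(1) that] tDW_cont[OF d(1)], of e] that
        by (auto simp: E_def)
      define V where "V x = (\<Sum>e\<in>Basis. E e x \<bullet> e)" for x
      have Vc: "continuous_on UNIV V" unfolding V_def[abs_def] by (intro continuous_intros Ec)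
      have [measurable]: "V \<in> borel_measurable borel" using Vc by (rule borel_measurable_continuous_onI)
      have "(LBINT x. W k x \<bullet> D x) = (LBINT x. \<Sum>e\<in>Basis. tW (d k) (h k) e x * (D x \<bullet> e))"
        unfolding W_def inner_sum_left by (simp add: inner_commute)
      also have "\<dots> = (\<Sum>e\<in>Basis. (LBINT x. tW (d k) (h k) e x * (D x \<bullet> e)))"
        by (rule Bochner_Integration.integral_sum) (rule bp(2), auto)
      also have "\<dots> = (\<Sum>e\<in>Basis. - (LBINT x. s x ^ 4 * \<zeta> x * (E e x \<bullet> e)))"
        by (rule sum.cong[OF refl]) (rule bp(1), auto)
      also have "\<dots> = - (LBINT x. \<Sum>e\<in>Basis. s x ^ 4 * \<zeta> x * (E e x \<bullet> e))"
        unfolding sum_negf by (subst Bochner_Integration.integral_sum) (auto intro: bp(3))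
      also have "\<dots> = - (LBINT x. s x ^ 4 * \<zeta> x * V x)" by (simp add: V_def sum_distrib_left)
      finally have e1: "(LBINT x. W k x \<bullet> D x) = - (LBINT x. s x ^ 4 * \<zeta> x * V x)" .
      \<comment> \<open>\<open>V\<close> is the divergence of the truncated field, and the k-th
        field has zero derivative wherever \<open>dq\<close> has norm at most \<open>d k\<close>, in
        particular on \<open>Z\<close>.\<close>
      have V0: "V x = 0" if "x \<in> Z" for x
        using that cl[of k x] by (auto simp: Z_def V_def E_def tDW_below d_def intro!: sum.neutral)
      have iE: "integrable lborel (\<lambda>x. s x ^ 4 * (\<Sum>e\<in>Basis. (norm (E e x))\<^sup>2))"
        by (rule integrable_continuous_compact_support[of _ "cball x0 R"]) (intro continuous_intros cs Ec, auto simp: s0)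
      have iU: "integrable lborel (\<lambda>x. s x ^ 4 * (\<zeta> x - indicator Z x)\<^sup>2 / (2 * \<kappa>) + \<kappa> / 2 * N * (s x ^ 4 * (\<Sum>e\<in>Basis. (norm (E e x))\<^sup>2)))"
        using iJ iE by auto
      have pt: "\<bar>s x ^ 4 * \<zeta> x * V x\<bar> \<le> s x ^ 4 * (\<zeta> x - indicator Z x)\<^sup>2 / (2 * \<kappa>) + \<kappa> / 2 * N * (s x ^ 4 * (\<Sum>e\<in>Basis. (norm (E e x))\<^sup>2))" for x
      proof -
        define c where "c = \<zeta> x - indicator Z x"
        have e2: "s x ^ 4 * \<zeta> x * V x = s x ^ 4 * (c * V x)" using V0[of x] by (auto simp: c_def indicator_def)
        have "\<bar>c * V x\<bar> \<le> c\<^sup>2 / (2 * \<kappa>) + \<kappa> / 2 * (V x)\<^sup>2"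
        proof -
          have "0 \<le> (\<bar>c\<bar> - \<kappa> * \<bar>V x\<bar>)\<^sup>2 / (2 * \<kappa>)" using \<kappa> by simp
          also have "(\<bar>c\<bar> - \<kappa> * \<bar>V x\<bar>)\<^sup>2 = c\<^sup>2 + \<kappa>\<^sup>2 * (V x)\<^sup>2 - 2 * \<kappa> * \<bar>c * V x\<bar>"
            by (simp add: power2_diff power_mult_distrib abs_mult)
          finally show ?thesis using \<kappa> by (simp add: field_simps power2_eq_square)
        qed
        moreover have "(V x)\<^sup>2 \<le> N * (\<Sum>e\<in>Basis. (norm (E e x))\<^sup>2)"
        proof -
          have "(V x)\<^sup>2 \<le> (\<Sum>e\<in>Basis. (E e x \<bullet> e)\<^sup>2) * N"
            unfolding V_def N_def by (rule sum_squared_le_sum_of_squares)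
          also have "\<dots> \<le> (\<Sum>e\<in>Basis. (norm (E e x))\<^sup>2) * N"
          proof (intro mult_right_mono sum_mono)
            fix e :: 'a assume "e \<in> Basis"
            from power_mono[OF Basis_le_norm[OF this, of "E e x"] abs_ge_zero, of 2]
            show "(E e x \<bullet> e)\<^sup>2 \<le> (norm (E e x))\<^sup>2" by simp
          qed (simp add: N_def)
          finally show ?thesis by (simp add: mult.commute)
        qed
        then have "\<kappa> / 2 * (V x)\<^sup>2 \<le> \<kappa> / 2 * (N * (\<Sum>e\<in>Basis. (norm (E e x))\<^sup>2))" using \<kappa> by (intro mult_left_mono) auto
        ultimately have "\<bar>c * V x\<bar> \<le> c\<^sup>2 / (2 * \<kappa>) + \<kappa> / 2 * (N * (\<Sum>e\<in>Basis. (norm (E e x))\<^sup>2))" by linarith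
        then have "s x ^ 4 * \<bar>c * V x\<bar> \<le> s x ^ 4 * (c\<^sup>2 / (2 * \<kappa>) + \<kappa> / 2 * (N * (\<Sum>e\<in>Basis. (norm (E e x))\<^sup>2)))"
          using s(1)[of x] by (intro mult_left_mono) auto
        then have "\<bar>s x ^ 4 * \<zeta> x * V x\<bar> \<le> s x ^ 4 * (c\<^sup>2 / (2 * \<kappa>) + \<kappa> / 2 * (N * (\<Sum>e\<in>Basis. (norm (E e x))\<^sup>2)))"
          unfolding e2 abs_mult[of "s x ^ 4"] using s(1)[of x] by simp
        then show ?thesis by (simp add: c_def algebra_simps)
      qed
      have "\<bar>(LBINT x. W k x \<bullet> D x)\<bar> \<le> (LBINT x. \<bar>s x ^ 4 * \<zeta> x * V x\<bar>)"
        unfolding e1 abs_minus_cancel by (rule integral_abs_bound)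
      also have "\<dots> \<le> (LBINT x. s x ^ 4 * (\<zeta> x - indicator Z x)\<^sup>2 / (2 * \<kappa>) + \<kappa> / 2 * N * (s x ^ 4 * (\<Sum>e\<in>Basis. (norm (E e x))\<^sup>2)))"
        by (rule integral_mono_AE'[OF iU]) (use pt order_trans[OF abs_ge_zero pt] in auto)
      also have "\<dots> = J / (2 * \<kappa>) + \<kappa> / 2 * N * (LBINT x. s x ^ 4 * (\<Sum>e\<in>Basis. (norm (E e x))\<^sup>2))"
        using iJ iE by (simp add: J_def)
      also have "\<dots> \<le> J / (2 * \<kappa>) + \<kappa> / 2 * N * C"
        using en[of k] \<kappa> by (intro add_left_mono mult_left_mono) (auto simp: s_def E_def d_def N_def)
      finally show ?thesis by (simp add: mult.assoc)
    qed
    have "\<bar>(LBINT x. flux (G x) \<bullet> D x)\<bar> \<le> J / (2 * \<kappa>) + \<kappa> / 2 * (N * C)"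
      by (rule LIMSEQ_le_const2[OF tendsto_rabs[OF lim]]) (use bnd in auto)
    then have "\<bar>(LBINT x. g x * (s x ^ 4 * \<zeta> x))\<bar> \<le> J / (2 * \<kappa>) + \<kappa> / 2 * (N * C)"
      using eqn[OF D2] by simp
    then show "\<bar>(LBINT x. g x * (cap x0 R x ^ 4 * \<zeta> x))\<bar>
      \<le> (LBINT x. cap x0 R x ^ 4 * (\<zeta> x - indicator {x. G x = 0} x)\<^sup>2) / (2 * \<kappa>) + \<kappa> / 2 * (N * C)"
      by (simp add: s_def J_def Z_def)
  qed
qed

text \<open>The preceding bound is applied to C1 functions decreasing in L2 distance to the
  indicator of the critical set. The limit n -> infinity removes the first term for fixed
  \<open>\<kappa>\<close>, and then \<open>\<kappa>\<close> tends to zero.\<close>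

lemma source_vanishes_on_critical_set:
  "(LBINT x. g x * (cap x0 R x ^ 4 * indicator {x. G x = 0} x)) = 0"
proof -
  obtain C where C: "\<And>\<zeta> X \<kappa>. (\<And>x. GDERIV \<zeta> x :> X x) \<Longrightarrow> continuous_on UNIV X \<Longrightarrow> (\<And>x. 0 \<le> \<zeta> x \<and> \<zeta> x \<le> 1) \<Longrightarrow> 0 < \<kappa> \<Longrightarrow>
    \<bar>(LBINT x. g x * (cap x0 R x ^ 4 * \<zeta> x))\<bar>
      \<le> (LBINT x. cap x0 R x ^ 4 * (\<zeta> x - indicator {x. G x = 0} x)\<^sup>2) / (2 * \<kappa>) + \<kappa> / 2 * C"
    by (rule flux_pairing_bound) blast
  have "\<exists>h. \<forall>x. norm (dq h x - G x) < 1 / real (Suc n)" for n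
  proof -
    obtain h0 where "0 < h0" "\<And>h x. 0 < h \<Longrightarrow> h < h0 \<Longrightarrow> norm (dq h x - G x) < 1 / real (Suc n)"
      by (rule dq_close[of "1 / real (Suc n)"]) auto
    then show ?thesis using dense[of 0 h0] by blast
  qed
  then obtain h where h: "\<And>n x. norm (dq (h n) x - G x) < 1 / real (Suc n)" by metis
  have d0: "(\<lambda>n. 1 / real (Suc n)) \<longlonglongrightarrow> 0" using LIMSEQ_Suc[OF lim_const_over_n[of 1]] by simp
  \<comment> \<open>The factor n + 1 is calibrated against the error 1 / (n + 1) of
    \<open>dq\<close>: on the critical set its product with the squared norm is at most 1 / (n + 1),
    while at other points it eventually exceeds 1 and the function is zero.\<close>
  define \<zeta> where "\<zeta> n x = (max 0 (1 - real (Suc n) * (norm (dq (h n) x))\<^sup>2))\<^sup>2" for n x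
  define X where "X n x = (2 * max 0 (1 - real (Suc n) * (norm (dq (h n) x))\<^sup>2)) *\<^sub>R
     (- real (Suc n) *\<^sub>R (\<Sum>e\<in>Basis. (2 * (dq (h n) x \<bullet> e)) *\<^sub>R dG (h n) e x))" for n x
  have \<zeta>d: "GDERIV (\<zeta> n) x :> X n x" for n x
  proof -
    have "GDERIV (\<lambda>x. (dq (h n) x \<bullet> e) * (dq (h n) x \<bullet> e)) x :> (2 * (dq (h n) x \<bullet> e)) *\<^sub>R dG (h n) e x" if "e \<in> Basis" for e
      using GDERIV_mult[OF dq_deriv[OF that, of "h n" x] dq_deriv[OF that, of "h n" x]] by (simp add: scaleR_add_left[symmetric])
    then have "((\<lambda>x. \<Sum>e\<in>Basis. (dq (h n) x \<bullet> e) * (dq (h n) x \<bullet> e)) has_derivative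
        (\<lambda>v. \<Sum>e\<in>Basis. v \<bullet> ((2 * (dq (h n) x \<bullet> e)) *\<^sub>R dG (h n) e x))) (at x)"
      unfolding gderiv_def by (intro has_derivative_sum)
    then have "GDERIV (\<lambda>x. (norm (dq (h n) x))\<^sup>2) x :> (\<Sum>e\<in>Basis. (2 * (dq (h n) x \<bullet> e)) *\<^sub>R dG (h n) e x)"
      unfolding gderiv_def power2_norm_eq_inner inner_sum_right euclidean_inner[of "dq (h n) _" "dq (h n) _"] by simp
    from GDERIV_diff[OF GDERIV_const_zero[of 1] GDERIV_cmult[OF this, of "real (Suc n)"]]
    have "GDERIV (\<lambda>x. 1 - real (Suc n) * (norm (dq (h n) x))\<^sup>2) x :> - real (Suc n) *\<^sub>R (\<Sum>e\<in>Basis. (2 * (dq (h n) x \<bullet> e)) *\<^sub>R dG (h n) e x)"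
      by (simp del: of_nat_Suc)
    from GDERIV_DERIV_compose[OF this DERIV_max_power[of 0]]
    show ?thesis unfolding \<zeta>_def[abs_def] X_def by (simp add: numeral_2_eq_2)
  qed
  have Xc: "continuous_on UNIV (X n)" for n
    unfolding X_def[abs_def] by (intro continuous_intros dq_cont dG_cont)
  have \<zeta>01: "0 \<le> \<zeta> n x \<and> \<zeta> n x \<le> 1" for n x
  proof -
    have "0 \<le> real (Suc n) * (norm (dq (h n) x))\<^sup>2" by simp
    then show ?thesis unfolding \<zeta>_def by (intro conjI zero_le_power2 power_le_one) (auto simp del: of_nat_Suc)
  qed
  define Z where "Z = {x. G x = 0}"
  have "closed Z" unfolding Z_def by (intro closed_Collect_eq continuous_intros G_cont)
  then have [measurable]: "Z \<in> sets borel" by simp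
  have [measurable]: "\<zeta> n \<in> borel_measurable borel" for n
    using GDERIV_continuous_on[of UNIV "\<zeta> n" "X n"] \<zeta>d by (intro borel_measurable_continuous_onI) auto
  have \<zeta>l: "(\<lambda>n. \<zeta> n x) \<longlonglongrightarrow> indicator Z x" for x
  proof (cases "x \<in> Z")
    case True
    have "(\<lambda>n. real (Suc n) * (norm (dq (h n) x))\<^sup>2) \<longlonglongrightarrow> 0"
    proof (rule tendsto_sandwich[OF _ _ tendsto_const d0])
      show "\<forall>\<^sub>F n in sequentially. real (Suc n) * (norm (dq (h n) x))\<^sup>2 \<le> 1 / real (Suc n)"
      proof (intro always_eventually allI)
        fix n
        have "(norm (dq (h n) x))\<^sup>2 \<le> (1 / real (Suc n))\<^sup>2"
          using h[of n x] True by (intro power_mono) (auto simp: Z_def)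
        then have "real (Suc n) * (norm (dq (h n) x))\<^sup>2 \<le> real (Suc n) * (1 / real (Suc n))\<^sup>2" by (intro mult_left_mono) auto
        also have "\<dots> = 1 / real (Suc n)" by (simp add: power2_eq_square)
        finally show "real (Suc n) * (norm (dq (h n) x))\<^sup>2 \<le> 1 / real (Suc n)" .
      qed
    qed auto
    then have "(\<lambda>n. \<zeta> n x) \<longlonglongrightarrow> (max 0 (1 - 0))\<^sup>2" unfolding \<zeta>_def by (intro tendsto_intros)
    then show ?thesis using True by simp
  next
    case False
    then have n: "0 < norm (G x)" by (simp add: Z_def)
    have "\<forall>\<^sub>F n in sequentially. 1 / real (Suc n) < norm (G x) / 2"
      using order_tendstoD(2)[OF d0, of "norm (G x) / 2"] n by simp
    moreover have "\<forall>\<^sub>F n in sequentially. 1 / real (Suc n) < (norm (G x) / 2)\<^sup>2"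
      using order_tendstoD(2)[OF d0, of "(norm (G x) / 2)\<^sup>2"] n by simp
    ultimately have "\<forall>\<^sub>F n in sequentially. \<zeta> n x = 0"
    proof eventually_elim
      case (elim n)
      have "norm (G x) / 2 \<le> norm (dq (h n) x)"
        using h[of n x] elim(1) norm_triangle_ineq2[of "G x" "dq (h n) x"] norm_minus_commute[of "G x" "dq (h n) x"] by linarith
      then have "(norm (G x) / 2)\<^sup>2 \<le> (norm (dq (h n) x))\<^sup>2" by (intro power_mono) auto
      then have "1 / real (Suc n) \<le> (norm (dq (h n) x))\<^sup>2" using elim(2) by linarith
      then have "1 \<le> real (Suc n) * (norm (dq (h n) x))\<^sup>2" by (simp add: field_simps)
      then show ?case by (simp add: \<zeta>_def)
    qed
    then show ?thesis using False by (simp add: tendsto_eventually)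
  qed
  define s where "s x = cap x0 R x" for x
  have s: "0 \<le> s x" "s x \<le> R\<^sup>2" for x using cap_nonneg cap_le by (auto simp: s_def)
  have s0: "s x = 0" if "x \<notin> cball x0 R" for x using cap_outside[OF that R] by (simp add: s_def)
  have cs: "continuous_on UNIV s" unfolding s_def[abs_def] by (rule cap_continuous)
  have [measurable]: "s \<in> borel_measurable borel" using cs by (rule borel_measurable_continuous_onI)
  have i4: "integrable lborel (\<lambda>x. s x ^ 4)"
    by (rule integrable_continuous_compact_support[of _ "cball x0 R"]) (intro continuous_intros cs, auto simp: s0)
  have l1: "(\<lambda>n. (LBINT x. s x ^ 4 * (\<zeta> n x - indicator Z x)\<^sup>2)) \<longlonglongrightarrow> (LBINT x::'a. 0 :: real)"
  proof (rule integral_dominated_convergence[where w="\<lambda>x. s x ^ 4"])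
    show "integrable lborel (\<lambda>x. s x ^ 4)" by (rule i4)
    show "AE x in lborel. (\<lambda>n. s x ^ 4 * (\<zeta> n x - indicator Z x)\<^sup>2) \<longlonglongrightarrow> 0"
    proof (intro always_eventually allI)
      fix x have "(\<lambda>n. s x ^ 4 * (\<zeta> n x - indicator Z x)\<^sup>2) \<longlonglongrightarrow> s x ^ 4 * (indicator Z x - indicator Z x)\<^sup>2"
        by (intro tendsto_intros \<zeta>l)
      then show "(\<lambda>n. s x ^ 4 * (\<zeta> n x - indicator Z x)\<^sup>2) \<longlonglongrightarrow> 0" by simp
    qed
    show "AE x in lborel. norm (s x ^ 4 * (\<zeta> n x - indicator Z x)\<^sup>2) \<le> s x ^ 4" for n
    proof (intro always_eventually allI)
      fix x
      have "\<bar>\<zeta> n x - indicator Z x\<bar> \<le> 1" using \<zeta>01[of n x] by (auto simp: indicator_def)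
      then have "(\<zeta> n x - indicator Z x)\<^sup>2 \<le> 1" by (simp add: abs_square_le_1)
      then show "norm (s x ^ 4 * (\<zeta> n x - indicator Z x)\<^sup>2) \<le> s x ^ 4"
        using s(1)[of x] by (auto simp: abs_mult intro: mult_left_le)
    qed
  qed measurable
  have l2: "(\<lambda>n. (LBINT x. g x * (s x ^ 4 * \<zeta> n x))) \<longlonglongrightarrow> (LBINT x. g x * (s x ^ 4 * indicator Z x))"
  proof (rule integral_dominated_convergence[where w="\<lambda>x. Bg * s x ^ 4"])
    show "integrable lborel (\<lambda>x. Bg * s x ^ 4)" using i4 by auto
    show "AE x in lborel. (\<lambda>n. g x * (s x ^ 4 * \<zeta> n x)) \<longlonglongrightarrow> g x * (s x ^ 4 * indicator Z x)"
      by (intro always_eventually allI tendsto_intros \<zeta>l)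
    show "AE x in lborel. norm (g x * (s x ^ 4 * \<zeta> n x)) \<le> Bg * s x ^ 4" for n
    proof (intro always_eventually allI)
      fix x have "norm (g x * (s x ^ 4 * \<zeta> n x)) = \<bar>g x\<bar> * (s x ^ 4 * \<zeta> n x)" using s(1)[of x] \<zeta>01[of n x] by (simp add: abs_mult)
      also have "\<dots> \<le> Bg * (s x ^ 4 * 1)" using g_bound[of x] \<zeta>01[of n x] s(1)[of x]
        by (intro mult_mono) auto
      finally show "norm (g x * (s x ^ 4 * \<zeta> n x)) \<le> Bg * s x ^ 4" by simp
    qed
  qed measurable
  define I where "I = \<bar>(LBINT x. g x * (s x ^ 4 * indicator Z x))\<bar>"
  have le: "I \<le> \<kappa> / 2 * C" if \<kappa>: "0 < \<kappa>" for \<kappa>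
  proof -
    have "(\<lambda>n. (LBINT x. s x ^ 4 * (\<zeta> n x - indicator Z x)\<^sup>2) / (2 * \<kappa>) + \<kappa> / 2 * C) \<longlonglongrightarrow> 0 / (2 * \<kappa>) + \<kappa> / 2 * C"
      using l1 \<kappa> by (intro tendsto_intros) auto
    then have "I \<le> 0 / (2 * \<kappa>) + \<kappa> / 2 * C"
      unfolding I_def using C[OF \<zeta>d Xc \<zeta>01 \<kappa>]
      by (intro LIMSEQ_le[OF tendsto_rabs[OF l2]]) (auto simp: s_def Z_def)
    then show ?thesis by simp
  qed
  have "I \<le> 0"
  proof (rule field_le_epsilon)
    fix e :: real assume e: "0 < e"
    \<comment> \<open>The sign of \<open>C\<close> is unknown; the absolute value plus 1 gives a
      positive denominator in any case.\<close>
    have "I \<le> (e / (\<bar>C\<bar> + 1)) / 2 * C" by (rule le) (use e in auto)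
    also have "\<dots> \<le> 0 + e"
    proof -
      have "C \<le> 2 * (\<bar>C\<bar> + 1)" using abs_ge_self[of C] abs_ge_zero[of C] unfolding distrib_left by linarith
      then have "e * C \<le> e * (2 * (\<bar>C\<bar> + 1))" using e by (intro mult_left_mono) auto
      then show ?thesis by (simp add: field_simps)
    qed
    finally show "I \<le> 0 + e" .
  qed
  then show ?thesis by (simp add: I_def s_def Z_def)
qed

end

section \<open>Mollification\<close>

text \<open>The smooth function exp(-1/t), extended by zero to t <= 0 and divided by powers of t.
  The powers are included because differentiation of exp(-1/t) produces them, so that the family is
  closed under derivatives up to linear combinations.\<close>

definition flat_exp :: "nat \<Rightarrow> real \<Rightarrow> real" where
  "flat_exp m t = (if 0 < t then exp (- 1 / t) / t ^ m else 0)"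

lemma flat_exp_tendsto_0: "(flat_exp m \<longlongrightarrow> 0) (at 0)"
proof (rule filterlim_split_at)
  have "eventually (\<lambda>t. 0 = flat_exp m t) (at_left 0)"
    by (auto simp: eventually_at_filter flat_exp_def)
  then show "(flat_exp m \<longlongrightarrow> 0) (at_left 0)" by (rule Lim_transform_eventually[OF tendsto_const])
  have "((\<lambda>t. inverse t ^ m / exp (inverse t)) \<longlongrightarrow> (0::real)) (at_right 0)"
    by (rule filterlim_compose[OF tendsto_power_div_exp_0 filterlim_inverse_at_top_right])
  moreover have "eventually (\<lambda>t. inverse t ^ m / exp (inverse t) = flat_exp m t) (at_right 0)"
    by (auto simp: eventually_at_filter flat_exp_def exp_minus field_simps power_inverse)
  ultimately show "(flat_exp m \<longlongrightarrow> 0) (at_right 0)" by (rule Lim_transform_eventually)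
qed

lemma flat_exp_deriv:
  "(flat_exp m has_real_derivative - real m * flat_exp (Suc m) t + flat_exp (Suc (Suc m)) t) (at t)"
proof -
  consider "t > 0" | "t < 0" | "t = 0" by linarith
  then show ?thesis
  proof cases
    case 1
    have "((\<lambda>t. exp (- 1 / t) / t ^ m) has_real_derivative - real m * flat_exp (Suc m) t + flat_exp (Suc (Suc m)) t) (at t)"
    proof -
      have e: "((\<lambda>t. exp (- 1 / t)) has_real_derivative exp (- 1 / t) / t\<^sup>2) (at t)"
        using 1 by (auto intro!: derivative_eq_intros simp: power2_eq_square)
      show ?thesis
        by (rule DERIV_cong[OF DERIV_divide[OF e DERIV_pow[of m]]])
          (use 1 in \<open>cases m; simp add: flat_exp_def field_simps power2_eq_square\<close>)+
    qed
    then show ?thesis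
      by (rule has_field_derivative_transform_within_open[where S="{0<..}"]) (use 1 in \<open>auto simp: flat_exp_def\<close>)
  next
    case 2
    have "((\<lambda>t. 0) has_real_derivative 0) (at t)" by simp
    then have "(flat_exp m has_real_derivative 0) (at t)"
      by (rule has_field_derivative_transform_within_open[where S="{..<0}"]) (use 2 in \<open>auto simp: flat_exp_def\<close>)
    then show ?thesis using 2 by (simp add: flat_exp_def)
  next
    case 3
    have "((\<lambda>h. (flat_exp m (0 + h) - flat_exp m 0) / h) \<longlongrightarrow> 0) (at 0)"
      by (rule Lim_transform_eventually[OF flat_exp_tendsto_0[of "Suc m"]]) (auto simp: eventually_at_filter flat_exp_def)
    then have "(flat_exp m has_real_derivative 0) (at 0)" by (simp add: DERIV_def)
    then show ?thesis using 3 by (simp add: flat_exp_def)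
  qed
qed

text \<open>A class of functions closed under partial derivatives that contains the standard bumps.\<close>
inductive bump_algebra :: "('a::euclidean_space \<Rightarrow> real) \<Rightarrow> bool" where
  const: "bump_algebra (\<lambda>x. c)"
| coord: "bump_algebra (\<lambda>x. x \<bullet> b)"
| bump: "bump_algebra (\<lambda>x. flat_exp m (1 - r * (x \<bullet> x)))"
| add: "bump_algebra f \<Longrightarrow> bump_algebra g \<Longrightarrow> bump_algebra (\<lambda>x. f x + g x)"
| mult: "bump_algebra f \<Longrightarrow> bump_algebra g \<Longrightarrow> bump_algebra (\<lambda>x. f x * g x)"

text \<open>Induction over the generators; the chain rule for a bump stays in the class because the
  derivative of \<open>flat_exp m\<close> is a combination of \<open>flat_exp (Suc m)\<close> and
  \<open>flat_exp (Suc (Suc m))\<close>. Iteration gives derivatives of every order.\<close>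

lemma bump_algebra_gradient:
  fixes f :: "'a::euclidean_space \<Rightarrow> real"
  assumes "bump_algebra f"
  shows "\<exists>R. (\<forall>x. GDERIV f x :> R x) \<and> (\<forall>b. bump_algebra (\<lambda>x. R x \<bullet> b))"
  using assms
proof induction
  case (const c)
  then show ?case by (intro exI[of _ "\<lambda>x. 0"]) (auto simp: GDERIV_const_zero bump_algebra.const)
next
  case (coord b)
  show ?case by (intro exI[of _ "\<lambda>x. b"]) (auto simp: gderiv_def bump_algebra.const intro!: derivative_eq_intros)
next
  case (bump m r)
  define R where "R x = (- real m * flat_exp (Suc m) (1 - r * (x \<bullet> x)) + flat_exp (Suc (Suc m)) (1 - r * (x \<bullet> x))) *\<^sub>R ((- 2 * r) *\<^sub>R x)" for x :: 'a
  have "GDERIV (\<lambda>x. 1 - r * (x \<bullet> x)) x :> (- 2 * r) *\<^sub>R x" for x :: 'a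
    unfolding gderiv_def by (auto intro!: derivative_eq_intros simp: inner_commute)
  from GDERIV_DERIV_compose[OF this flat_exp_deriv]
  have "GDERIV (\<lambda>x. flat_exp m (1 - r * (x \<bullet> x))) x :> R x" for x :: 'a by (simp add: R_def)
  moreover have "bump_algebra (\<lambda>x. R x \<bullet> b)" for b
  proof -
    have "bump_algebra (\<lambda>x::'a. (- real m * flat_exp (Suc m) (1 - r * (x \<bullet> x)) + flat_exp (Suc (Suc m)) (1 - r * (x \<bullet> x))) * ((- 2 * r) * (x \<bullet> b)))"
      by (intro bump_algebra.intros)
    then show ?thesis by (simp add: R_def mult.assoc)
  qed
  ultimately show ?case by blast
next
  case (add f g)
  then obtain R S where "\<And>x. GDERIV f x :> R x" "\<And>b. bump_algebra (\<lambda>x. R x \<bullet> b)"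
    "\<And>x. GDERIV g x :> S x" "\<And>b. bump_algebra (\<lambda>x. S x \<bullet> b)" by blast
  then show ?case by (intro exI[of _ "\<lambda>x. R x + S x"]) (auto intro: GDERIV_add bump_algebra.add simp: inner_add_left)
next
  case (mult f g)
  then obtain R S where RS: "\<And>x. GDERIV f x :> R x" "\<And>b. bump_algebra (\<lambda>x. R x \<bullet> b)"
    "\<And>x. GDERIV g x :> S x" "\<And>b. bump_algebra (\<lambda>x. S x \<bullet> b)" by blast
  then have "bump_algebra (\<lambda>x. f x * (S x \<bullet> b) + g x * (R x \<bullet> b))" for b
    using mult by (intro bump_algebra.add bump_algebra.mult) auto
  then show ?case using GDERIV_mult[OF RS(1,3)]
    by (intro exI[of _ "\<lambda>x. f x *\<^sub>R S x + g x *\<^sub>R R x"]) (auto simp: inner_add_left)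
qed

section \<open>Convolution and uniform approximation by smooth functions\<close>

lemma bump_algebra_continuous: "bump_algebra f \<Longrightarrow> continuous_on S f"
  using bump_algebra_gradient[of f] GDERIV_continuous_on by blast

definition convol :: "('a::euclidean_space \<Rightarrow> real) \<Rightarrow> ('a \<Rightarrow> real) \<Rightarrow> 'a \<Rightarrow> real" where
  "convol \<rho> \<phi> x = (LBINT z. \<rho> (x - z) * \<phi> z)"

lemma convol_integrable:
  fixes \<rho> \<phi> :: "'a::euclidean_space \<Rightarrow> real"
  assumes "continuous_on UNIV \<rho>" "continuous_on UNIV \<phi>" "compact K" "\<And>x. x \<notin> K \<Longrightarrow> \<phi> x = 0"
  shows "integrable lborel (\<lambda>z. \<rho> (x - z) * \<phi> z)"
  by (rule integrable_continuous_compact_support[OF _ assms(3)])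
    (auto intro!: continuous_intros assms(2) continuous_on_compose2[OF assms(1)] simp: assms(4))

text \<open>The support of \<open>\<phi>\<close> lies in a box, on which the Lebesgue integral
  agrees with the gauge integral, and Leibniz' rule differentiates under the integral sign. All
  derivatives fall on the kernel, so continuity of \<open>\<phi>\<close> suffices.\<close>

lemma convol_deriv:
  fixes \<rho> \<phi> :: "'a::euclidean_space \<Rightarrow> real"
  assumes \<rho>: "\<And>x. GDERIV \<rho> x :> R x" "continuous_on UNIV R"
    and \<phi>: "continuous_on UNIV \<phi>" "compact K" "\<And>x. x \<notin> K \<Longrightarrow> \<phi> x = 0"
  shows "GDERIV (convol \<rho> \<phi>) x :> (\<Sum>b\<in>Basis. convol (\<lambda>x. R x \<bullet> b) \<phi> x *\<^sub>R b)"
proof -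
  obtain a where a: "K \<subseteq> cbox (-a) a" using bounded_subset_cbox_symmetric[OF compact_imp_bounded[OF \<phi>(2)]] by blast
  have \<rho>c: "continuous_on UNIV \<rho>" using \<rho>(1) by (rule GDERIV_continuous_on)
  have conv: "convol r \<phi> x = integral (cbox (-a) a) (\<lambda>z. r (x - z) * \<phi> z)" if "continuous_on UNIV r" for r x
  proof -
    have c: "continuous_on (cbox (-a) a) (\<lambda>z. r (x - z) * \<phi> z)"
      by (intro continuous_intros continuous_on_subset[OF \<phi>(1)] continuous_on_compose2[OF that]) auto
    have "set_integrable lborel (cbox (-a) a) (\<lambda>z. r (x - z) * \<phi> z)"
      unfolding set_integrable_def by (intro borel_integrable_compact compact_cbox c)
    from set_borel_integral_eq_integral(2)[OF this]
    have "integral (cbox (-a) a) (\<lambda>z. r (x - z) * \<phi> z) = (LBINT z. indicator (cbox (-a) a) z *\<^sub>R (r (x - z) * \<phi> z))"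
      by (simp add: set_lebesgue_integral_def)
    also have "(\<lambda>z. indicator (cbox (-a) a) z *\<^sub>R (r (x - z) * \<phi> z)) = (\<lambda>z. r (x - z) * \<phi> z)"
    proof
      fix z show "indicator (cbox (-a) a) z *\<^sub>R (r (x - z) * \<phi> z) = r (x - z) * \<phi> z"
        using a \<phi>(3)[of z] by (cases "z \<in> K") (auto simp: indicator_def)
    qed
    finally show ?thesis by (simp add: convol_def)
  qed
  define fx where "fx x t = \<phi> t *\<^sub>R blinfun_inner_left (R (x - t))" for x t
  have Rc: "continuous_on S (\<lambda>p. R (fst p - snd p))" for S
    by (intro continuous_on_compose2[OF \<rho>(2)] continuous_intros) auto
  have fxc: "continuous_on (UNIV \<times> cbox (-a) a) (\<lambda>(x, t). fx x t)"
    unfolding fx_def case_prod_unfold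
    by (intro continuous_intros continuous_on_compose2[OF \<phi>(1)] bounded_linear.continuous_on[OF bounded_linear_blinfun_inner_left] Rc) auto
  have fxi: "fx x integrable_on cbox (-a) a"
  proof (rule integrable_continuous)
    have "continuous_on (cbox (-a) a) (\<lambda>t. (x, t))" by (intro continuous_intros)
    from continuous_on_compose2[OF fxc this] show "continuous_on (cbox (-a) a) (fx x)" by auto
  qed
  have "((\<lambda>x. integral (cbox (-a) a) (\<lambda>t. \<rho> (x - t) * \<phi> t)) has_derivative integral (cbox (-a) a) (fx x)) (at x within UNIV)"
  proof (rule leibniz_rule[OF _ _ fxc])
    fix x t
    have "GDERIV (\<lambda>x. \<rho> (x - t)) x :> R (x - t)" using GDERIV_translate[of \<rho> x "- t" "R (x - t)"] \<rho>(1) by simp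
    then have "((\<lambda>x. \<phi> t * \<rho> (x - t)) has_derivative (\<lambda>v. \<phi> t * (v \<bullet> R (x - t)))) (at x)"
      unfolding gderiv_def by (intro has_derivative_mult_right)
    then show "((\<lambda>x. \<rho> (x - t) * \<phi> t) has_derivative blinfun_apply (fx x t)) (at x within UNIV)"
      by (simp add: fx_def scaleR_blinfun.rep_eq mult.commute)
  next
    fix x show "(\<lambda>t. \<rho> (x - t) * \<phi> t) integrable_on cbox (-a) a"
      by (intro integrable_continuous continuous_intros continuous_on_subset[OF \<phi>(1)] continuous_on_compose2[OF \<rho>c]) auto
  qed auto
  then have "(convol \<rho> \<phi> has_derivative integral (cbox (-a) a) (fx x)) (at x)"
    using conv[OF \<rho>c] by (simp add: convol_def[abs_def])
  moreover have "blinfun_apply (integral (cbox (-a) a) (fx x)) v = v \<bullet> (\<Sum>b\<in>Basis. convol (\<lambda>x. R x \<bullet> b) \<phi> x *\<^sub>R b)" for v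
  proof -
    have e: "blinfun_apply (integral (cbox (-a) a) (fx x)) b = convol (\<lambda>x. R x \<bullet> b) \<phi> x" for b
    proof -
      have "blinfun_apply (integral (cbox (-a) a) (fx x)) b = integral (cbox (-a) a) (\<lambda>t. (R (x - t) \<bullet> b) * \<phi> t)"
        by (subst blinfun_apply_integral[OF fxi]) (simp add: fx_def scaleR_blinfun.rep_eq mult.commute inner_commute)
      also have "\<dots> = convol (\<lambda>x. R x \<bullet> b) \<phi> x"
        by (rule conv[symmetric]) (intro continuous_intros \<rho>(2))
      finally show ?thesis .
    qed
    have "blinfun_apply (integral (cbox (-a) a) (fx x)) (\<Sum>b\<in>Basis. (v \<bullet> b) *\<^sub>R b) = (\<Sum>b\<in>Basis. (v \<bullet> b) * convol (\<lambda>x. R x \<bullet> b) \<phi> x)"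
      by (simp add: blinfun.sum_right blinfun.scaleR_right e)
    then show ?thesis by (simp add: euclidean_representation inner_sum_right mult.commute)
  qed
  then have "blinfun_apply (integral (cbox (-a) a) (fx x)) = (\<lambda>v. v \<bullet> (\<Sum>b\<in>Basis. convol (\<lambda>x. R x \<bullet> b) \<phi> x *\<^sub>R b))"
    by (rule ext)
  ultimately show ?thesis unfolding gderiv_def by (simp only:)
qed

text \<open>A partial derivative of a convolution is the convolution with a partial derivative of
  the kernel. The latter is again in the class, so the induction has to run over all kernels
  simultaneously.\<close>

lemma convol_C_k:
  fixes \<rho> \<phi> :: "'a::euclidean_space \<Rightarrow> real"
  assumes \<phi>: "continuous_on UNIV \<phi>" "compact K" "\<And>x. x \<notin> K \<Longrightarrow> \<phi> x = 0"
  shows "bump_algebra \<rho> \<Longrightarrow> C_k k (convol \<rho> \<phi>)"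
proof (induction k arbitrary: \<rho>)
  case (0 \<rho>)
  then obtain R where R: "\<And>x. GDERIV \<rho> x :> R x" "\<And>b. bump_algebra (\<lambda>x. R x \<bullet> b)" using bump_algebra_gradient by blast
  have "continuous_on UNIV R"
    unfolding continuous_on_componentwise[of UNIV R] using bump_algebra_continuous[OF R(2)] by blast
  from convol_deriv[OF R(1) this \<phi>] have "continuous_on UNIV (convol \<rho> \<phi>)" by (rule GDERIV_continuous_on)
  then show ?case by simp
next
  case (Suc k)
  then obtain R where R: "\<And>x. GDERIV \<rho> x :> R x" "\<And>b. bump_algebra (\<lambda>x. R x \<bullet> b)" using bump_algebra_gradient by blast
  have "continuous_on UNIV R"
    unfolding continuous_on_componentwise[of UNIV R] using bump_algebra_continuous[OF R(2)] by blast
  note d = convol_deriv[OF R(1) this \<phi>]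
  have "frechet_derivative (convol \<rho> \<phi>) (at x) = (\<lambda>v. v \<bullet> (\<Sum>b\<in>Basis. convol (\<lambda>x. R x \<bullet> b) \<phi> x *\<^sub>R b))" for x
    using frechet_derivative_at[OF d[of x, unfolded gderiv_def]] by (rule sym)
  then have "frechet_derivative (convol \<rho> \<phi>) (at x) b = convol (\<lambda>x. R x \<bullet> b) \<phi> x" if "b \<in> Basis" for x b
    using that inner_sum_left_Basis[OF that, of "\<lambda>b. convol (\<lambda>x. R x \<bullet> b) \<phi> x"] by (simp add: inner_commute[of b])
  moreover have "convol \<rho> \<phi> differentiable at x" for x using d[of x] unfolding gderiv_def differentiable_def by blast
  ultimately show ?case using Suc.IH[OF R(2)] by simp
qed

definition mollifier :: "real \<Rightarrow> 'a::euclidean_space \<Rightarrow> real" where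
  "mollifier \<eta> x = flat_exp 0 (1 - inverse (\<eta>\<^sup>2) * (x \<bullet> x)) / (LBINT x::'a. flat_exp 0 (1 - inverse (\<eta>\<^sup>2) * (x \<bullet> x)))"

lemma mollifier_properties:
  assumes "0 < \<eta>"
  shows "bump_algebra (mollifier \<eta> :: 'a::euclidean_space \<Rightarrow> real)"
    and "0 \<le> mollifier \<eta> (x::'a)"
    and "x \<notin> cball 0 \<eta> \<Longrightarrow> mollifier \<eta> (x::'a) = 0"
    and "mollifier \<eta> (- x) = mollifier \<eta> x"
    and "integral\<^sup>L lborel (mollifier \<eta> :: 'a \<Rightarrow> real) = 1"
    and "integrable lborel (mollifier \<eta> :: 'a \<Rightarrow> real)"
proof -
  define e where "e x = flat_exp 0 (1 - inverse (\<eta>\<^sup>2) * (x \<bullet> x))" for x :: 'a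
  define c where "c = integral\<^sup>L lborel e"
  have m: "mollifier \<eta> = (\<lambda>x. inverse c * e x)" by (auto simp: mollifier_def e_def[abs_def] c_def divide_inverse mult.commute)
  have be: "bump_algebra e" unfolding e_def[abs_def] by (rule bump_algebra.bump)
  have en: "0 \<le> e x" for x by (simp add: e_def flat_exp_def)
  have e0: "e x = 0" if "x \<notin> cball 0 \<eta>" for x
  proof -
    have "\<eta>\<^sup>2 < (norm x)\<^sup>2" using that assms by (intro power_strict_mono) auto
    then have "1 - inverse (\<eta>\<^sup>2) * (x \<bullet> x) < 0" using assms by (simp add: power2_norm_eq_inner field_simps)
    then show ?thesis by (simp add: e_def flat_exp_def)
  qed
  have ec: "continuous_on UNIV e" by (rule bump_algebra_continuous[OF be])
  have ei: "integrable lborel e" by (rule integrable_continuous_compact_support[OF ec compact_cball e0])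
  \<comment> \<open>Were the integral zero, the bump would vanish almost everywhere; but it is
    positive on an open set containing the origin, and such a set is not negligible.\<close>
  have "0 < c"
  proof (rule ccontr)
    assume "\<not> 0 < c"
    moreover have "0 \<le> c" unfolding c_def by (rule Bochner_Integration.integral_nonneg) (rule en)
    ultimately have "integral\<^sup>L lborel e = 0" by (simp add: c_def)
    then have "AE x in lborel. e x = 0" using integral_nonneg_eq_0_iff_AE[OF ei] en by simp
    then have ae: "AE x in lborel. x \<notin> {x. 0 < e x}" by eventually_elim simp
    have op: "open {x. 0 < e x}" by (intro open_Collect_less continuous_intros ec)
    have "emeasure lborel {x. 0 < e x} = 0" using AE_iff_measurable[of "{x. 0 < e x}" lborel "\<lambda>x. x \<notin> {x. 0 < e x}"] ae op by auto
    then have "{x. 0 < e x} \<in> null_sets lborel" using op by (simp add: null_sets_def)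
    then have "negligible {x. 0 < e x}" by (simp add: negligible_iff_null_sets null_sets_completionI)
    moreover have "0 \<in> {x. 0 < e x}" by (simp add: e_def flat_exp_def)
    ultimately show False using open_not_negligible[OF op] by blast
  qed
  note c = this
  show "bump_algebra (mollifier \<eta> :: 'a \<Rightarrow> real)" unfolding m by (intro bump_algebra.mult bump_algebra.const be)
  show "0 \<le> mollifier \<eta> x" unfolding m using c en by simp
  show "x \<notin> cball 0 \<eta> \<Longrightarrow> mollifier \<eta> x = 0" unfolding m using e0 by simp
  show "mollifier \<eta> (- x) = mollifier \<eta> x" unfolding m by (simp add: e_def)
  show "integral\<^sup>L lborel (mollifier \<eta> :: 'a \<Rightarrow> real) = 1" unfolding m using c by (simp add: c_def)
  show "integrable lborel (mollifier \<eta> :: 'a \<Rightarrow> real)" unfolding m using ei by auto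
qed

text \<open>Of two points at distance below 1, either both lie in the compact neighbourhood of
  \<open>K\<close> of radius 1, or both lie outside \<open>K\<close>, where the function is
  zero.\<close>

lemma uniformly_continuous_compact_support:
  fixes f :: "'a::euclidean_space \<Rightarrow> 'b::real_normed_vector"
  assumes "continuous_on UNIV f" "compact K" "\<And>x. x \<notin> K \<Longrightarrow> f x = 0"
  shows "uniformly_continuous_on UNIV f"
proof -
  define K' where "K' = (\<Union>x\<in>K. cball x 1)"
  have "K' = {x + y | x y. x \<in> K \<and> y \<in> cball 0 1}"
    unfolding K'_def by (auto simp: dist_norm) (metis add.commute diff_add_cancel norm_minus_commute)
  then have "compact K'" using compact_sums[OF assms(2) compact_cball[of 0 1]] by simp
  then have u: "uniformly_continuous_on K' f"
    by (intro compact_uniformly_continuous continuous_on_subset[OF assms(1)]) auto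
  show ?thesis unfolding uniformly_continuous_on_def
  proof (intro allI impI)
    fix e :: real assume e: "0 < e"
    obtain d where d: "0 < d" "\<And>x x'. x \<in> K' \<Longrightarrow> x' \<in> K' \<Longrightarrow> dist x' x < d \<Longrightarrow> dist (f x') (f x) < e"
      using u e unfolding uniformly_continuous_on_def by meson
    show "\<exists>d>0. \<forall>x\<in>UNIV. \<forall>x'\<in>UNIV. dist x' x < d \<longrightarrow> dist (f x') (f x) < e"
    proof (intro exI[of _ "min d 1"] conjI ballI impI)
      fix x x' :: 'a assume dx: "dist x' x < min d 1"
      show "dist (f x') (f x) < e"
      proof (cases "x \<in> K \<or> x' \<in> K")
        case True
        then have "x \<in> K' \<and> x' \<in> K'" unfolding K'_def using dx
          by (auto intro: bexI[of _ x] bexI[of _ x'] simp: dist_commute)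
        then show ?thesis using d(2) dx by auto
      next
        case False
        then show ?thesis using assms(3) e by simp
      qed
    qed (use d in auto)
  qed
qed

lemma mollifier_approx:
  fixes \<phi> :: "'a::euclidean_space \<Rightarrow> real"
  assumes \<phi>: "continuous_on UNIV \<phi>" "compact K" "\<And>x. x \<notin> K \<Longrightarrow> \<phi> x = 0" and "0 < \<epsilon>"
  obtains \<eta>0 where "0 < \<eta>0" "\<And>\<eta> x. 0 < \<eta> \<Longrightarrow> \<eta> < \<eta>0 \<Longrightarrow> \<bar>convol (mollifier \<eta>) \<phi> x - \<phi> x\<bar> \<le> \<epsilon>"
proof -
  have "uniformly_continuous_on UNIV \<phi>" by (rule uniformly_continuous_compact_support[OF \<phi>])
  then obtain \<eta>0 where e0: "0 < \<eta>0" "\<And>x x'. dist x' x < \<eta>0 \<Longrightarrow> dist (\<phi> x') (\<phi> x) < \<epsilon>"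
    using assms(4) unfolding uniformly_continuous_on_def by (metis UNIV_I)
  show thesis
  proof (rule that[OF e0(1)])
    fix \<eta> :: real and x :: 'a assume \<eta>: "0 < \<eta>" "\<eta> < \<eta>0"
    note m = mollifier_properties[OF \<eta>(1), where 'a='a]
    have mc: "continuous_on UNIV (mollifier \<eta> :: 'a \<Rightarrow> real)" by (rule bump_algebra_continuous[OF m(1)])
    have [measurable]: "(mollifier \<eta> :: 'a \<Rightarrow> real) \<in> borel_measurable borel" using mc by (rule borel_measurable_continuous_onI)
    have sym: "mollifier \<eta> (x - z) = mollifier \<eta> (z + (- x))" for z using m(4)[of "z - x"] by simp
    have i1: "integrable lborel (\<lambda>z. mollifier \<eta> (x - z))"
      unfolding sym by (rule lborel_integrable_translate[OF m(6)])
    have v1: "(LBINT z. mollifier \<eta> (x - z)) = 1"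
      unfolding sym by (subst lborel_integral_translate) (auto simp: m(5))
    have i2: "integrable lborel (\<lambda>z. mollifier \<eta> (x - z) * \<phi> z)" by (rule convol_integrable[OF mc \<phi>])
    have "convol (mollifier \<eta>) \<phi> x - \<phi> x = (LBINT z. mollifier \<eta> (x - z) * \<phi> z - mollifier \<eta> (x - z) * \<phi> x)"
      using i1 i2 v1 by (simp add: convol_def)
    also have "\<bar>\<dots>\<bar> \<le> (LBINT z. \<bar>mollifier \<eta> (x - z) * \<phi> z - mollifier \<eta> (x - z) * \<phi> x\<bar>)"
      by (rule integral_abs_bound)
    also have "\<dots> \<le> (LBINT z. mollifier \<eta> (x - z) * \<epsilon>)"
    proof (rule integral_mono)
      fix z
      have "\<bar>mollifier \<eta> (x - z) * \<phi> z - mollifier \<eta> (x - z) * \<phi> x\<bar> = mollifier \<eta> (x - z) * \<bar>\<phi> z - \<phi> x\<bar>"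
        using m(2)[of "x - z"] by (simp add: right_diff_distrib[symmetric] abs_mult)
      also have "\<dots> \<le> mollifier \<eta> (x - z) * \<epsilon>"
      proof (cases "x - z \<in> cball 0 \<eta>")
        case True
        then have "dist z x < \<eta>0" using \<eta> by (simp add: dist_norm norm_minus_commute)
        then have "\<bar>\<phi> z - \<phi> x\<bar> \<le> \<epsilon>" using e0(2)[of z x] by (simp add: dist_real_def)
        then show ?thesis using m(2) by (intro mult_left_mono)
      qed (simp add: m(3))
      finally show "\<bar>mollifier \<eta> (x - z) * \<phi> z - mollifier \<eta> (x - z) * \<phi> x\<bar> \<le> mollifier \<eta> (x - z) * \<epsilon>" .
    qed (use i1 i2 in auto)
    also have "\<dots> = \<epsilon>" using i1 v1 by simp
    finally show "\<bar>convol (mollifier \<eta>) \<phi> x - \<phi> x\<bar> \<le> \<epsilon>" .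
  qed
qed

lemma mollifier_support:
  fixes \<phi> :: "'a::euclidean_space \<Rightarrow> real"
  assumes "0 < \<eta>" "\<And>x. x \<notin> K \<Longrightarrow> \<phi> x = 0" "x \<notin> (\<Union>x\<in>K. cball x \<eta>)"
  shows "convol (mollifier \<eta>) \<phi> x = 0"
proof -
  have "mollifier \<eta> (x - z) * \<phi> z = 0" for z
  proof (cases "z \<in> K")
    case True
    then have "x - z \<notin> cball 0 \<eta>" using assms(3) by (auto simp: dist_norm norm_minus_commute)
    then have "mollifier \<eta> (x - z) = 0" by (rule mollifier_properties(3)[OF assms(1)])
    then show ?thesis by simp
  qed (simp add: assms(2))
  then show ?thesis unfolding convol_def by (simp only: integral_zero)
qed

text \<open>Integration by parts moves the derivative from the kernel to \<open>\<phi>\<close>; the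
  minus sign it produces cancels the one from the reflected argument x - z.\<close>

lemma convol_gradient_mollifier:
  fixes \<phi> :: "'a::euclidean_space \<Rightarrow> real"
  assumes \<phi>: "C1c U \<phi> D" and \<eta>: "0 < \<eta>"
  shows "GDERIV (convol (mollifier \<eta>) \<phi>) x :> (\<Sum>b\<in>Basis. convol (mollifier \<eta>) (\<lambda>x. D x \<bullet> b) x *\<^sub>R b)"
proof -
  obtain K where K: "compact K" "\<And>x. x \<notin> K \<Longrightarrow> \<phi> x = 0" using \<phi> by (rule C1c_support) blast
  obtain R :: "'a \<Rightarrow> 'a" where R: "\<And>x. GDERIV (mollifier \<eta>) x :> R x" "\<And>b. bump_algebra (\<lambda>x. R x \<bullet> b)"
    using bump_algebra_gradient[OF mollifier_properties(1)[OF \<eta>]] by blast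
  have Rc: "continuous_on UNIV R"
    unfolding continuous_on_componentwise[of UNIV R] using bump_algebra_continuous[OF R(2)] by blast
  have "convol (\<lambda>x. R x \<bullet> b) \<phi> x = convol (mollifier \<eta>) (\<lambda>x. D x \<bullet> b) x" if b: "b \<in> Basis" for b
  proof -
    have "GDERIV (\<lambda>z. mollifier \<eta> (x - z)) z :> - R (x - z)" for z
    proof -
      have "((\<lambda>z. mollifier \<eta> (x - z)) has_derivative (\<lambda>v. (- v) \<bullet> R (x - z))) (at z)"
        by (rule has_derivative_compose[of "\<lambda>z. x - z" uminus z UNIV "mollifier \<eta>" "\<lambda>v. v \<bullet> R (x - z)"])
          (use R(1) in \<open>auto simp: gderiv_def intro!: derivative_eq_intros\<close>)
      then show ?thesis by (simp add: gderiv_def)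
    qed
    moreover have "continuous_on UNIV (\<lambda>z. - R (x - z))" by (intro continuous_intros continuous_on_compose2[OF Rc]) auto
    moreover have "C1c UNIV \<phi> D" using \<phi> by (rule C1c_mono) auto
    ultimately have "(LBINT z. mollifier \<eta> (x - z) * (D z \<bullet> b)) = - (LBINT z. \<phi> z * (- R (x - z) \<bullet> b))"
      using b by (intro C1c_integration_by_parts(1)[where U=UNIV]) auto
    then show ?thesis by (simp add: convol_def mult.commute)
  qed
  then show ?thesis using convol_deriv[OF R(1) Rc C1c_D(3)[OF \<phi>] K, of x] by simp
qed

section \<open>Sobolev test functions and weak gradients\<close>

lemma gradient_eq: "GDERIV f x :> D \<Longrightarrow> gradient f x = D"
  unfolding gradient_def using GDERIV_unique' by blast

lemma smooth_GDERIV: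
  fixes f :: "'a::euclidean_space \<Rightarrow> real"
  assumes "smooth f"
  shows "GDERIV f x :> gradient f x" "continuous_on UNIV (gradient f)"
proof -
  have s: "C_k (Suc 0) f" using assms by (simp only: smooth_def)
  define D where "D x = (\<Sum>b\<in>Basis. frechet_derivative f (at x) b *\<^sub>R b)" for x
  have D: "GDERIV f x :> D x" for x
  proof -
    have "(f has_derivative frechet_derivative f (at x)) (at x)"
      using s by (simp add: frechet_derivative_works)
    moreover from this interpret linear "frechet_derivative f (at x)" by (rule has_derivative_linear)
    have "frechet_derivative f (at x) v = v \<bullet> D x" for v
    proof -
      have "frechet_derivative f (at x) (\<Sum>b\<in>Basis. (v \<bullet> b) *\<^sub>R b) = v \<bullet> D x"
        by (simp add: sum scale D_def inner_sum_right mult.commute)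
      then show ?thesis by (simp add: euclidean_representation)
    qed
    then have "frechet_derivative f (at x) = (\<lambda>v. v \<bullet> D x)" by (rule ext)
    ultimately show ?thesis by (simp add: gderiv_def)
  qed
  then have g: "gradient f = D" using gradient_eq by blast
  show "GDERIV f x :> gradient f x" using D g by simp
  show "continuous_on UNIV (gradient f)" unfolding g D_def[abs_def] using s by (intro continuous_intros) auto
qed

lemma test_functions_C1c:
  assumes "\<psi> \<in> test_functions U" shows "C1c U \<psi> (gradient \<psi>)"
proof -
  have t: "smooth \<psi>" "compact (closure {x. \<psi> x \<noteq> 0})" "closure {x. \<psi> x \<noteq> 0} \<subseteq> U"
    using assms by (auto simp: test_functions_def)
  show ?thesis
    by (rule C1cI[OF smooth_GDERIV[OF t(1)] t(2,3)]) (use closure_subset[of "{x. \<psi> x \<noteq> 0}"] in auto)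
qed

lemma test_functionsI:
  assumes "smooth \<psi>" "compact K" "K \<subseteq> U" "\<And>x. x \<notin> K \<Longrightarrow> \<psi> x = 0"
  shows "\<psi> \<in> test_functions U"
proof -
  have "closure {x. \<psi> x \<noteq> 0} \<subseteq> K" using assms(4) by (intro closure_minimal compact_imp_closed assms) auto
  moreover have "compact (closure {x. \<psi> x \<noteq> 0})"
    using compact_Int_closed[OF assms(2), of "closure {x. \<psi> x \<noteq> 0}"] calculation by (simp add: Int_absorb1)
  ultimately show ?thesis using assms by (auto simp: test_functions_def)
qed

lemma compact_neighbourhood:
  fixes K :: "'a::euclidean_space set"
  assumes "compact K" "K \<subseteq> U" "open U"
  obtains r where "0 < r" "compact (\<Union>x\<in>K. cball x r)" "(\<Union>x\<in>K. cball x r) \<subseteq> U" "K \<subseteq> (\<Union>x\<in>K. cball x r)"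
proof -
  obtain r where r: "0 < r" "(\<Union>x\<in>K. cball x r) \<subseteq> U"
    using compact_subset_open_imp_cball_epsilon_subset[OF assms(1,3,2)] by blast
  have "(\<Union>x\<in>K. cball x r) = {x + y | x y. x \<in> K \<and> y \<in> cball 0 r}"
    by (auto simp: dist_norm) (metis add.commute diff_add_cancel norm_minus_commute)
  then have "compact (\<Union>x\<in>K. cball x r)" using compact_sums[OF assms(1) compact_cball[of 0 r]] by simp
  moreover have "K \<subseteq> (\<Union>x\<in>K. cball x r)"
  proof
    fix x assume "x \<in> K" then show "x \<in> (\<Union>x\<in>K. cball x r)" using r(1) by (intro UN_I[of x]) auto
  qed
  ultimately show thesis using that r by blast
qed

text \<open>The compact set \<open>K'\<close> is the same for all functions and all accuracies. A
  common support is what turns uniform approximation into convergence in L^p and supplies a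
  dominating function.\<close>

lemma test_function_approx_continuous:
  fixes K :: "'a::euclidean_space set"
  assumes "compact K" "K \<subseteq> U" "open U"
  obtains K' where "compact K'" "K' \<subseteq> U" "K \<subseteq> K'"
    "\<And>\<phi> \<epsilon>. continuous_on UNIV \<phi> \<Longrightarrow> (\<And>x. x \<notin> K \<Longrightarrow> \<phi> x = 0) \<Longrightarrow> 0 < \<epsilon> \<Longrightarrow>
       \<exists>\<psi>\<in>test_functions U. \<forall>x. \<bar>\<psi> x - \<phi> x\<bar> \<le> \<epsilon> \<and> (x \<notin> K' \<longrightarrow> \<psi> x = 0)"
    "\<And>\<phi> D \<epsilon>. C1c K \<phi> D \<Longrightarrow> 0 < \<epsilon> \<Longrightarrow>
       \<exists>\<psi>\<in>test_functions U. \<forall>x. \<bar>\<psi> x - \<phi> x\<bar> \<le> \<epsilon> \<and> norm (gradient \<psi> x - D x) \<le> \<epsilon> \<and> (x \<notin> K' \<longrightarrow> \<psi> x = 0 \<and> gradient \<psi> x = 0)"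
proof -
  obtain r where r: "0 < r" "compact (\<Union>x\<in>K. cball x r)" "(\<Union>x\<in>K. cball x r) \<subseteq> U" "K \<subseteq> (\<Union>x\<in>K. cball x r)"
    using compact_neighbourhood[OF assms] by blast
  have supp: "convol (mollifier \<eta>) \<phi> x = 0" if "0 < \<eta>" "\<eta> < r" "\<And>x. x \<notin> K \<Longrightarrow> \<phi> x = 0" "x \<notin> (\<Union>x\<in>K. cball x r)" for \<eta> \<phi> x
    by (rule mollifier_support[OF that(1), of K]) (use that in fastforce)+
  have test: "convol (mollifier \<eta>) \<phi> \<in> test_functions U"
    if "0 < \<eta>" "\<eta> < r" "continuous_on UNIV \<phi>" "\<And>x. x \<notin> K \<Longrightarrow> \<phi> x = 0" for \<eta> \<phi>
  proof (rule test_functionsI[OF _ r(2,3)])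
    show "smooth (convol (mollifier \<eta>) \<phi>)"
      unfolding smooth_def using convol_C_k[OF that(3) assms(1) that(4) mollifier_properties(1)[OF that(1)]] by blast
  qed (rule supp, use that in auto)
  show thesis
  proof (rule that[OF r(2,3,4)])
    fix \<phi> :: "'a \<Rightarrow> real" and \<epsilon> :: real
    assume \<phi>: "continuous_on UNIV \<phi>" "\<And>x. x \<notin> K \<Longrightarrow> \<phi> x = 0" and \<epsilon>: "0 < \<epsilon>"
    obtain \<eta>0 where e0: "0 < \<eta>0" "\<And>\<eta> x. 0 < \<eta> \<Longrightarrow> \<eta> < \<eta>0 \<Longrightarrow> \<bar>convol (mollifier \<eta>) \<phi> x - \<phi> x\<bar> \<le> \<epsilon>"
      by (rule mollifier_approx[OF \<phi>(1) assms(1) \<phi>(2) \<epsilon>]) auto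
    have "0 < min \<eta>0 r" using e0 r by simp
    then obtain \<eta> where \<eta>: "0 < \<eta>" "\<eta> < \<eta>0" "\<eta> < r" using dense[of 0 "min \<eta>0 r"] by auto
    show "\<exists>\<psi>\<in>test_functions U. \<forall>x. \<bar>\<psi> x - \<phi> x\<bar> \<le> \<epsilon> \<and> (x \<notin> (\<Union>x\<in>K. cball x r) \<longrightarrow> \<psi> x = 0)"
    proof (rule bexI[OF _ test[OF \<eta>(1,3) \<phi>]], intro allI conjI impI)
      fix x show "\<bar>convol (mollifier \<eta>) \<phi> x - \<phi> x\<bar> \<le> \<epsilon>" by (rule e0(2)[OF \<eta>(1,2)])
      assume x: "x \<notin> (\<Union>x\<in>K. cball x r)"
      show "convol (mollifier \<eta>) \<phi> x = 0" by (rule supp[OF \<eta>(1,3) \<phi>(2) x])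
    qed
  next
    fix \<phi> :: "'a \<Rightarrow> real" and D and \<epsilon> :: real
    assume C: "C1c K \<phi> D" and \<epsilon>: "0 < \<epsilon>"
    obtain K0 where K0: "K0 \<subseteq> K" "\<And>x. x \<notin> K0 \<Longrightarrow> \<phi> x = 0" "\<And>x. x \<notin> K0 \<Longrightarrow> D x = 0"
      using C by (rule C1c_support) blast
    have \<phi>: "continuous_on UNIV \<phi>" "\<And>x. x \<notin> K \<Longrightarrow> \<phi> x = 0" using C1c_D(3)[OF C] K0 by blast+
    have Db: "continuous_on UNIV (\<lambda>x. D x \<bullet> b)" "\<And>x. x \<notin> K \<Longrightarrow> D x \<bullet> b = 0" for b
    proof -
      show "continuous_on UNIV (\<lambda>x. D x \<bullet> b)" using C1c_D(2)[OF C] by (intro continuous_intros)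
      fix x assume "x \<notin> K" then have "D x = 0" using K0 by blast
      then show "D x \<bullet> b = 0" by simp
    qed
    define \<epsilon>' where "\<epsilon>' = \<epsilon> / real DIM('a)"
    have e': "0 < \<epsilon>'" "real DIM('a) * \<epsilon>' = \<epsilon>" using \<epsilon> by (auto simp: \<epsilon>'_def)
    obtain \<eta>0 where e0: "0 < \<eta>0" "\<And>\<eta> x. 0 < \<eta> \<Longrightarrow> \<eta> < \<eta>0 \<Longrightarrow> \<bar>convol (mollifier \<eta>) \<phi> x - \<phi> x\<bar> \<le> \<epsilon>"
      by (rule mollifier_approx[OF \<phi>(1) assms(1) \<phi>(2) \<epsilon>]) auto
    have "\<exists>\<eta>1>0. \<forall>\<eta> x. 0 < \<eta> \<and> \<eta> < \<eta>1 \<longrightarrow> \<bar>convol (mollifier \<eta>) (\<lambda>x. D x \<bullet> b) x - D x \<bullet> b\<bar> \<le> \<epsilon>'" for b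
      by (rule mollifier_approx[OF Db(1) assms(1) Db(2) e'(1)]) auto
    then obtain \<eta>1 where e1: "\<And>b. 0 < \<eta>1 b" "\<And>b \<eta> x. 0 < \<eta> \<Longrightarrow> \<eta> < \<eta>1 b \<Longrightarrow> \<bar>convol (mollifier \<eta>) (\<lambda>x. D x \<bullet> b) x - D x \<bullet> b\<bar> \<le> \<epsilon>'"
      by metis
    define \<eta>2 where "\<eta>2 = Min (insert \<eta>0 (insert r (\<eta>1 ` Basis)))"
    have "0 < \<eta>2" unfolding \<eta>2_def using e0 e1 r by (subst Min_gr_iff) auto
    then obtain \<eta> where \<eta>': "0 < \<eta>" "\<eta> < \<eta>2" using dense by blast
    then have \<eta>: "0 < \<eta>" "\<eta> < \<eta>0" "\<eta> < r" "\<And>b. b \<in> Basis \<Longrightarrow> \<eta> < \<eta>1 b" by (auto simp: \<eta>2_def)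
    let ?\<psi> = "convol (mollifier \<eta>) \<phi>"
    have gr: "gradient ?\<psi> x = (\<Sum>b\<in>Basis. convol (mollifier \<eta>) (\<lambda>x. D x \<bullet> b) x *\<^sub>R b)" for x
      by (rule gradient_eq[OF convol_gradient_mollifier[OF C \<eta>(1)]])
    show "\<exists>\<psi>\<in>test_functions U. \<forall>x. \<bar>\<psi> x - \<phi> x\<bar> \<le> \<epsilon> \<and> norm (gradient \<psi> x - D x) \<le> \<epsilon> \<and> (x \<notin> (\<Union>x\<in>K. cball x r) \<longrightarrow> \<psi> x = 0 \<and> gradient \<psi> x = 0)"
    proof (rule bexI[OF _ test[OF \<eta>(1,3) \<phi>]], intro allI conjI impI)
      fix x
      show "\<bar>?\<psi> x - \<phi> x\<bar> \<le> \<epsilon>" by (rule e0(2)[OF \<eta>(1,2)])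
      have "norm (gradient ?\<psi> x - D x) \<le> (\<Sum>b\<in>Basis. \<bar>(gradient ?\<psi> x - D x) \<bullet> b\<bar>)" by (rule norm_le_l1)
      also have "\<dots> = (\<Sum>b\<in>Basis. \<bar>convol (mollifier \<eta>) (\<lambda>x. D x \<bullet> b) x - D x \<bullet> b\<bar>)"
        by (rule sum.cong[OF refl]) (simp add: inner_diff_left gr)
      also have "\<dots> \<le> real DIM('a) * \<epsilon>'" using e1(2)[OF \<eta>(1) \<eta>(4)] by (intro sum_bounded_above) auto
      finally show "norm (gradient ?\<psi> x - D x) \<le> \<epsilon>" using e' by simp
      assume x: "x \<notin> (\<Union>x\<in>K. cball x r)"
      show "?\<psi> x = 0" by (rule supp[OF \<eta>(1,3) \<phi>(2) x])
      show "gradient ?\<psi> x = 0" unfolding gr using supp[OF \<eta>(1,3) Db(2) x] by simp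
    qed
  qed
qed

lemma set_integral_lebesgue_eq_lborel:
  fixes f :: "'a::euclidean_space \<Rightarrow> 'b::euclidean_space"
  assumes "f \<in> borel_measurable borel" "\<And>x. x \<notin> S \<Longrightarrow> f x = 0"
  shows "(LINT x:S|lebesgue. f x) = integral\<^sup>L lborel f"
    and "integrable lborel f \<Longrightarrow> set_integrable lebesgue S f"
proof -
  have e: "(\<lambda>x. indicator S x *\<^sub>R f x) = f" using assms(2) by (auto simp: indicator_def)
  show "(LINT x:S|lebesgue. f x) = integral\<^sup>L lborel f"
    unfolding set_lebesgue_integral_def e using assms(1) by (intro integral_completion) simp
  show "integrable lborel f \<Longrightarrow> set_integrable lebesgue S f"
    unfolding set_integrable_def e using assms(1) by (subst integrable_completion) auto
qed

lemma C1c_weak_gradient: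
  assumes "C1c \<Omega> \<phi> D" "open \<Omega>"
  shows "has_weak_gradient \<Omega> \<phi> D"
  unfolding has_weak_gradient_def
proof (intro conjI ballI)
  have loc: "h \<in> L1_loc \<Omega>" if "continuous_on UNIV h" for h :: "'a \<Rightarrow> 'b::euclidean_space"
  proof -
    have "set_integrable lborel K h" if "compact K" for K
      unfolding set_integrable_def using that \<open>continuous_on UNIV h\<close> by (intro borel_integrable_compact) (auto intro: continuous_on_subset)
    then show ?thesis unfolding L1_loc_def set_integrable_def by (auto intro: integrable_completion[THEN iffD2] borel_measurable_integrable)
  qed
  show "\<phi> \<in> L1_loc \<Omega>" "D \<in> L1_loc \<Omega>" using C1c_D[OF assms(1)] by (auto intro: loc)
  fix \<psi> assume "\<psi> \<in> test_functions \<Omega>"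
  then have \<psi>: "C1c \<Omega> \<psi> (gradient \<psi>)" by (rule test_functions_C1c)
  obtain K where K: "compact K" "K \<subseteq> \<Omega>" "\<And>x. x \<notin> K \<Longrightarrow> \<psi> x = 0" "\<And>x. x \<notin> K \<Longrightarrow> gradient \<psi> x = 0"
    using \<psi> by (rule C1c_support) blast
  note c = C1c_D(2,3)[OF assms(1)] C1c_D(2,3)[OF \<psi>]
  have c1: "continuous_on UNIV (\<lambda>x. \<phi> x *\<^sub>R gradient \<psi> x)" and c2: "continuous_on UNIV (\<lambda>x. \<psi> x *\<^sub>R D x)"
    by (intro continuous_intros c)+
  have z1: "\<phi> x *\<^sub>R gradient \<psi> x = 0" and z2: "\<psi> x *\<^sub>R D x = 0" if "x \<notin> K" for x using K(3,4)[OF that] by auto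
  have i1: "integrable lborel (\<lambda>x. \<phi> x *\<^sub>R gradient \<psi> x)" by (rule integrable_continuous_compact_support[OF c1 K(1) z1])
  have i2: "integrable lborel (\<lambda>x. \<psi> x *\<^sub>R D x)" by (rule integrable_continuous_compact_support[OF c2 K(1) z2])
  have e1: "(LINT x:\<Omega>|lebesgue. \<phi> x *\<^sub>R gradient \<psi> x) = (LBINT x. \<phi> x *\<^sub>R gradient \<psi> x)"
    by (rule set_integral_lebesgue_eq_lborel) (use K z1 in \<open>auto intro!: borel_measurable_continuous_onI c1\<close>)
  have e2: "(LINT x:\<Omega>|lebesgue. \<psi> x *\<^sub>R D x) = (LBINT x. \<psi> x *\<^sub>R D x)"
    by (rule set_integral_lebesgue_eq_lborel) (use K z2 in \<open>auto intro!: borel_measurable_continuous_onI c2\<close>)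
  show "(LINT x:\<Omega>|lebesgue. \<phi> x *\<^sub>R gradient \<psi> x) = - (LINT x:\<Omega>|lebesgue. \<psi> x *\<^sub>R D x)"
    unfolding e1 e2
  proof (rule euclidean_eqI)
    fix e :: 'a assume e: "e \<in> Basis"
    have "(LBINT x. \<phi> x * (gradient \<psi> x \<bullet> e)) = - (LBINT x. \<psi> x * (D x \<bullet> e))"
      by (rule C1c_integration_by_parts(1)[OF \<psi> assms(2)]) (use C1c_D[OF assms(1)] e in \<open>auto intro: continuous_on_subset\<close>)
    then show "(LBINT x. \<phi> x *\<^sub>R gradient \<psi> x) \<bullet> e = - (LBINT x. \<psi> x *\<^sub>R D x) \<bullet> e"
      using integral_inner_left[OF i1, of e] integral_inner_left[OF i2, of e] by simp
  qed
qed

text \<open>The integral is at most \<open>(1 / real (Suc n)) powr p\<close> times the finite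
  measure of the common support.\<close>

lemma powr_integral_tendsto_0:
  fixes F :: "nat \<Rightarrow> 'a::euclidean_space \<Rightarrow> 'b::euclidean_space"
  assumes p: "0 < p" and S: "compact S" "S \<subseteq> \<Omega>" and F: "\<And>n. continuous_on UNIV (F n)" "\<And>n x. x \<notin> S \<Longrightarrow> F n x = 0"
    "\<And>n x. norm (F n x) \<le> 1 / real (Suc n)"
  shows "(\<lambda>n. LINT x:\<Omega>|lebesgue. norm (F n x) powr p) \<longlonglongrightarrow> 0"
proof -
  have Sm: "S \<in> sets borel" using S(1) by (simp add: borel_compact)
  have fin: "emeasure lborel S < \<infinity>" by (rule emeasure_compact_finite[OF S(1)])
  have iS: "integrable lborel (\<lambda>x. c * indicator S x)" for c :: real
    using Sm fin by (intro integrable_mult_right integrable_real_indicator) auto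
  have e: "(LINT x:\<Omega>|lebesgue. norm (F n x) powr p) = (LBINT x. norm (F n x) powr p)" for n
  proof (rule set_integral_lebesgue_eq_lborel)
    have [measurable]: "F n \<in> borel_measurable borel" using F(1) by (rule borel_measurable_continuous_onI)
    show "(\<lambda>x. norm (F n x) powr p) \<in> borel_measurable borel" by measurable
    show "norm (F n x) powr p = 0" if "x \<notin> \<Omega>" for x using F(2)[of x n] that S p by auto
  qed
  have up: "(LBINT x. norm (F n x) powr p) \<le> (1 / real (Suc n)) powr p * measure lborel S" for n
  proof -
    have "(LBINT x. norm (F n x) powr p) \<le> (LBINT x. (1 / real (Suc n)) powr p * indicator S x)"
    proof (rule integral_mono_AE'[OF iS])
      show "AE x in lborel. norm (F n x) powr p \<le> (1 / real (Suc n)) powr p * indicator S x"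
        using F(2)[of _ n] F(3)[of n] p by (intro always_eventually allI) (auto simp: indicator_def intro!: powr_mono2 simp del: of_nat_Suc)
    qed auto
    then show ?thesis by simp
  qed
  have "(\<lambda>n. 1 / real (Suc n)) \<longlonglongrightarrow> 0" using LIMSEQ_Suc[OF lim_const_over_n[of 1]] by simp
  then have "(\<lambda>n. (1 / real (Suc n)) powr p) \<longlonglongrightarrow> 0 powr p"
    using p by (intro tendsto_powr2) auto
  then have "(\<lambda>n. (1 / real (Suc n)) powr p * measure lborel S) \<longlonglongrightarrow> 0 * measure lborel S"
    using p by (intro tendsto_intros) simp
  then have l: "(\<lambda>n. (1 / real (Suc n)) powr p * measure lborel S) \<longlonglongrightarrow> 0" by simp
  show ?thesis unfolding e
    by (rule tendsto_sandwich[OF _ _ tendsto_const l]) (use up in auto)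
qed

lemma C1c_Lp:
  fixes h :: "'a::euclidean_space \<Rightarrow> 'b::euclidean_space"
  assumes p: "0 < p" and K: "compact K" "K \<subseteq> \<Omega>" and h: "continuous_on UNIV h" "\<And>x. x \<notin> K \<Longrightarrow> h x = 0"
  shows "h \<in> L_p \<Omega> p" "h \<in> L_infinity \<Omega>"
proof -
  have e: "(\<lambda>x. indicator \<Omega> x *\<^sub>R h x) = h" using h(2) K by (force simp: indicator_def)
  have [measurable]: "h \<in> borel_measurable borel" using h(1) by (rule borel_measurable_continuous_onI)
  have m: "set_borel_measurable lebesgue \<Omega> h"
    unfolding set_borel_measurable_def e by (rule measurable_completion) simp
  have "integrable lborel (\<lambda>x. norm (h x) powr p)"
  proof (rule integrable_continuous_compact_support[OF _ K(1)])
    show "continuous_on UNIV (\<lambda>x. norm (h x) powr p)"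
      by (rule continuous_on_powr') (use p in \<open>auto intro!: continuous_intros h(1)\<close>)
  qed (use p h(2) in auto)
  then have "set_integrable lebesgue \<Omega> (\<lambda>x. norm (h x) powr p)"
    by (intro set_integral_lebesgue_eq_lborel(2)) (use h(2) K p in \<open>auto\<close>)
  then show "h \<in> L_p \<Omega> p" using m by (simp add: L_p_def)
  obtain B where "\<And>x. norm (h x) \<le> B" using bounded_continuous_compact_support[OF h(1) K(1) h(2)] by auto
  then show "h \<in> L_infinity \<Omega>" using m by (auto simp: L_infinity_def)
qed

text \<open>The weak formulation quantifies over a Sobolev space; this makes all compactly supported
  C1 functions admissible in it. Mollification provides test functions converging uniformly,
  together with their gradients, on a fixed compact set.\<close>

lemma C1c_W0_1p:
  assumes "C1c \<Omega> \<phi> D" "open \<Omega>" "0 < p"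
  shows "\<phi> \<in> W0_1p \<Omega> p \<inter> L_infinity \<Omega>"
proof -
  obtain K where K: "compact K" "K \<subseteq> \<Omega>" "\<And>x. x \<notin> K \<Longrightarrow> \<phi> x = 0" "\<And>x. x \<notin> K \<Longrightarrow> D x = 0"
    using assms(1) by (rule C1c_support) blast
  have CK: "C1c K \<phi> D" by (rule C1cI[OF C1c_D(1,2)[OF assms(1)] K(1) order_refl K(3)])
  obtain K' where K': "compact K'" "K' \<subseteq> \<Omega>" "K \<subseteq> K'"
    "\<And>\<phi> D \<epsilon>. C1c K \<phi> D \<Longrightarrow> 0 < \<epsilon> \<Longrightarrow>
       \<exists>\<psi>\<in>test_functions \<Omega>. \<forall>x. \<bar>\<psi> x - \<phi> x\<bar> \<le> \<epsilon> \<and> norm (gradient \<psi> x - D x) \<le> \<epsilon> \<and> (x \<notin> K' \<longrightarrow> \<psi> x = 0 \<and> gradient \<psi> x = 0)"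
    by (rule test_function_approx_continuous[OF K(1,2) assms(2)]) blast
  have "\<exists>\<psi>\<in>test_functions \<Omega>. \<forall>x. \<bar>\<psi> x - \<phi> x\<bar> \<le> 1 / real (Suc n) \<and> norm (gradient \<psi> x - D x) \<le> 1 / real (Suc n) \<and> (x \<notin> K' \<longrightarrow> \<psi> x = 0 \<and> gradient \<psi> x = 0)" for n
    by (rule K'(4)[OF CK]) simp
  then obtain \<psi> where \<psi>: "\<And>n. \<psi> n \<in> test_functions \<Omega>" "\<And>n x. \<bar>\<psi> n x - \<phi> x\<bar> \<le> 1 / real (Suc n)"
    "\<And>n x. norm (gradient (\<psi> n) x - D x) \<le> 1 / real (Suc n)" "\<And>n x. x \<notin> K' \<Longrightarrow> \<psi> n x = 0 \<and> gradient (\<psi> n) x = 0"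
    by metis
  have z: "\<phi> x = 0" "D x = 0" if "x \<notin> K'" for x using that K K'(3) by blast+
  note \<psi>c = C1c_D[OF test_functions_C1c[OF \<psi>(1)]]
  have l1: "(\<lambda>n. LINT x:\<Omega>|lebesgue. norm (\<psi> n x - \<phi> x) powr p) \<longlonglongrightarrow> 0"
    by (rule powr_integral_tendsto_0[OF assms(3) K'(1,2)])
      (use \<psi>(2,4) z in \<open>auto intro!: continuous_intros \<psi>c C1c_D(3)[OF assms(1)] simp del: of_nat_Suc\<close>)
  have l2: "(\<lambda>n. LINT x:\<Omega>|lebesgue. norm (gradient (\<psi> n) x - D x) powr p) \<longlonglongrightarrow> 0"
    by (rule powr_integral_tendsto_0[OF assms(3) K'(1,2)])
      (use \<psi>(3,4) z in \<open>auto intro!: continuous_intros \<psi>c C1c_D(2)[OF assms(1)] simp del: of_nat_Suc\<close>)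
  show ?thesis unfolding W0_1p_def
    using C1c_Lp[OF assms(3) K(1,2) C1c_D(3)[OF assms(1)] K(3)] C1c_Lp[OF assms(3) K(1,2) C1c_D(2)[OF assms(1)] K(4)]
      C1c_weak_gradient[OF assms(1,2)] \<psi>(1) l1 l2
    by auto
qed

text \<open>The set where \<open>w\<close> is positive is approximated from inside by closed sets up
  to measure \<open>e\<close>. On each of them a positive function has integral zero, so the closed
  set is null and the positivity set has measure at most \<open>e\<close>.\<close>

lemma positive_set_null:
  fixes w :: "'a::euclidean_space \<Rightarrow> real"
  assumes int: "\<And>T. compact T \<Longrightarrow> T \<subseteq> J \<Longrightarrow> set_integrable lebesgue T w \<and> (LINT x:T|lebesgue. w x) = 0" and J: "compact J"
  shows "AE x\<in>J in lebesgue. w x \<le> 0"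
proof -
  define S where "S = {x. 0 < indicator J x *\<^sub>R w x}"
  have "set_integrable lebesgue J w" using int[OF J] by simp
  then have "(\<lambda>x. indicator J x *\<^sub>R w x) \<in> borel_measurable lebesgue" unfolding set_integrable_def by (rule borel_measurable_integrable)
  then have S: "S \<in> sets lebesgue" unfolding S_def borel_measurable_iff_greater by simp
  have SJ: "S \<subseteq> J" by (auto simp: S_def indicator_def split: if_splits)
  have "emeasure lebesgue S \<le> ennreal e" if e: "0 < e" for e
  proof -
    obtain T where T: "closed T" "T \<subseteq> S" "S - T \<in> lmeasurable" "emeasure lebesgue (S - T) < ennreal e"
      by (rule sets_lebesgue_inner_closed[OF S e])
    have cT: "compact T" using T SJ J compact_Int_closed[OF J T(1)] by (metis Int_absorb1 order_trans)
    note i = int[OF cT order_trans[OF T(2) SJ]]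
    have Tw: "0 < w x" if "x \<in> T" for x
      using that T(2) SJ by (auto simp: S_def dest!: subsetD)
    have "AE x in lebesgue. indicator T x *\<^sub>R w x = 0"
    proof (rule integral_nonneg_eq_0_iff_AE[THEN iffD1])
      show "integrable lebesgue (\<lambda>x. indicator T x *\<^sub>R w x)" using i by (simp add: set_integrable_def)
      show "integral\<^sup>L lebesgue (\<lambda>x. indicator T x *\<^sub>R w x) = 0" using i by (simp add: set_lebesgue_integral_def)
      show "AE x in lebesgue. 0 \<le> indicator T x *\<^sub>R w x"
        using Tw by (intro always_eventually allI) (auto simp: indicator_def less_imp_le)
    qed
    then have "AE x in lebesgue. x \<notin> T"
      by eventually_elim (use Tw in \<open>force simp: indicator_def split: if_splits\<close>)
    moreover have Ts: "T \<in> sets lebesgue" using T(1) by simp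
    ultimately have T0: "emeasure lebesgue T = 0"
      using AE_iff_measurable[of T lebesgue "\<lambda>x. x \<notin> T"] by simp
    have "emeasure lebesgue S \<le> emeasure lebesgue T + emeasure lebesgue (S - T)"
      using emeasure_subadditive[of T lebesgue "S - T"] Ts S T(2) by (simp add: Un_absorb1)
    then show ?thesis using T(4) T0 by simp
  qed
  then have "emeasure lebesgue S \<le> 0 + ennreal e" if "0 < e" for e :: real using that by simp
  then have "emeasure lebesgue S \<le> 0" by (rule ennreal_le_epsilon)
  then have "S \<in> null_sets lebesgue" using S by (simp add: null_sets_def)
  then have "AE x in lebesgue. x \<notin> S" by (rule AE_not_in)
  then show ?thesis by eventually_elim (auto simp: S_def)
qed

text \<open>The indicator of a compact set is a pointwise limit of test functions with one common
  compact support, so \<open>w\<close> integrates to zero over every compact set. This determines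
  the sign of \<open>w\<close> and of \<open>- w\<close> almost everywhere, and an exhaustion by
  compact sets covers \<open>U\<close>.\<close>

lemma fundamental_lemma:
  fixes w :: "'a::euclidean_space \<Rightarrow> real"
  assumes U: "open U" and w: "w \<in> L1_loc U" and test: "\<And>\<psi>. \<psi> \<in> test_functions U \<Longrightarrow> (LINT x:U|lebesgue. \<psi> x * w x) = 0"
  shows "AE x\<in>U in lebesgue. w x = 0"
proof -
  have int: "set_integrable lebesgue T w \<and> (LINT x:T|lebesgue. w x) = 0" if T: "compact T" "T \<subseteq> U" for T
  proof
    show iT: "set_integrable lebesgue T w" using w T by (simp add: L1_loc_def)
    show "(LINT x:T|lebesgue. w x) = 0"
    proof (cases "T = {}")
      case False
      obtain r where r: "0 < r" "compact (\<Union>x\<in>T. cball x r)" "(\<Union>x\<in>T. cball x r) \<subseteq> U" "T \<subseteq> (\<Union>x\<in>T. cball x r)"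
        using compact_neighbourhood[OF T U] by blast
      define K where "K = (\<Union>x\<in>T. cball x r)"
      obtain K' where K': "compact K'" "K' \<subseteq> U" "K \<subseteq> K'"
        "\<And>\<phi> \<epsilon>. continuous_on UNIV \<phi> \<Longrightarrow> (\<And>x. x \<notin> K \<Longrightarrow> \<phi> x = 0) \<Longrightarrow> 0 < \<epsilon> \<Longrightarrow>
          \<exists>\<psi>\<in>test_functions U. \<forall>x. \<bar>\<psi> x - \<phi> x\<bar> \<le> \<epsilon> \<and> (x \<notin> K' \<longrightarrow> \<psi> x = 0)"
        by (rule test_function_approx_continuous[OF r(2,3) U, folded K_def]) blast
      \<comment> \<open>Tent functions of the distance to \<open>T\<close>: equal to 1 on
        \<open>T\<close>, zero beyond distance \<open>r / Suc n\<close>, hence all supported in the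
        neighbourhood \<open>K\<close>. Being merely Lipschitz, they are then replaced by test
        functions within 1 / (n + 1).\<close>
      define \<phi> where "\<phi> n x = max 0 (1 - real (Suc n) / r * infdist x T)" for n x
      have \<phi>c: "continuous_on UNIV (\<phi> n)" for n unfolding \<phi>_def[abs_def] by (intro continuous_intros)
      have \<phi>0: "\<phi> n x = 0" if "x \<notin> K" for n x
      proof -
        obtain y where y: "y \<in> T" "infdist x T = dist x y" using infdist_attains_inf[OF compact_imp_closed[OF T(1)] False] by blast
        have "r < infdist x T" using that y by (auto simp: K_def dist_commute)
        then have "1 \<le> infdist x T / r" using r(1) by simp
        also have "\<dots> \<le> real (Suc n) * (infdist x T / r)" using r(1) infdist_nonneg[of x T] by (simp add: divide_right_mono mult_le_cancel_right1)
        finally show ?thesis by (simp add: \<phi>_def)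
      qed
      have "\<exists>\<psi>\<in>test_functions U. \<forall>x. \<bar>\<psi> x - \<phi> n x\<bar> \<le> 1 / real (Suc n) \<and> (x \<notin> K' \<longrightarrow> \<psi> x = 0)" for n
        by (rule K'(4)[OF \<phi>c \<phi>0]) auto
      then obtain \<psi> where \<psi>: "\<And>n. \<psi> n \<in> test_functions U" "\<And>n x. \<bar>\<psi> n x - \<phi> n x\<bar> \<le> 1 / real (Suc n)" "\<And>n x. x \<notin> K' \<Longrightarrow> \<psi> n x = 0"
        by metis
      have d0: "(\<lambda>n. 1 / real (Suc n)) \<longlonglongrightarrow> 0" using LIMSEQ_Suc[OF lim_const_over_n[of 1]] by simp
      have \<phi>l: "(\<lambda>n. \<phi> n x) \<longlonglongrightarrow> indicator T x" for x
      proof (cases "x \<in> T")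
        case True
        then show ?thesis by (simp add: \<phi>_def)
      next
        case False
        have "0 < infdist x T" using False \<open>T \<noteq> {}\<close> compact_imp_closed[OF T(1)] in_closed_iff_infdist_zero infdist_nonneg[of x T] by fastforce
        then have "0 < infdist x T / r" using r(1) by simp
        then have "\<forall>\<^sub>F n in sequentially. 1 / real (Suc n) < infdist x T / r" using order_tendstoD(2)[OF d0] by blast
        then have "\<forall>\<^sub>F n in sequentially. \<phi> n x = 0"
        proof eventually_elim
          case (elim n)
          then have "1 \<le> real (Suc n) * (infdist x T / r)" by (simp add: field_simps del: of_nat_Suc)
          then show ?case by (simp add: \<phi>_def)
        qed
        then show ?thesis using False by (simp add: tendsto_eventually)
      qed
      have \<psi>l: "(\<lambda>n. \<psi> n x) \<longlonglongrightarrow> indicator T x" for x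
      proof -
        have "(\<lambda>n. \<psi> n x - \<phi> n x) \<longlonglongrightarrow> 0"
          by (rule Lim_null_comparison[OF _ d0]) (use \<psi>(2) in \<open>auto simp del: of_nat_Suc\<close>)
        from tendsto_add[OF this \<phi>l[of x]] show ?thesis by simp
      qed
      have iK': "set_integrable lebesgue K' w" using w K' by (simp add: L1_loc_def)
      have "(\<lambda>n. integral\<^sup>L lebesgue (\<lambda>x. indicator U x *\<^sub>R (\<psi> n x * w x))) \<longlonglongrightarrow> integral\<^sup>L lebesgue (\<lambda>x. indicator T x *\<^sub>R w x)"
      \<comment> \<open>The factor 2 bounds the test functions: a tent function is at most 1 and the
        approximation error is at most 1.\<close>
      proof (rule integral_dominated_convergence[where w="\<lambda>x. 2 * \<bar>indicator K' x *\<^sub>R w x\<bar>"])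
        have eq: "indicator U x *\<^sub>R (\<psi> n x * w x) = \<psi> n x * (indicator K' x *\<^sub>R w x)" for n x
          using \<psi>(3)[of x n] K'(2) by (auto simp: indicator_def)
        show "(\<lambda>x. indicator T x *\<^sub>R w x) \<in> borel_measurable lebesgue" using iT unfolding set_integrable_def by (rule borel_measurable_integrable)
        show "(\<lambda>x. indicator U x *\<^sub>R (\<psi> n x * w x)) \<in> borel_measurable lebesgue" for n
          unfolding eq
        proof (rule borel_measurable_times)
          show "(\<lambda>x. indicator K' x *\<^sub>R w x) \<in> borel_measurable lebesgue" using iK' unfolding set_integrable_def by (rule borel_measurable_integrable)
          show "\<psi> n \<in> borel_measurable lebesgue"
            by (rule measurable_completion) (use borel_measurable_continuous_onI[OF C1c_D(3)[OF test_functions_C1c[OF \<psi>(1)]]] in simp)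
        qed
        show "integrable lebesgue (\<lambda>x. 2 * \<bar>indicator K' x *\<^sub>R w x\<bar>)" using iK' unfolding set_integrable_def by (intro integrable_mult_right integrable_abs)
        show "AE x in lebesgue. (\<lambda>n. indicator U x *\<^sub>R (\<psi> n x * w x)) \<longlonglongrightarrow> indicator T x *\<^sub>R w x"
        proof (intro always_eventually allI)
          fix x
          have "(\<lambda>n. indicator U x *\<^sub>R (\<psi> n x * w x)) \<longlonglongrightarrow> indicator U x *\<^sub>R (indicator T x * w x)"
            by (intro tendsto_intros \<psi>l)
          moreover have "indicator U x *\<^sub>R (indicator T x * w x) = indicator T x *\<^sub>R w x" using T(2) by (auto simp: indicator_def)
          ultimately show "(\<lambda>n. indicator U x *\<^sub>R (\<psi> n x * w x)) \<longlonglongrightarrow> indicator T x *\<^sub>R w x" by (simp only:)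
        qed
        show "AE x in lebesgue. norm (indicator U x *\<^sub>R (\<psi> n x * w x)) \<le> 2 * \<bar>indicator K' x *\<^sub>R w x\<bar>" for n
        proof (intro always_eventually allI)
          fix x
          have "0 \<le> real (Suc n) / r * infdist x T" using r(1) infdist_nonneg[of x T] by simp
          then have "\<bar>\<phi> n x\<bar> \<le> 1" by (simp add: \<phi>_def)
          moreover have "1 / real (Suc n) \<le> 1" by simp
          ultimately have "\<bar>\<psi> n x\<bar> \<le> 2" using \<psi>(2)[of n x] by linarith
          then show "norm (indicator U x *\<^sub>R (\<psi> n x * w x)) \<le> 2 * \<bar>indicator K' x *\<^sub>R w x\<bar>"
            unfolding eq by (simp add: abs_mult mult_right_mono)
        qed
      qed
      then have "(\<lambda>n. LINT x:U|lebesgue. \<psi> n x * w x) \<longlonglongrightarrow> (LINT x:T|lebesgue. w x)" by (simp add: set_lebesgue_integral_def)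
      then show ?thesis using test[OF \<psi>(1)] LIMSEQ_unique[OF _ tendsto_const] by fastforce
    qed (simp add: set_lebesgue_integral_def)
  qed
  obtain C :: "nat \<Rightarrow> 'a set" where C: "\<And>n. compact (C n)" "\<And>n. C n \<subseteq> U" "\<Union>(range C) = U"
    using open_Union_compact_subsets[OF U] by metis
  have "AE x in lebesgue. x \<in> C n \<longrightarrow> w x = 0" for n
  proof -
    have "AE x in lebesgue. x \<in> C n \<longrightarrow> w x \<le> 0"
      by (rule positive_set_null[OF _ C(1)]) (use int C(2) in blast)
    moreover have "AE x in lebesgue. x \<in> C n \<longrightarrow> - w x \<le> 0"
    proof (rule positive_set_null[OF _ C(1)])
      fix T assume T: "compact T" "T \<subseteq> C n"
      note i = int[OF T(1) order_trans[OF T(2) C(2)]]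
      then show "set_integrable lebesgue T (\<lambda>x. - w x) \<and> (LINT x:T|lebesgue. - w x) = 0"
        by (simp add: set_integrable_def set_lebesgue_integral_def)
    qed
    ultimately show ?thesis by eventually_elim auto
  qed
  then have "AE x in lebesgue. \<forall>n. x \<in> C n \<longrightarrow> w x = 0" unfolding AE_all_countable by blast
  then show ?thesis by eventually_elim (use C(3) in blast)
qed

text \<open>Both fields satisfy the same integration by parts formula against test functions
  supported in \<open>U\<close>, so each component of their difference is annihilated by all of
  them. This replaces the unspecified weak gradient of the solution by its classical one.\<close>

lemma weak_gradient_eq_gradient:
  fixes u :: "'a::euclidean_space \<Rightarrow> real"
  assumes wg: "has_weak_gradient \<Omega> u Du" and U: "open U" "U \<subseteq> \<Omega>"
    and u: "\<And>x. x \<in> U \<Longrightarrow> GDERIV u x :> G x" "continuous_on U G"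
  shows "AE x\<in>U in lebesgue. Du x = G x"
proof -
  have iDu: "set_integrable lebesgue K Du" if "compact K" "K \<subseteq> U" for K
    using wg that U by (auto simp: has_weak_gradient_def L1_loc_def)
  have iG: "set_integrable lebesgue K G" if "compact K" "K \<subseteq> U" for K
  proof -
    have "integrable lborel (\<lambda>x. indicator K x *\<^sub>R G x)"
      using that u(2) by (intro borel_integrable_compact) (auto intro: continuous_on_subset)
    then show ?thesis unfolding set_integrable_def
      by (auto intro: integrable_completion[THEN iffD2] borel_measurable_integrable)
  qed
  have "AE x\<in>U in lebesgue. (Du x - G x) \<bullet> e = 0" if e: "e \<in> Basis" for e
  proof (rule fundamental_lemma[OF U(1)])
    show "(\<lambda>x. (Du x - G x) \<bullet> e) \<in> L1_loc U"
      unfolding L1_loc_def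
    proof safe
      fix K assume K: "compact K" "K \<subseteq> U"
      have "integrable lebesgue (\<lambda>x. (indicator K x *\<^sub>R Du x - indicator K x *\<^sub>R G x) \<bullet> e)"
        using iDu[OF K] iG[OF K] unfolding set_integrable_def by (intro integrable_inner_left Bochner_Integration.integrable_diff) auto
      then show "set_integrable lebesgue K (\<lambda>x. (Du x - G x) \<bullet> e)"
        unfolding set_integrable_def by (simp add: scaleR_diff_right[symmetric])
    qed
    fix \<psi> assume \<psi>t: "\<psi> \<in> test_functions U"
    then have \<psi>\<Omega>: "\<psi> \<in> test_functions \<Omega>" using U(2) by (auto simp: test_functions_def)
    have \<psi>: "C1c U \<psi> (gradient \<psi>)" by (rule test_functions_C1c[OF \<psi>t])
    obtain K where K: "compact K" "K \<subseteq> U" "\<And>x. x \<notin> K \<Longrightarrow> \<psi> x = 0" "\<And>x. x \<notin> K \<Longrightarrow> gradient \<psi> x = 0"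
      using \<psi> by (rule C1c_support) blast
    obtain B where B: "\<And>x. norm (\<psi> x) \<le> B" using bounded_continuous_compact_support[OF C1c_D(3)[OF \<psi>] K(1,3)] by auto
    have \<psi>m: "\<psi> \<in> borel_measurable lebesgue"
      by (rule measurable_completion) (use borel_measurable_continuous_onI[OF C1c_D(3)[OF \<psi>]] in simp)
    have uc: "continuous_on U u" using u(1) by (rule GDERIV_continuous_on)
    define F where "F x = u x *\<^sub>R gradient \<psi> x" for x
    have F0: "F x = 0" if "x \<notin> K" for x using K(4)[OF that] by (simp add: F_def)
    have "integrable lborel (\<lambda>x. indicator K x *\<^sub>R F x)"
      unfolding F_def by (intro borel_integrable_compact K continuous_intros continuous_on_subset[OF uc]
          continuous_on_subset[OF C1c_D(2)[OF \<psi>]]) auto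
    moreover have "(\<lambda>x. indicator K x *\<^sub>R F x) = F" using F0 by (force simp: indicator_def)
    ultimately have iF: "integrable lborel F" by simp
    have e1: "(LINT x:\<Omega>|lebesgue. F x) = integral\<^sup>L lborel F"
      by (rule set_integral_lebesgue_eq_lborel) (use iF F0 K(2) U(2) in auto)
    have prod: "integrable lebesgue (\<lambda>x. \<psi> x *\<^sub>R H x)" if H: "set_integrable lebesgue K H" for H :: "'a \<Rightarrow> 'a"
    proof -
      have eq: "\<psi> x *\<^sub>R H x = \<psi> x *\<^sub>R (indicator K x *\<^sub>R H x)" for x using K(3)[of x] by (cases "x \<in> K") auto
      show ?thesis unfolding eq
      proof (rule Bochner_Integration.integrable_bound)
        show "integrable lebesgue (\<lambda>x. B * norm (indicator K x *\<^sub>R H x))"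
          using H unfolding set_integrable_def by (intro integrable_mult_right integrable_norm) auto
        show "(\<lambda>x. \<psi> x *\<^sub>R (indicator K x *\<^sub>R H x)) \<in> borel_measurable lebesgue"
          by (rule borel_measurable_scaleR[OF \<psi>m borel_measurable_integrable[OF H[unfolded set_integrable_def]]])
        show "AE x in lebesgue. norm (\<psi> x *\<^sub>R (indicator K x *\<^sub>R H x)) \<le> norm (B * norm (indicator K x *\<^sub>R H x))"
        proof (intro always_eventually allI)
          fix x
          have "0 \<le> B" using B[of x] norm_ge_zero[of "\<psi> x"] by linarith
          then show "norm (\<psi> x *\<^sub>R (indicator K x *\<^sub>R H x)) \<le> norm (B * norm (indicator K x *\<^sub>R H x))"
            using mult_right_mono[OF B[of x] norm_ge_zero[of "indicator K x *\<^sub>R H x"]] by (simp add: abs_mult mult.assoc)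
        qed
      qed
    qed
    note iD = prod[OF iDu[OF K(1,2)]] and iGp = prod[OF iG[OF K(1,2)]]
    have e2: "(LINT x:\<Omega>|lebesgue. \<psi> x *\<^sub>R Du x) = integral\<^sup>L lebesgue (\<lambda>x. \<psi> x *\<^sub>R Du x)"
    proof -
      have "indicator \<Omega> x *\<^sub>R (\<psi> x *\<^sub>R Du x) = \<psi> x *\<^sub>R Du x" for x
        using K(2,3) U(2) by (cases "x \<in> \<Omega>") (auto simp: subset_iff)
      then show ?thesis by (simp only: set_lebesgue_integral_def)
    qed
    have "integral\<^sup>L lborel F = - integral\<^sup>L lebesgue (\<lambda>x. \<psi> x *\<^sub>R Du x)"
      using wg \<psi>\<Omega> e1 e2 by (simp add: has_weak_gradient_def F_def[abs_def])
    then have "(LBINT x. F x \<bullet> e) = - integral\<^sup>L lebesgue (\<lambda>x. (\<psi> x *\<^sub>R Du x) \<bullet> e)"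
      using integral_inner_left[OF iF, of e] integral_inner_left[OF iD, of e] by simp
    moreover have "(LBINT x. F x \<bullet> e) = - (LBINT x. \<psi> x * (G x \<bullet> e))"
      and iP: "integrable lborel (\<lambda>x. \<psi> x * (G x \<bullet> e))"
      using C1c_integration_by_parts[OF \<psi> U(1) u, of e] e by (auto simp: F_def)
    moreover have "(LBINT x. \<psi> x * (G x \<bullet> e)) = integral\<^sup>L lebesgue (\<lambda>x. \<psi> x * (G x \<bullet> e))"
      by (rule integral_completion[symmetric]) (rule borel_measurable_integrable[OF iP])
    ultimately have eq: "integral\<^sup>L lebesgue (\<lambda>x. (\<psi> x *\<^sub>R Du x) \<bullet> e) = integral\<^sup>L lebesgue (\<lambda>x. (\<psi> x *\<^sub>R G x) \<bullet> e)" by simp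
    have "(LINT x:U|lebesgue. \<psi> x * ((Du x - G x) \<bullet> e)) = integral\<^sup>L lebesgue (\<lambda>x. (\<psi> x *\<^sub>R Du x) \<bullet> e - (\<psi> x *\<^sub>R G x) \<bullet> e)"
    proof -
      have "indicator U x *\<^sub>R (\<psi> x * ((Du x - G x) \<bullet> e)) = (\<psi> x *\<^sub>R Du x) \<bullet> e - (\<psi> x *\<^sub>R G x) \<bullet> e" for x
        using K(2,3) by (cases "x \<in> U") (auto simp: subset_iff inner_diff_left right_diff_distrib)
      then show ?thesis by (simp only: set_lebesgue_integral_def)
    qed
    also have "\<dots> = 0"
      using Bochner_Integration.integral_diff[OF integrable_inner_left[OF iD, of e] integrable_inner_left[OF iGp, of e]] eq
      by (simp only: diff_self)
    finally show "(LINT x:U|lebesgue. \<psi> x * ((Du x - G x) \<bullet> e)) = 0" .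
  qed
  then have "AE x in lebesgue. \<forall>e\<in>Basis. x \<in> U \<longrightarrow> (Du x - G x) \<bullet> e = 0"
    by (intro AE_finite_allI) auto
  then show ?thesis
  proof eventually_elim
    case (elim x)
    show ?case
    proof
      assume "x \<in> U"
      with elim have "Du x \<bullet> b = G x \<bullet> b" if "b \<in> Basis" for b using that by (auto simp: inner_diff_left)
      then show "Du x = G x" by (rule euclidean_eqI)
    qed
  qed
qed

section \<open>Localisation of weak solutions\<close>

lemma set_integral_vanishing_outside:
  fixes h :: "'a \<Rightarrow> 'b::{banach,second_countable_topology}"
  assumes "\<And>x. x \<notin> S \<Longrightarrow> h x = 0"
  shows "(LINT x:S|M. h x) = integral\<^sup>L M h"
proof -
  have "(\<lambda>x. indicator S x *\<^sub>R h x) = h" using assms by (force simp: indicator_def)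
  then show ?thesis by (simp add: set_lebesgue_integral_def)
qed

lemma integrable_lebesgue_continuous_mult:
  fixes h \<phi> :: "'a::euclidean_space \<Rightarrow> real"
  assumes "continuous_on U h" "continuous_on UNIV \<phi>" "compact K" "K \<subseteq> U" "\<And>x. x \<notin> K \<Longrightarrow> \<phi> x = 0"
  shows "integrable lebesgue (\<lambda>x. h x * \<phi> x)"
proof -
  have "integrable lborel (\<lambda>x. indicator K x *\<^sub>R (h x * \<phi> x))"
    by (intro borel_integrable_compact assms(3) continuous_intros continuous_on_subset[OF assms(1)] continuous_on_subset[OF assms(2)])
      (use assms(4) in auto)
  moreover have "(\<lambda>x. indicator K x *\<^sub>R (h x * \<phi> x)) = (\<lambda>x. h x * \<phi> x)" using assms(5) by (force simp: indicator_def)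
  ultimately have "integrable lborel (\<lambda>x. h x * \<phi> x)" by simp
  then show ?thesis by (auto intro: integrable_completion[THEN iffD2] borel_measurable_integrable)
qed

lemma L_infinity_mult_integrable:
  fixes f \<phi> :: "'a::euclidean_space \<Rightarrow> real"
  assumes f: "f \<in> L_infinity \<Omega>" and \<phi>: "continuous_on UNIV \<phi>" "compact K" "K \<subseteq> \<Omega>" "\<And>x. x \<notin> K \<Longrightarrow> \<phi> x = 0"
  shows "integrable lebesgue (\<lambda>x. f x * \<phi> x)"
proof -
  obtain Mf where Mf: "AE x\<in>\<Omega> in lebesgue. norm (f x) \<le> Mf" using f by (auto simp: L_infinity_def)
  have fm: "(\<lambda>x. indicator \<Omega> x *\<^sub>R f x) \<in> borel_measurable lebesgue" using f by (simp add: L_infinity_def set_borel_measurable_def)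
  have \<phi>i: "integrable lborel \<phi>" by (rule integrable_continuous_compact_support[OF \<phi>(1,2,4)])
  then have \<phi>l: "integrable lebesgue \<phi>" by (auto intro: integrable_completion[THEN iffD2] borel_measurable_integrable)
  have eq: "f x * \<phi> x = indicator \<Omega> x *\<^sub>R f x * \<phi> x" for x using \<phi>(3) \<phi>(4)[of x] by (cases "x \<in> \<Omega>") auto
  show ?thesis
  proof (rule Bochner_Integration.integrable_bound[of _ "\<lambda>x. Mf * \<phi> x"])
    show "integrable lebesgue (\<lambda>x. Mf * \<phi> x)" using \<phi>l by auto
    show "(\<lambda>x. f x * \<phi> x) \<in> borel_measurable lebesgue"
      unfolding eq by (rule borel_measurable_times[OF fm borel_measurable_integrable[OF \<phi>l]])
    show "AE x in lebesgue. norm (f x * \<phi> x) \<le> norm (Mf * \<phi> x)"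
      using Mf
    proof eventually_elim
      case (elim x)
      show ?case
      proof (cases "x \<in> K")
        case True
        then have "\<bar>f x\<bar> \<le> Mf" using elim \<phi>(3) by auto
        then have "\<bar>f x\<bar> \<le> \<bar>Mf\<bar>" by linarith
        then show ?thesis by (simp add: abs_mult mult_right_mono)
      qed (simp add: \<phi>(4))
    qed
  qed
qed

text \<open>The function t is nonpositive on the ball of radius \<open>2 * R\<close> and at least 1
  outside the ball of radius \<open>5 / 2 * R\<close>, since 25/4 - 4 exceeds 1. Two nested squared
  positive parts turn it into a C1 plateau.\<close>

lemma plateau_cutoff:
  fixes x0 :: "'a::euclidean_space"
  assumes "0 < R"
  obtains \<zeta> Z where "C1c (ball x0 (3 * R)) \<zeta> Z" "\<And>x. x \<in> ball x0 (2 * R) \<Longrightarrow> \<zeta> x = 1 \<and> Z x = 0"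
proof -
  define t where "t x = (norm (x - x0))\<^sup>2 / R\<^sup>2 - 4" for x
  have td: "GDERIV t x :> (2 / R\<^sup>2) *\<^sub>R (x - x0)" for x
  proof -
    have "GDERIV (\<lambda>x. (norm (x - x0))\<^sup>2) x :> 2 *\<^sub>R (x - x0)"
      unfolding gderiv_def power2_norm_eq_inner by (rule derivative_eq_intros refl | simp add: inner_commute)+
    from GDERIV_diff[OF GDERIV_divide_const[OF this, of "R\<^sup>2"] GDERIV_const_zero[of 4]]
    show ?thesis by (simp add: t_def[abs_def] divide_inverse mult.commute)
  qed
  define \<zeta> where "\<zeta> x = (max 0 (1 - (max 0 (t x))\<^sup>2))\<^sup>2" for x
  define Z where "Z x = (2 * max 0 (1 - (max 0 (t x))\<^sup>2)) *\<^sub>R (- ((2 * max 0 (t x)) *\<^sub>R ((2 / R\<^sup>2) *\<^sub>R (x - x0))))" for x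
  have 1: "GDERIV (\<lambda>x. (max 0 (t x))\<^sup>2) x :> (2 * max 0 (t x)) *\<^sub>R ((2 / R\<^sup>2) *\<^sub>R (x - x0))" for x
    using GDERIV_DERIV_compose[OF td DERIV_max_power[of 0]] by (simp add: numeral_2_eq_2)
  have 2: "GDERIV (\<lambda>x. 1 - (max 0 (t x))\<^sup>2) x :> - ((2 * max 0 (t x)) *\<^sub>R ((2 / R\<^sup>2) *\<^sub>R (x - x0)))" for x
    using GDERIV_diff[OF GDERIV_const_zero[of 1] 1] by simp
  have 3: "GDERIV \<zeta> x :> Z x" for x
    using GDERIV_DERIV_compose[OF 2 DERIV_max_power[of 0], of x] unfolding \<zeta>_def[abs_def] Z_def by (simp add: numeral_2_eq_2)
  have tc: "continuous_on UNIV t" using td by (rule GDERIV_continuous_on)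
  show thesis
  proof (rule that[of \<zeta> Z])
    show "C1c (ball x0 (3 * R)) \<zeta> Z"
    proof (rule C1cI[OF 3])
      show "continuous_on UNIV Z" unfolding Z_def[abs_def] by (intro continuous_intros tc)
      show "compact (cball x0 (5 / 2 * R))" by simp
      show "cball x0 (5 / 2 * R) \<subseteq> ball x0 (3 * R)" using assms by auto
      fix x assume "x \<notin> cball x0 (5 / 2 * R)"
      then have "(5 / 2 * R)\<^sup>2 \<le> (norm (x - x0))\<^sup>2" using assms by (intro power_mono) (auto simp: dist_norm norm_minus_commute)
      moreover have "(5 / 2 * R)\<^sup>2 = 5 * R\<^sup>2 + 5 / 4 * R\<^sup>2" by (simp add: power2_eq_square)
      ultimately have "5 * R\<^sup>2 \<le> (norm (x - x0))\<^sup>2" using zero_le_power2[of R] by linarith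
      then have "1 \<le> t x" using assms by (simp add: t_def field_simps)
      then have "1 \<le> (max 0 (t x))\<^sup>2" by simp
      then show "\<zeta> x = 0" by (simp add: \<zeta>_def)
    qed
    fix x assume "x \<in> ball x0 (2 * R)"
    then have "(norm (x - x0))\<^sup>2 \<le> (2 * R)\<^sup>2" using assms by (intro power_mono) (auto simp: dist_norm norm_minus_commute)
    then have "t x \<le> 0" using assms by (simp add: t_def field_simps power2_eq_square)
    then show "\<zeta> x = 1 \<and> Z x = 0" by (simp add: \<zeta>_def Z_def)
  qed
qed

context elliptic_profile
begin

text \<open>The support of \<open>\<phi>\<close> is compact and avoids the origin, so the singular
  weight, the power of u and the gradient terms are continuous on it and each integral converges
  separately. They can then be collected into a single source term.\<close>

lemma weak_solution_local_equation:
  fixes u f :: "'a::euclidean_space \<Rightarrow> real"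
  assumes \<Omega>: "open \<Omega>" and p: "0 < p" and sol: "weak_solution \<Omega> p q \<theta> A B f u" and U: "U = \<Omega> - {0}"
    and u: "\<And>x. x \<in> U \<Longrightarrow> GDERIV u x :> G x" "continuous_on U G" "\<And>x. x \<in> U \<Longrightarrow> 0 < u x"
    and B: "continuous_on {0..} B" and f: "f \<in> L_infinity \<Omega>" and \<phi>: "C1c U \<phi> D"
  shows "integral\<^sup>L lebesgue (\<lambda>x. flux (G x) \<bullet> D x)
    = integral\<^sup>L lebesgue (\<lambda>x. (\<theta> * (u x powr q / norm x powr p) + f x - B (norm (G x))) * \<phi> x)"
proof -
  have oU: "open U" and UO: "U \<subseteq> \<Omega>" using \<Omega> by (auto simp: U)
  have \<phi>\<Omega>: "C1c \<Omega> \<phi> D" using \<phi> UO by (rule C1c_mono)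
  obtain K where K: "compact K" "K \<subseteq> U" "\<And>x. x \<notin> K \<Longrightarrow> \<phi> x = 0" "\<And>x. x \<notin> K \<Longrightarrow> D x = 0"
    using \<phi> by (rule C1c_support) blast
  obtain Du where Du: "has_weak_gradient \<Omega> u Du" and eq: "\<forall>\<phi> D\<phi>. \<phi> \<in> W0_1p \<Omega> p \<inter> L_infinity \<Omega> \<and> has_weak_gradient \<Omega> \<phi> D\<phi> \<longrightarrow>
      (LINT x:\<Omega>|lebesgue. A (norm (Du x)) * (Du x \<bullet> D\<phi> x)) + (LINT x:\<Omega>|lebesgue. B (norm (Du x)) * \<phi> x)
          = \<theta> * (LINT x:\<Omega>|lebesgue. u x powr q / norm x powr p * \<phi> x) + (LINT x:\<Omega>|lebesgue. f x * \<phi> x)"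
    using sol unfolding weak_solution_def by (elim conjE exE)
  have ae: "AE x\<in>U in lebesgue. Du x = G x" by (rule weak_gradient_eq_gradient[OF Du oU UO u(1,2)])
  have "set_integrable lebesgue K Du" using Du K(1,2) UO by (auto simp: has_weak_gradient_def L1_loc_def)
  then have [measurable]: "(\<lambda>x. indicator K x *\<^sub>R Du x) \<in> borel_measurable lebesgue" unfolding set_integrable_def by (rule borel_measurable_integrable)
  have "set_integrable lborel K G" unfolding set_integrable_def using K u(2) by (intro borel_integrable_compact) (auto intro: continuous_on_subset)
  then have "(\<lambda>x. indicator K x *\<^sub>R G x) \<in> borel_measurable lborel" unfolding set_integrable_def by (rule borel_measurable_integrable)
  then have [measurable]: "(\<lambda>x. indicator K x *\<^sub>R G x) \<in> borel_measurable lebesgue" by (rule measurable_completion)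
  have [measurable]: "\<phi> \<in> borel_measurable lebesgue" "D \<in> borel_measurable lebesgue"
    using borel_measurable_continuous_onI[OF C1c_D(3)[OF \<phi>]] borel_measurable_continuous_onI[OF C1c_D(2)[OF \<phi>]]
    by (auto intro!: measurable_completion)
  have Bn: "continuous_on UNIV (\<lambda>\<xi>::'a. B (norm \<xi>))" by (intro continuous_on_compose2[OF B] continuous_intros) auto
  then have [measurable]: "(\<lambda>\<xi>::'a. B (norm \<xi>)) \<in> borel_measurable borel" by (rule borel_measurable_continuous_onI)
  \<comment> \<open>The weak gradient is known to be measurable only after restriction to compact
    sets. Inserting the indicator of \<open>K\<close> changes nothing under the integral, since the
    other factor vanishes off \<open>K\<close>.\<close>
  have fl: "flux (H x) \<bullet> D x = flux (indicator K x *\<^sub>R H x) \<bullet> D x" for H :: "'a \<Rightarrow> 'a" and x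
    using K(4)[of x] by (cases "x \<in> K") auto
  have bl: "B (norm (H x)) * \<phi> x = B (norm (indicator K x *\<^sub>R H x)) * \<phi> x" for H :: "'a \<Rightarrow> 'a" and x
    using K(3)[of x] by (cases "x \<in> K") auto
  have out: "\<phi> x = 0" "D x = 0" if "x \<notin> \<Omega>" for x using that K UO by blast+
  have I1: "(LINT x:\<Omega>|lebesgue. A (norm (Du x)) * (Du x \<bullet> D x)) = integral\<^sup>L lebesgue (\<lambda>x. flux (G x) \<bullet> D x)"
  proof -
    have "(LINT x:\<Omega>|lebesgue. A (norm (Du x)) * (Du x \<bullet> D x)) = integral\<^sup>L lebesgue (\<lambda>x. flux (Du x) \<bullet> D x)"
      by (subst set_integral_vanishing_outside) (auto simp: flux_def out)
    also have "\<dots> = integral\<^sup>L lebesgue (\<lambda>x. flux (G x) \<bullet> D x)"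
      unfolding fl[of Du] fl[of G]
    proof (rule integral_cong_AE)
      show "AE x in lebesgue. flux (indicator K x *\<^sub>R Du x) \<bullet> D x = flux (indicator K x *\<^sub>R G x) \<bullet> D x"
        using ae by eventually_elim (use K(2) in \<open>auto simp: indicator_def\<close>)
    qed measurable
    finally show ?thesis .
  qed
  have I2: "(LINT x:\<Omega>|lebesgue. B (norm (Du x)) * \<phi> x) = integral\<^sup>L lebesgue (\<lambda>x. B (norm (G x)) * \<phi> x)"
  proof -
    have "(LINT x:\<Omega>|lebesgue. B (norm (Du x)) * \<phi> x) = integral\<^sup>L lebesgue (\<lambda>x. B (norm (Du x)) * \<phi> x)"
      by (rule set_integral_vanishing_outside) (simp add: out)
    also have "\<dots> = integral\<^sup>L lebesgue (\<lambda>x. B (norm (G x)) * \<phi> x)"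
      unfolding bl[of Du] bl[of G]
    proof (rule integral_cong_AE)
      show "AE x in lebesgue. B (norm (indicator K x *\<^sub>R Du x)) * \<phi> x = B (norm (indicator K x *\<^sub>R G x)) * \<phi> x"
        using ae by eventually_elim (use K(2) in \<open>auto simp: indicator_def\<close>)
    qed measurable
    finally show ?thesis .
  qed
  have I3: "(LINT x:\<Omega>|lebesgue. h x * \<phi> x) = integral\<^sup>L lebesgue (\<lambda>x. h x * \<phi> x)" for h
    by (rule set_integral_vanishing_outside) (simp add: out)
  have uc: "continuous_on U u" using u(1) by (rule GDERIV_continuous_on)
  have un: "u x \<noteq> 0 \<and> x \<noteq> 0" if "x \<in> U" for x using u(3)[OF that] that by (auto simp: U)
  have c1: "continuous_on U (\<lambda>x. u x powr q / norm x powr p)"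
    using un by (intro continuous_intros uc) auto
  have c2: "continuous_on U (\<lambda>x. B (norm (G x)))" by (intro continuous_on_compose2[OF Bn] u(2)) auto
  have i1: "integrable lebesgue (\<lambda>x. u x powr q / norm x powr p * \<phi> x)"
    by (rule integrable_lebesgue_continuous_mult[OF c1 C1c_D(3)[OF \<phi>] K(1,2,3)])
  have i2: "integrable lebesgue (\<lambda>x. B (norm (G x)) * \<phi> x)"
    by (rule integrable_lebesgue_continuous_mult[OF c2 C1c_D(3)[OF \<phi>] K(1,2,3)])
  have i3: "integrable lebesgue (\<lambda>x. f x * \<phi> x)"
    by (rule L_infinity_mult_integrable[OF f C1c_D(3)[OF \<phi>] K(1) order_trans[OF K(2) UO] K(3)])
  have "integral\<^sup>L lebesgue (\<lambda>x. (\<theta> * (u x powr q / norm x powr p) + f x - B (norm (G x))) * \<phi> x)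
    = integral\<^sup>L lebesgue (\<lambda>x. \<theta> * (u x powr q / norm x powr p * \<phi> x) + f x * \<phi> x - B (norm (G x)) * \<phi> x)"
    by (simp add: algebra_simps)
  also have "\<dots> = \<theta> * integral\<^sup>L lebesgue (\<lambda>x. u x powr q / norm x powr p * \<phi> x) + integral\<^sup>L lebesgue (\<lambda>x. f x * \<phi> x)
     - integral\<^sup>L lebesgue (\<lambda>x. B (norm (G x)) * \<phi> x)"
    unfolding Bochner_Integration.integral_diff[OF Bochner_Integration.integrable_add[OF integrable_mult_right[OF i1, of \<theta>] i3] i2]
      Bochner_Integration.integral_add[OF integrable_mult_right[OF i1, of \<theta>] i3]
      integral_mult_right_zero[of lebesgue \<theta>] by (rule refl)
  finally show ?thesis
    using eq[rule_format, OF conjI, OF C1c_W0_1p[OF \<phi>\<Omega> \<Omega> p] C1c_weak_gradient[OF \<phi>\<Omega> \<Omega>]]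
    unfolding I1 I2 I3 by simp
qed

text \<open>After multiplication by a cutoff that is 1 near \<open>x0\<close>, the solution fits
  \<open>flux_equation\<close>. The source then integrates to zero over the critical set against a
  positive weight, while it is positive there almost everywhere; this leaves only a null
  set.\<close>

lemma critical_points_null_near:
  fixes u f :: "'a::euclidean_space \<Rightarrow> real"
  assumes \<Omega>: "open \<Omega>" and p: "0 < p" and \<theta>: "0 < \<theta>" and sol: "weak_solution \<Omega> p q \<theta> A B f u" and U: "U = \<Omega> - {0}"
    and u: "\<And>x. x \<in> U \<Longrightarrow> GDERIV u x :> G x" "continuous_on U G" "\<And>x. x \<in> U \<Longrightarrow> 0 < u x"
    and B: "continuous_on {0..} B" "B 0 = 0" and f: "f \<in> L_infinity \<Omega>" "AE x\<in>\<Omega> in lebesgue. 0 \<le> f x"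
    and x0: "x0 \<in> U"
  obtains R where "0 < R" "{x \<in> ball x0 R. G x = 0} \<in> null_sets lebesgue"
proof -
  have oU: "open U" and UO: "U \<subseteq> \<Omega>" using \<Omega> by (auto simp: U)
  obtain r where r: "0 < r" "cball x0 r \<subseteq> U" using open_contains_cball[of U] oU x0 by blast
  define R where "R = r / 3"
  have R: "0 < R" "cball x0 (3 * R) \<subseteq> U" using r by (auto simp: R_def)
  have b3: "ball x0 (3 * R) \<subseteq> U" and b2: "ball x0 (2 * R) \<subseteq> U" and cb2: "cball x0 (2 * R) \<subseteq> U"
    using R(2) subset_ball[of "2 * R" "3 * R" x0] subset_cball[of "2 * R" "3 * R" x0] ball_subset_cball[of x0 "3 * R"] R(1) by auto
  obtain \<zeta> Z where \<zeta>: "C1c (ball x0 (3 * R)) \<zeta> Z" "\<And>x. x \<in> ball x0 (2 * R) \<Longrightarrow> \<zeta> x = 1 \<and> Z x = 0"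
    using plateau_cutoff[OF R(1), of x0] by blast
  \<comment> \<open>Cutting off extends u to the whole space with a uniformly continuous gradient.
    On the ball of radius \<open>2 * R\<close> the gradient is unchanged, so the equation is not
    affected.\<close>
  define v where "v x = \<zeta> x * u x" for x
  define H where "H x = \<zeta> x *\<^sub>R G x + u x *\<^sub>R Z x" for x
  have v: "C1c U v H" unfolding v_def[abs_def] H_def[abs_def]
    by (rule C1c_mult[OF C1c_mono[OF \<zeta>(1) b3] oU u(1,2)])
  have HG: "H x = G x" if "x \<in> ball x0 (2 * R)" for x using \<zeta>(2)[OF that] by (simp add: H_def)
  obtain Kv where Kv: "compact Kv" "\<And>x. x \<notin> Kv \<Longrightarrow> H x = 0" using v by (rule C1c_support) blast
  obtain L where L: "0 < L" "\<And>x. norm (H x) \<le> L" using bounded_continuous_compact_support[OF C1c_D(2)[OF v] Kv] by auto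

  define g0 where "g0 x = \<theta> * (u x powr q / norm x powr p) + f x - B (norm (G x))" for x
  have uc: "continuous_on U u" using u(1) by (rule GDERIV_continuous_on)
  define k0 where "k0 x = \<theta> * (u x powr q / norm x powr p) - B (norm (G x))" for x
  have un: "u x \<noteq> 0 \<and> x \<noteq> 0" if "x \<in> U" for x using u(3)[OF that] that by (auto simp: U)
  have k0c: "continuous_on U k0"
    unfolding k0_def using un by (intro continuous_intros uc u(2) continuous_on_compose2[OF B(1)]) auto
  obtain Bk where Bk: "\<And>x. x \<in> cball x0 (2 * R) \<Longrightarrow> \<bar>k0 x\<bar> \<le> Bk"
  proof -
    have "compact (k0 ` cball x0 (2 * R))" by (intro compact_continuous_image continuous_on_subset[OF k0c cb2]) auto
    then obtain b where "\<forall>y\<in>k0 ` cball x0 (2 * R). norm y \<le> b" using compact_imp_bounded bounded_iff by metis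
    then show ?thesis using that[of b] by auto
  qed
  obtain Mf where Mf: "AE x\<in>\<Omega> in lebesgue. norm (f x) \<le> Mf" using f by (auto simp: L_infinity_def)
  define Bg where "Bg = \<bar>Bk\<bar> + \<bar>Mf\<bar>"
  define b where "b = ball x0 (2 * R)"
  have bs [measurable]: "b \<in> sets borel" by (simp add: b_def)
  have g0m: "(\<lambda>x. indicator b x * g0 x) \<in> borel_measurable lebesgue"
  proof -
    have "set_integrable lborel (cball x0 (2 * R)) k0"
      unfolding set_integrable_def by (intro borel_integrable_compact continuous_on_subset[OF k0c cb2]) auto
    then have "(\<lambda>x. indicator (cball x0 (2 * R)) x *\<^sub>R k0 x) \<in> borel_measurable lborel"
      unfolding set_integrable_def by (rule borel_measurable_integrable)
    then have 1: "(\<lambda>x. indicator (cball x0 (2 * R)) x *\<^sub>R k0 x) \<in> borel_measurable lebesgue" by (rule measurable_completion)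
    have 2: "(\<lambda>x. indicator \<Omega> x *\<^sub>R f x) \<in> borel_measurable lebesgue" using f(1) by (simp add: L_infinity_def set_borel_measurable_def)
    have 3: "(\<lambda>x. indicator b x :: real) \<in> borel_measurable lebesgue" by (rule measurable_completion) measurable
    have "indicator b x * g0 x = indicator b x * (indicator (cball x0 (2 * R)) x *\<^sub>R k0 x + indicator \<Omega> x *\<^sub>R f x)" for x
      using b2 UO by (auto simp: b_def g0_def k0_def indicator_def subset_iff)
    then show ?thesis using borel_measurable_times[OF 3 borel_measurable_add[OF 1 2]] by (simp only:)
  qed
  then obtain g1 where g1: "g1 \<in> borel_measurable lborel" "AE x in lborel. indicator b x * g0 x = g1 x"
    using completion_ex_borel_measurable_real by blast
  \<comment> \<open>\<open>g1\<close> is a Borel representative of the Lebesgue measurable source.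
    Clipping at \<open>Bg\<close> makes the bound hold at every point, and the indicator provides
    the support condition; both alter it on a null set only.\<close>
  define g where "g x = indicator b x * max (- Bg) (min Bg (g1 x))" for x
  have g1' [measurable]: "g1 \<in> borel_measurable borel" using g1(1) by simp
  have gm [measurable]: "g \<in> borel_measurable borel" unfolding g_def by measurable
  have gae: "AE x in lebesgue. g x = indicator b x * g0 x"
    using AE_completion[OF g1(2)] Mf
  proof eventually_elim
    case (elim x)
    show ?case
    proof (cases "x \<in> b")
      case True
      then have "x \<in> cball x0 (2 * R)" "x \<in> \<Omega>" using b2 UO by (auto simp: b_def)
      then have "\<bar>g0 x\<bar> \<le> Bg" using Bk[of x] elim(2) by (auto simp: g0_def k0_def Bg_def)
      then show ?thesis using elim(1) True by (simp add: g_def)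
    qed (simp add: g_def)
  qed
  interpret flux_equation A A' c0 M v H L g Bg x0 R
  proof
    show "GDERIV v x :> H x" for x by (rule C1c_D(1)[OF v])
    show "uniformly_continuous_on UNIV H" by (rule uniformly_continuous_compact_support[OF C1c_D(2)[OF v] Kv])
    show "\<bar>g x\<bar> \<le> Bg" for x
    proof -
      have "0 \<le> Bg" by (simp add: Bg_def)
      then show ?thesis by (auto simp: g_def indicator_def)
    qed
    show "g x = 0" if "x \<notin> ball x0 (2 * R)" for x using that by (simp add: g_def b_def)
    fix \<phi> D assume \<phi>: "C1c (ball x0 (2 * R)) \<phi> D"
    obtain K where K: "compact K" "K \<subseteq> b" "\<And>x. x \<notin> K \<Longrightarrow> \<phi> x = 0" "\<And>x. x \<notin> K \<Longrightarrow> D x = 0"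
      using \<phi> unfolding b_def by (rule C1c_support) blast
    have [measurable]: "\<phi> \<in> borel_measurable borel" "D \<in> borel_measurable borel" "H \<in> borel_measurable borel"
      using borel_measurable_continuous_onI[OF C1c_D(3)[OF \<phi>]] borel_measurable_continuous_onI[OF C1c_D(2)[OF \<phi>]]
        borel_measurable_continuous_onI[OF C1c_D(2)[OF v]] by auto
    have "(LBINT x. flux (H x) \<bullet> D x) = integral\<^sup>L lebesgue (\<lambda>x. flux (H x) \<bullet> D x)"
      by (rule integral_completion[symmetric]) measurable
    also have "\<dots> = integral\<^sup>L lebesgue (\<lambda>x. flux (G x) \<bullet> D x)"
    proof (rule Bochner_Integration.integral_cong[OF refl])
      fix x show "flux (H x) \<bullet> D x = flux (G x) \<bullet> D x" using K(2) K(4)[of x] HG[of x] by (cases "x \<in> K") (auto simp: b_def)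
    qed
    also have "\<dots> = integral\<^sup>L lebesgue (\<lambda>x. g0 x * \<phi> x)"
      unfolding g0_def by (rule weak_solution_local_equation[OF \<Omega> p sol U u B(1) f(1) C1c_mono[OF \<phi> b2]])
    also have "\<dots> = integral\<^sup>L lebesgue (\<lambda>x. indicator b x * g0 x * \<phi> x)"
    proof (rule Bochner_Integration.integral_cong[OF refl])
      fix x show "g0 x * \<phi> x = indicator b x * g0 x * \<phi> x" using K(2) K(3)[of x] by (cases "x \<in> K") auto
    qed
    also have "\<dots> = integral\<^sup>L lebesgue (\<lambda>x. g x * \<phi> x)"
    proof (rule integral_cong_AE)
      have \<phi>m: "\<phi> \<in> borel_measurable lebesgue" by (rule measurable_completion) simp
      have gl: "g \<in> borel_measurable lebesgue" by (rule measurable_completion) simp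
      show "(\<lambda>x. indicator b x * g0 x * \<phi> x) \<in> borel_measurable lebesgue" by (rule borel_measurable_times[OF g0m \<phi>m])
      show "(\<lambda>x. g x * \<phi> x) \<in> borel_measurable lebesgue" by (rule borel_measurable_times[OF gl \<phi>m])
      show "AE x in lebesgue. indicator b x * g0 x * \<phi> x = g x * \<phi> x" using gae by eventually_elim simp
    qed
    also have "\<dots> = (LBINT x. g x * \<phi> x)" by (rule integral_completion) measurable
    finally show "(LBINT x. flux (H x) \<bullet> D x) = (LBINT x. g x * \<phi> x)" .
  qed (use L R(1) gm in auto)

  define F where "F x = g x * (cap x0 R x ^ 4 * indicator {x. H x = 0} x)" for x
  have cl: "closed {x. H x = 0}" by (intro closed_Collect_eq continuous_intros C1c_D(2)[OF v])
  then have [measurable]: "{x. H x = 0} \<in> sets borel" by simp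
  have capm [measurable]: "cap x0 R \<in> borel_measurable borel" by (rule borel_measurable_continuous_onI[OF cap_continuous])
  have Fm: "F \<in> borel_measurable borel" unfolding F_def by measurable
  have F0: "(LBINT x. F x) = 0" unfolding F_def by (rule source_vanishes_on_critical_set)
  \<comment> \<open>At a critical point the absorption term equals \<open>B 0 = 0\<close>,
    \<open>f\<close> is nonnegative almost everywhere, and the Hardy term is strictly positive
    because u is.\<close>
  have pos: "AE x in lebesgue. x \<in> ball x0 R \<and> G x = 0 \<longrightarrow> 0 < g x"
    using gae f(2)
  proof eventually_elim
    case (elim x)
    show ?case
    proof (intro impI)
      assume x: "x \<in> ball x0 R \<and> G x = 0"
      then have xb: "x \<in> b" using R(1) by (auto simp: b_def)
      then have xU: "x \<in> U" using b2 by (auto simp: b_def)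
      then have "0 \<le> f x" using elim UO by auto
      moreover have "0 < \<theta> * (u x powr q / norm x powr p)" using \<theta> u(3)[OF xU] xU by (auto simp: U)
      ultimately show "0 < g x" using elim(1) xb x B(2) by (simp add: g0_def)
    qed
  qed
  have HGR: "H x = G x" if "x \<in> ball x0 R" for x using that R(1) by (intro HG) auto
  have capR: "0 < cap x0 R x" if "x \<in> ball x0 R" for x
  proof -
    have "(norm (x - x0))\<^sup>2 < R\<^sup>2" using that by (intro power_strict_mono) (auto simp: dist_norm norm_minus_commute)
    then show ?thesis by (simp add: cap_def)
  qed
  have cap0: "cap x0 R x = 0" if "x \<notin> ball x0 R" for x
  proof -
    have "R\<^sup>2 \<le> (norm (x - x0))\<^sup>2" using that R(1) by (intro power_mono) (auto simp: dist_norm norm_minus_commute)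
    then show ?thesis by (simp add: cap_def)
  qed
  have Fn: "AE x in lebesgue. 0 \<le> F x"
    using pos
  proof eventually_elim
    case (elim x)
    then show ?case using HGR[of x] cap0[of x] cap_nonneg[of x0 R x]
      by (cases "x \<in> ball x0 R") (auto simp: F_def indicator_def less_imp_le)
  qed
  have iF: "integrable lebesgue F"
  proof -
    have "integrable lborel F"
    proof (rule Bochner_Integration.integrable_bound)
      show "integrable lborel (\<lambda>x. Bg * cap x0 R x ^ 4)"
        by (intro integrable_mult_right integrable_continuous_compact_support[of _ "cball x0 R"])
          (auto intro!: continuous_intros cap_continuous simp: cap_outside R(1))
      show "AE x in lborel. norm (F x) \<le> norm (Bg * cap x0 R x ^ 4)"
      proof (intro always_eventually allI)
        fix x
        have "\<bar>g x\<bar> * cap x0 R x ^ 4 \<le> \<bar>Bg\<bar> * cap x0 R x ^ 4" using g_bound[of x] cap_nonneg[of x0 R x]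
          by (intro mult_right_mono) auto
        then show "norm (F x) \<le> norm (Bg * cap x0 R x ^ 4)"
          using cap_nonneg[of x0 R x] by (auto simp: F_def indicator_def abs_mult)
      qed
    qed (use Fm in simp)
    then show ?thesis using Fm by (subst integrable_completion) auto
  qed
  have "integral\<^sup>L lebesgue F = 0" using F0 Fm by (subst integral_completion) auto
  then have "AE x in lebesgue. F x = 0" using integral_nonneg_eq_0_iff_AE[OF iF Fn] by simp
  then have ae: "AE x in lebesgue. x \<notin> {x \<in> ball x0 R. G x = 0}"
    using pos
  proof eventually_elim
    case (elim x)
    show ?case
    proof
      assume "x \<in> {x \<in> ball x0 R. G x = 0}"
      then have x: "x \<in> ball x0 R" "G x = 0" by auto
      then have "0 < F x" using elim(2) capR[OF x(1)] HGR[OF x(1)] by (simp add: F_def)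
      then show False using elim(1) by simp
    qed
  qed
  have "{x \<in> ball x0 R. G x = 0} = ball x0 R \<inter> {x. H x = 0}" using HGR by auto
  then have ms: "{x \<in> ball x0 R. G x = 0} \<in> sets lebesgue" using cl by auto
  then have "{x \<in> ball x0 R. G x = 0} \<in> null_sets lebesgue"
    using AE_iff_null_sets[OF ms] ae by simp
  then show thesis using that[OF R(1)] by blast
qed

end

text \<open>A real c is chosen strictly between -1 and the lower index, so that \<open>1 + c\<close>
  is a positive ellipticity constant, capped at 1. Finiteness of the upper index gives an integer
  above it, which serves as \<open>M\<close>.\<close>

lemma elliptic_profileI:
  assumes A_pos: "\<And>t. 0 < t \<Longrightarrow> 0 < A t" and A_C1: "A C1_differentiable_on {0<..}"
    and A_mono: "mono_on {0<..} (\<lambda>t. t * A t)" and idx: "- 1 < lower_index A" "upper_index A < \<infinity>"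
  obtains A' c0 M where "elliptic_profile A A' c0 M"
proof -
  obtain A' where A': "\<And>t. 0 < t \<Longrightarrow> (A has_real_derivative A' t) (at t)" "continuous_on {0<..} A'"
    using A_C1 unfolding C1_differentiable_on_def has_real_derivative_iff_has_vector_derivative by (metis greaterThan_iff)
  have dA: "deriv A t = A' t" if "0 < t" for t by (rule DERIV_imp_deriv[OF A'(1)[OF that]])
  obtain c where c: "- 1 < ereal c" "ereal c < lower_index A" using ereal_dense2[OF idx(1)] by blast
  have lo: "c * A t \<le> t * A' t" if t: "0 < t" for t
  proof -
    have "lower_index A \<le> ereal (t * deriv A t / A t)" unfolding lower_index_def by (rule INF_lower) (use t in simp)
    then have "ereal c \<le> ereal (t * A' t / A t)" using c(2) dA[OF t] by (metis less_imp_le order_trans)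
    then show ?thesis using A_pos[OF t] by (simp add: field_simps)
  qed
  obtain n :: nat where n: "upper_index A < ereal (real n)" using idx(2) less_PInf_Ex_of_nat by auto
  have up: "t * A' t \<le> real n * A t" if t: "0 < t" for t
  proof -
    have "ereal (t * deriv A t / A t) \<le> upper_index A" unfolding upper_index_def by (rule SUP_upper) (use t in simp)
    then have "ereal (t * A' t / A t) \<le> ereal (real n)" using n dA[OF t] by (metis less_imp_le order_trans)
    then show ?thesis using A_pos[OF t] by (simp add: field_simps)
  qed
  have c1: "- 1 < c" using c(1) by (simp add: one_ereal_def)
  have "elliptic_profile A A' (min 1 (1 + c)) (real n)"
  proof
    fix t :: real assume t: "0 < t"
    have "(min 1 (1 + c) - 1) * A t \<le> c * A t" using A_pos[OF t] by (intro mult_right_mono) auto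
    then show "(min 1 (1 + c) - 1) * A t \<le> t * A' t" using lo[OF t] by linarith
  qed (use A_pos A' A_mono up c1 in auto)
  then show thesis by (rule that)
qed

text \<open>Every point of the punctured domain has a ball in which the critical points form a null
  set. The punctured domain is not compact, so countably many such balls are extracted by the
  Lindelof property, which suffices for a null union.\<close>

theorem mainTheorem5:
  fixes \<Omega> :: "(real ^ 'n) set"
    and p q \<theta> K c1 c2 \<sigma> C :: real
    and A B B' :: "real \<Rightarrow> real"
    and f u :: "real ^ 'n \<Rightarrow> real"
  assumes domain: "smooth_bounded_domain \<Omega>" "0 \<in> \<Omega>"
    and exponents: "1 < p" "p < real CARD('n)" "p - 1 < q" "q < p" "0 < \<theta>"
    and A_pos: "\<And>t. 0 < t \<Longrightarrow> 0 < A t"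
    and A_C1: "A C1_differentiable_on {0<..}"
    and A_constants: "1 \<le> K" "0 < c1" "0 < c2"
    and A_mono: "mono_on {0<..} (\<lambda>t. t * A t)"
    and A_growth: "\<And>\<eta> :: real ^ 'n. K \<le> norm \<eta> \<Longrightarrow>
          norm (A (norm \<eta>) *\<^sub>R \<eta>) \<le> c1 * norm \<eta> powr (p - 1)"
    and A_elliptic: "\<And>\<eta> \<eta>' :: real ^ 'n. \<eta> \<noteq> 0 \<or> \<eta>' \<noteq> 0 \<Longrightarrow>
          c2 * (norm \<eta> + norm \<eta>') powr (p - 2) * (norm (\<eta> - \<eta>'))\<^sup>2
            \<le> (A (norm \<eta>) *\<^sub>R \<eta> - A (norm \<eta>') *\<^sub>R \<eta>') \<bullet> (\<eta> - \<eta>')"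
    and A_index: "- 1 < lower_index A" "upper_index A < \<infinity>"
    and B_nonneg: "\<And>t. 0 \<le> t \<Longrightarrow> 0 \<le> B t"
    and B_C1: "\<And>t. 0 \<le> t \<Longrightarrow> (B has_real_derivative B' t) (at t within {0..})"
      "continuous_on {0..} B'"
    and B_zero: "B 0 = 0"
    and B_constants: "0 < \<sigma>" "0 < C"
    and B_lower: "\<And>t. 0 \<le> t \<Longrightarrow> \<sigma> * t powr p \<le> B t"
    and B_deriv: "\<And>t. 0 < t \<Longrightarrow> B' t \<le> C * t * A t"
    and f: "f \<in> W_1_infinity \<Omega>" "AE x\<in>\<Omega> in lebesgue. 0 \<le> f x"
    and u_C1: "C1_closure_minus_origin \<Omega> u"
    and u_pos: "\<And>x. x \<in> \<Omega> - {0} \<Longrightarrow> 0 < u x"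
    and u_boundary: "\<And>x. x \<in> frontier \<Omega> \<Longrightarrow> u x = 0"
    and u_solution: "weak_solution \<Omega> p q \<theta> A B f u"
  shows "critical_set \<Omega> u \<in> null_sets lebesgue"
proof -
  have \<Omega>: "open \<Omega>" using domain(1) by (simp add: smooth_bounded_domain_def)
  obtain A' c0 M where "elliptic_profile A A' c0 M" by (rule elliptic_profileI[OF A_pos A_C1 A_mono A_index])
  then interpret elliptic_profile A A' c0 M .
  define U where "U = \<Omega> - {0}"
  have oU: "open U" using \<Omega> by (auto simp: U_def)
  obtain G where "continuous_on (closure \<Omega> - {0}) G" and uG: "\<And>x. x \<in> U \<Longrightarrow> GDERIV u x :> G x"
    using u_C1 by (auto simp: C1_closure_minus_origin_def U_def)
  then have Gc: "continuous_on U G"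
    by (rule_tac continuous_on_subset) (use closure_subset in \<open>auto simp: U_def\<close>)
  have Bc: "continuous_on {0..} B" using B_C1(1) by (intro DERIV_continuous_on) auto
  have fi: "f \<in> L_infinity \<Omega>" using f(1) by (simp add: W_1_infinity_def)
  have p0: "0 < p" using exponents by simp
  define small where "small x0 r \<longleftrightarrow> 0 < r \<and> {x \<in> ball x0 r. G x = 0} \<in> null_sets lebesgue" for x0 r
  have "\<exists>r. small x0 r" if "x0 \<in> U" for x0
    unfolding small_def
    by (rule critical_points_null_near[OF \<Omega> p0 exponents(5) u_solution U_def uG Gc _ Bc B_zero fi f(2) that])
      (use u_pos in \<open>auto simp: U_def\<close>)
  then obtain R where "\<And>x. x \<in> U \<Longrightarrow> small x (R x)" by metis
  then have R: "\<And>x. x \<in> U \<Longrightarrow> 0 < R x" "\<And>x. x \<in> U \<Longrightarrow> {y \<in> ball x (R x). G y = 0} \<in> null_sets lebesgue"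
    by (auto simp: small_def)
  have op: "\<And>S. S \<in> (\<lambda>x. ball x (R x)) ` U \<Longrightarrow> open S" by auto
  obtain \<F> where F: "\<F> \<subseteq> (\<lambda>x. ball x (R x)) ` U" "countable \<F>" "\<Union>\<F> = \<Union>((\<lambda>x. ball x (R x)) ` U)"
    by (rule Lindelof[OF op]) blast+
  have "critical_set \<Omega> u = {x \<in> U. G x = 0}"
    using gradient_eq[OF uG] by (auto simp: critical_set_def U_def)
  also have "\<dots> \<subseteq> (\<Union>S\<in>\<F>. {y \<in> S. G y = 0})"
  proof
    fix x assume x: "x \<in> {x \<in> U. G x = 0}"
    then have "x \<in> \<Union>((\<lambda>x. ball x (R x)) ` U)" using R(1)[of x] by (auto intro!: bexI[of _ x])
    then obtain S where "S \<in> \<F>" "x \<in> S" using F(3) by blast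
    then show "x \<in> (\<Union>S\<in>\<F>. {y \<in> S. G y = 0})" using x by auto
  qed
  finally have sub: "critical_set \<Omega> u \<subseteq> (\<Union>S\<in>\<F>. {y \<in> S. G y = 0})" .
  have "(\<Union>S\<in>\<F>. {y \<in> S. G y = 0}) \<in> null_sets lebesgue"
    by (rule null_sets_UN'[OF F(2)]) (use F(1) R(2) in auto)
  with sub show ?thesis by (rule null_sets_completion_subset)
qed

end
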